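(* Let $N\ge 1$ be an integer, $\mu>0$, $R>0$, and let $p,q>1$, with $q\le \frac{2N}{N-2}$ if $N\ge 3$, satisfy $$\lambda(p,q,N+\mu)<4,\qquad p>p_G(N+\mu),\qquad q>q_S(N+\mu),$$ where $\lambda$, $p_G$, $q_S$ are the quantities defined in the context. Assume that $f\in H^1(\mathbb{R}^N)$ and $g\in L^2(\mathbb{R}^N)$ are non-negative functions which are compactly supported in $B_{\mathbb{R}^N}(0,R)$ and neither of which vanishes everywhere. Then there exist a constant $\varepsilon_0=\varepsilon_0(f,g,N,R,p,q,\mu)>0$ and a constant $C>0$ independent of $\varepsilon$ such that the following holds for every $0<\varepsilon\le\varepsilon_0$: if $u$ is an energy solution on $[0,T_\varepsilon)$ of $$u_{tt}-\Delta u+\frac{\mu}{1+t}u_t=|u_t|^p+|u|^q \ \text{ in } \mathbb{R}^N\times[0,\infty),\qquad u(x,0)=\varepsilon f(x),\quad u_t(x,0)=\varepsilon g(x),\quad x\in\mathbb{R}^N,$$ such that $\mathrm{supp}(u)\subset\{(x,t)\in\mathbb{R}^N\times[0,\infty): |x|\le t+R\}$, then $$T_\varepsilon\le C\,\varepsilon^{-\frac{2p(q-1)}{4-\lambda(p,q,N+\mu)}}.$$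
   Context: For real $n>1$ put $$\lambda(p,q,n):=(q-1)\big((n-1)p-2\big),\qquad p_G(n):=1+\frac{2}{n-1},\qquad q_S(n):=\frac{n+1+\sqrt{n^2+10n-7}}{2(n-1)}.$$ Energy (weak) solution: $u$ is an energy solution of the Cauchy problem on $[0,T)$ if $u\in \mathcal{C}([0,T),H^1(\mathbb{R}^N))\cap \mathcal{C}^1([0,T),L^2(\mathbb{R}^N))$, $u\in L^q_{loc}((0,T)\times\mathbb{R}^N)$, $u_t\in L^p_{loc}((0,T)\times\mathbb{R}^N)$, the initial conditions $u(\cdot,0)=\varepsilon f$, $u_t(\cdot,0)=\varepsilon g$ hold, and for all $\Phi\in\mathcal{C}_0^\infty(\mathbb{R}^N\times[0,T))$ and all $t\in[0,T)$, $$\int_{\mathbb{R}^N}u_t(x,t)\Phi(x,t)\,dx-\int_{\mathbb{R}^N}u_t(x,0)\Phi(x,0)\,dx-\int_0^t\int_{\mathbb{R}^N}u_t(x,s)\Phi_t(x,s)\,dx\,ds+\int_0^t\int_{\mathbb{R}^N}\nabla u(x,s)\cdot\nabla\Phi(x,s)\,dx\,ds$$ $$+\int_0^t\int_{\mathbb{R}^N}\frac{\mu}{1+s}u_t(x,s)\Phi(x,s)\,dx\,ds=\int_0^t\int_{\mathbb{R}^N}\big\{|u_t(x,s)|^p+|u(x,s)|^q\big\}\Phi(x,s)\,dx\,ds.$$ *)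

theory Defs
  imports "HOL-Analysis.Analysis"
begin

definition lam :: "real \<Rightarrow> real \<Rightarrow> real \<Rightarrow> real" where
  "lam p q n = (q - 1) * ((n - 1) * p - 2)"

definition p_Glassey :: "real \<Rightarrow> real" where
  "p_Glassey n = 1 + 2 / (n - 1)"

definition q_Strauss :: "real \<Rightarrow> real" where
  "q_Strauss n = (n + 1 + sqrt (n\<^sup>2 + 10 * n - 7)) / (2 * (n - 1))"

primrec C_k :: "nat \<Rightarrow> ('a::real_normed_vector \<Rightarrow> real) \<Rightarrow> bool" where
  "C_k 0 \<phi> \<longleftrightarrow> continuous_on UNIV \<phi>"
| "C_k (Suc k) \<phi> \<longleftrightarrow> (\<forall>x. \<phi> differentiable (at x)) \<and>
     (\<forall>v. C_k k (\<lambda>x. frechet_derivative \<phi> (at x) v))"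

definition test_function :: "('a::real_normed_vector \<Rightarrow> real) \<Rightarrow> bool" where
  "test_function \<phi> \<longleftrightarrow> (\<forall>k. C_k k \<phi>) \<and> compact (closure {x. \<phi> x \<noteq> 0})"

definition grad :: "('a::euclidean_space \<Rightarrow> real) \<Rightarrow> 'a \<Rightarrow> 'a" where
  "grad \<phi> x = (\<Sum>b\<in>Basis. frechet_derivative \<phi> (at x) b *\<^sub>R b)"

text \<open>Elements of the Lebesgue and Sobolev spaces are represented by measurable
  functions, and membership, norms and supports are insensitive to changes on null sets.\<close>

definition in_L2 :: "('a::euclidean_space \<Rightarrow> 'b::euclidean_space) \<Rightarrow> bool" where
  "in_L2 v \<longleftrightarrow> v \<in> borel_measurable lebesgue \<and> integrable lebesgue (\<lambda>x. (norm (v x))\<^sup>2)"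

definition norm_L2 :: "('a::euclidean_space \<Rightarrow> 'b::euclidean_space) \<Rightarrow> real" where
  "norm_L2 v = sqrt (LINT x|lebesgue. (norm (v x))\<^sup>2)"

definition is_weak_grad :: "('a::euclidean_space \<Rightarrow> real) \<Rightarrow> ('a \<Rightarrow> 'a) \<Rightarrow> bool" where
  "is_weak_grad v G \<longleftrightarrow> (\<forall>\<phi>. test_function \<phi> \<longrightarrow>
     (LINT x|lebesgue. v x *\<^sub>R grad \<phi> x) = - (LINT x|lebesgue. \<phi> x *\<^sub>R G x))"

definition in_H1 :: "('a::euclidean_space \<Rightarrow> real) \<Rightarrow> bool" where
  "in_H1 v \<longleftrightarrow> in_L2 v \<and> (\<exists>G. in_L2 G \<and> is_weak_grad v G)"

text \<open>The weak gradient, unique up to null sets; meaningful only for functions satisfying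
  \<^const>\<open>in_H1\<close>.\<close>

definition weak_grad :: "('a::euclidean_space \<Rightarrow> real) \<Rightarrow> 'a \<Rightarrow> 'a" where
  "weak_grad v = (SOME G. in_L2 G \<and> is_weak_grad v G)"

definition norm_H1 :: "('a::euclidean_space \<Rightarrow> real) \<Rightarrow> real" where
  "norm_H1 v = sqrt ((norm_L2 v)\<^sup>2 + (norm_L2 (weak_grad v))\<^sup>2)"

definition in_Lp_loc :: "real \<Rightarrow> 'a::euclidean_space set \<Rightarrow> ('a \<Rightarrow> real) \<Rightarrow> bool" where
  "in_Lp_loc p S v \<longleftrightarrow> v \<in> borel_measurable (lebesgue_on S) \<and>
     (\<forall>K. compact K \<and> K \<subseteq> S \<longrightarrow> set_integrable lebesgue K (\<lambda>z. \<bar>v z\<bar> powr p))"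

text \<open>The support of (the class of) a measurable function on \<open>S\<close>, relative to \<open>S\<close>.\<close>

definition ess_supp :: "'a::euclidean_space set \<Rightarrow> ('a \<Rightarrow> real) \<Rightarrow> 'a set" where
  "ess_supp S v = {z \<in> S. \<forall>U. open U \<and> z \<in> U \<longrightarrow>
     \<not> (AE w in lebesgue. w \<in> U \<inter> S \<longrightarrow> v w = 0)}"

text \<open>The interval \<open>[0,T)\<close>, where \<open>T = \<infinity>\<close> is allowed.\<close>

definition time_ivl :: "ereal \<Rightarrow> real set" where
  "time_ivl T = {t. 0 \<le> t \<and> ereal t < T}"

definition C0_H1 :: "real set \<Rightarrow> (real \<Rightarrow> 'a::euclidean_space \<Rightarrow> real) \<Rightarrow> bool" where
  "C0_H1 J u \<longleftrightarrow> (\<forall>t\<in>J. in_H1 (u t)) \<and>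
     (\<forall>t\<in>J. ((\<lambda>s. norm_H1 (\<lambda>x. u s x - u t x)) \<longlongrightarrow> 0) (at t within J))"

definition C0_L2 :: "real set \<Rightarrow> (real \<Rightarrow> 'a::euclidean_space \<Rightarrow> real) \<Rightarrow> bool" where
  "C0_L2 J u \<longleftrightarrow> (\<forall>t\<in>J. in_L2 (u t)) \<and>
     (\<forall>t\<in>J. ((\<lambda>s. norm_L2 (\<lambda>x. u s x - u t x)) \<longlongrightarrow> 0) (at t within J))"

text \<open>\<open>u \<in> C\<^sup>1(J, L\<^sup>2)\<close> with derivative \<open>ut\<close>.\<close>

definition C1_L2 ::
  "real set \<Rightarrow> (real \<Rightarrow> 'a::euclidean_space \<Rightarrow> real) \<Rightarrow> (real \<Rightarrow> 'a \<Rightarrow> real) \<Rightarrow> bool" where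
  "C1_L2 J u ut \<longleftrightarrow> C0_L2 J u \<and> C0_L2 J ut \<and>
     (\<forall>t\<in>J. ((\<lambda>s. norm_L2 (\<lambda>x. (u s x - u t x) / (s - t) - ut t x)) \<longlongrightarrow> 0) (at t within J))"

text \<open>A smooth function with compact support in \<open>\<real>\<^sup>N \<times> [0,T)\<close> (the support may meet
  \<open>t = 0\<close>) is represented by a smooth extension to all times, compactly supported in
  \<open>\<real>\<^sup>N \<times> (-\<infinity>,T)\<close>.\<close>

definition spacetime_test_function :: "ereal \<Rightarrow> ('a::euclidean_space \<times> real \<Rightarrow> real) \<Rightarrow> bool" where
  "spacetime_test_function T \<Phi> \<longleftrightarrow> test_function \<Phi> \<and>
     closure {z. \<Phi> z \<noteq> 0} \<subseteq> {(x, t). ereal t < T}"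

text \<open>Energy solutions of \<open>u\<^sub>t\<^sub>t - \<Delta>u + \<mu>/(1+t) u\<^sub>t = |u\<^sub>t|\<^sup>p + |u|\<^sup>q\<close> on
  \<open>[0,T)\<close> with data \<open>u0\<close>, \<open>u1\<close>; \<open>u t x\<close> stands for \<open>u(x,t)\<close>. The integrability clause makes
  explicit that the nonlinear term of the weak identity is a convergent integral: local
  integrability in the open set \<open>(0,T) \<times> \<real>\<^sup>N\<close> does not give this near \<open>t = 0\<close>, and
  a divergent integral would have the default value 0. The other integrals converge by the
  continuity in time of \<open>u\<close> and \<open>ut\<close>. The conditions \<open>in_Lp_loc\<close> include joint measurability of
  the chosen representatives in \<open>(x,t)\<close>.\<close>

definition energy_solution ::
  "real \<Rightarrow> real \<Rightarrow> real \<Rightarrow> ('a::euclidean_space \<Rightarrow> real) \<Rightarrow> ('a \<Rightarrow> real) \<Rightarrow> ereal \<Rightarrow>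
   (real \<Rightarrow> 'a \<Rightarrow> real) \<Rightarrow> bool" where
  "energy_solution \<mu> p q u0 u1 T u \<longleftrightarrow> 0 < T \<and> C0_H1 (time_ivl T) u \<and>
    in_Lp_loc q (UNIV \<times> (time_ivl T - {0})) (\<lambda>(x, t). u t x) \<and>
    (AE x in lebesgue. u 0 x = u0 x) \<and>
    (\<exists>ut. C1_L2 (time_ivl T) u ut \<and>
      in_Lp_loc p (UNIV \<times> (time_ivl T - {0})) (\<lambda>(x, t). ut t x) \<and>
      (AE x in lebesgue. ut 0 x = u1 x) \<and>
      (\<forall>\<Phi>. spacetime_test_function T \<Phi> \<longrightarrow> (\<forall>t\<in>time_ivl T.
        set_integrable lebesgue (UNIV \<times> {0..t})
          (\<lambda>(x, s). (\<bar>ut s x\<bar> powr p + \<bar>u s x\<bar> powr q) * \<Phi> (x, s)) \<and>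
        (LINT x|lebesgue. ut t x * \<Phi> (x, t))
        - (LINT x|lebesgue. ut 0 x * \<Phi> (x, 0))
        - (LINT s:{0..t}|lebesgue. LINT x|lebesgue. ut s x * deriv (\<lambda>\<tau>. \<Phi> (x, \<tau>)) s)
        + (LINT s:{0..t}|lebesgue. LINT x|lebesgue.
             weak_grad (u s) x \<bullet> grad (\<lambda>y. \<Phi> (y, s)) x)
        + (LINT s:{0..t}|lebesgue. LINT x|lebesgue. \<mu> / (1 + s) * ut s x * \<Phi> (x, s))
        = (LINT s:{0..t}|lebesgue. LINT x|lebesgue.
             (\<bar>ut s x\<bar> powr p + \<bar>u s x\<bar> powr q) * \<Phi> (x, s)))))"

end

theory Submission
  imports Defs "HOL-Real_Asymp.Real_Asymp"
begin

text \<open>Write \<open>h = |u\<^sub>t|\<^sup>p + |u|\<^sup>q\<close> for the source and \<open>N\<close> for the dimension. Since \<open>h \<ge> 0\<close> and \<open>u\<close> vanishes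
outside a light cone, the blow-up can be read off two scalar functions of time: the average
\<open>F = \<integral>u\<close> and the weighted average \<open>G = \<integral>u \<phi>\<close>, where \<open>\<phi> > 0\<close> solves \<open>\<Delta>\<phi> = \<phi>\<close>. Testing the
equation against \<open>(1 + t)\<^sup>\<mu>\<close> and \<open>(1 + t)\<^sup>\<mu> \<phi>\<close>, both cut off outside the support of \<open>u\<close>, absorbs the
damping and gives \<open>((1 + t)\<^sup>\<mu> F')' = (1 + t)\<^sup>\<mu> \<integral>h\<close> and \<open>((1 + t)\<^sup>\<mu> G')' = (1 + t)\<^sup>\<mu> (G + \<integral>h \<phi>)\<close> in
integrated form (\<open>weighted_identity\<close>).

The second identity makes \<open>G\<close> a supersolution of \<open>y'' + \<mu>/(1 + t) y' = y\<close>. Comparison with an explicit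
subsolution that grows like \<open>e\<^sup>t (1 + t) powr (-\<mu>/2)\<close> gives \<open>G' \<ge> c \<epsilon> e\<^sup>t (1 + t) powr (-\<mu>/2)\<close>
(\<open>damped_exponential_growth\<close>). Hoelder's inequality for \<open>G' = \<integral>u\<^sub>t \<phi>\<close> turns this into a lower bound
\<open>\<integral>h \<ge> c \<epsilon>\<^sup>p (1 + t) powr (-\<kappa>)\<close> with \<open>\<kappa> = (N + \<mu> - 1) p/2 - (N - 1)\<close>, provided that the norm of \<open>\<phi>\<close> in
the dual Lebesgue space over a ball of radius \<open>r\<close> has the sharp size. For this, \<open>\<phi>\<close> is taken to be the
mean of the plane waves \<open>exp (x \<bullet> \<omega>)\<close> over the unit vectors \<open>\<omega>\<close>. Mainly the directions close to that
of \<open>x\<close> contribute to it, whence \<open>\<phi>(x) \<le> C exp |x| (1 + |x|) powr (-(N - 1)/2)\<close> (\<open>sphere_mean_le\<close>).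

The first identity now gives \<open>F \<ge> c \<epsilon>\<^sup>p t powr (2 - \<kappa>)\<close>. Hoelder's inequality on the support also gives
\<open>\<integral>h \<ge> c F\<^sup>q (1 + t) powr (-N (q - 1))\<close>, so that on a time interval \<open>[M, 2M]\<close> the function \<open>F\<close> satisfies an
inequality of the type \<open>F'' \<ge> b F\<^sup>q\<close> with \<open>b\<close> of size \<open>M powr (-N (q - 1))\<close>. Such a function doubles
infinitely often within a time of size \<open>(b F(M) powr (q - 1)) powr (-1/2)\<close> (\<open>kato_blow_up\<close>). This time
fits into \<open>[M, 2M]\<close> as soon as \<open>\<epsilon> powr (p (q - 1)) M powr \<theta>\<close> exceeds a constant, where
\<open>\<theta> = (2 - \<kappa>)(q - 1) - N (q - 1) + 2 = (4 - \<lambda>)/2\<close>. Since \<open>\<theta> > 0\<close> is the hypothesis \<open>\<lambda> < 4\<close>, the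
solution cannot live beyond a multiple of \<open>\<epsilon> powr (-p (q - 1)/\<theta>)\<close> (\<open>lifespan_from_averages\<close>).\<close>

section \<open>Calculus of the classes \<open>C_k\<close>\<close>

text \<open>A derivative given explicitly is easier to handle than \<^const>\<open>frechet_derivative\<close>; with this rule and
its converse, each closure property below becomes an induction on the order of differentiability.\<close>

lemma C_k_SucI:
  fixes f :: "'a::real_normed_vector \<Rightarrow> real"
  assumes "\<And>x. (f has_derivative f' x) (at x)" and "\<And>v. C_k k (\<lambda>x. f' x v)"
  shows "C_k (Suc k) f"
proof -
  have "frechet_derivative f (at x) = f' x" for x
    using frechet_derivative_at[OF assms(1)] by simp
  then show ?thesis
    using assms by (auto simp: differentiable_def)
qed

lemma C_k_SucE:
  fixes f :: "'a::real_normed_vector \<Rightarrow> real"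
  assumes "C_k (Suc k) f"
  obtains f' where "\<And>x. (f has_derivative f' x) (at x)" and "\<And>v. C_k k (\<lambda>x. f' x v)"
  using assms that[of "\<lambda>x. frechet_derivative f (at x)"] frechet_derivative_works[of f]
  by auto

lemma C_k_Suc_imp_C_k:
  fixes f :: "'a::real_normed_vector \<Rightarrow> real"
  shows "C_k (Suc k) f \<Longrightarrow> C_k k f"
proof (induction k arbitrary: f)
  case 0
  then show ?case
    by (auto intro!: continuous_at_imp_continuous_on differentiable_imp_continuous_within)
next
  case (Suc k)
  then show ?case by (simp only: C_k.simps(2)) blast
qed

lemma C_k_imp_continuous:
  fixes f :: "'a::real_normed_vector \<Rightarrow> real"
  shows "C_k k f \<Longrightarrow> continuous_on UNIV f"
proof (induction k)
  case (Suc k)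
  then show ?case using C_k_Suc_imp_C_k by blast
qed simp

lemma C_k_const: "C_k k (\<lambda>x::'a::real_normed_vector. c)"
proof (induction k arbitrary: c)
  case (Suc k)
  show ?case by (rule C_k_SucI[where f' = "\<lambda>x v. 0"]) (use Suc in auto)
qed auto

lemma C_k_add:
  fixes f g :: "'a::real_normed_vector \<Rightarrow> real"
  shows "C_k k f \<Longrightarrow> C_k k g \<Longrightarrow> C_k k (\<lambda>x. f x + g x)"
proof (induction k arbitrary: f g)
  case 0
  then show ?case by (auto intro: continuous_on_add)
next
  case (Suc k)
  from Suc.prems obtain f' g' where
    "\<And>x. (f has_derivative f' x) (at x)" "\<And>v. C_k k (\<lambda>x. f' x v)"
    "\<And>x. (g has_derivative g' x) (at x)" "\<And>v. C_k k (\<lambda>x. g' x v)"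
    by (elim C_k_SucE) blast
  then show ?case
    by (intro C_k_SucI[where f' = "\<lambda>x v. f' x v + g' x v"] has_derivative_add Suc.IH)
qed

lemma C_k_mult:
  fixes f g :: "'a::real_normed_vector \<Rightarrow> real"
  shows "C_k k f \<Longrightarrow> C_k k g \<Longrightarrow> C_k k (\<lambda>x. f x * g x)"
proof (induction k arbitrary: f g)
  case 0
  then show ?case by (auto intro: continuous_on_mult)
next
  case (Suc k)
  from Suc.prems obtain f' g' where *:
    "\<And>x. (f has_derivative f' x) (at x)" "\<And>v. C_k k (\<lambda>x. f' x v)"
    "\<And>x. (g has_derivative g' x) (at x)" "\<And>v. C_k k (\<lambda>x. g' x v)"
    by (elim C_k_SucE) blast
  have "C_k k f" "C_k k g" using Suc.prems C_k_Suc_imp_C_k by blast+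
  with * show ?case
    by (intro C_k_SucI[where f' = "\<lambda>x v. f x * g' x v + f' x v * g x"] has_derivative_mult
        C_k_add Suc.IH)
qed

lemma C_k_sum:
  fixes f :: "'i \<Rightarrow> 'a::real_normed_vector \<Rightarrow> real"
  shows "finite I \<Longrightarrow> (\<And>i. i \<in> I \<Longrightarrow> C_k k (f i)) \<Longrightarrow> C_k k (\<lambda>x. \<Sum>i\<in>I. f i x)"
  by (induction I rule: finite_induct) (auto intro: C_k_const C_k_add)

lemma C_k_inverse:
  fixes f :: "'a::real_normed_vector \<Rightarrow> real"
  assumes "\<And>x. f x \<noteq> 0"
  shows "C_k k f \<Longrightarrow> C_k k (\<lambda>x. inverse (f x))"
proof (induction k)
  case 0
  then show ?case using assms by (auto intro: continuous_on_inverse)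
next
  case (Suc k)
  then obtain f' where *:
    "\<And>x. (f has_derivative f' x) (at x)" "\<And>v. C_k k (\<lambda>x. f' x v)"
    by (elim C_k_SucE) blast
  have IH: "C_k k (\<lambda>x. inverse (f x))" using Suc C_k_Suc_imp_C_k by blast
  show ?case
  proof (rule C_k_SucI[where f' = "\<lambda>x v. (-1) * (inverse (f x) * f' x v * inverse (f x))"])
    show "((\<lambda>x. inverse (f x)) has_derivative
        (\<lambda>v. (-1) * (inverse (f x) * f' x v * inverse (f x)))) (at x)" for x
      using has_derivative_compose[OF *(1)[of x] has_derivative_inverse'[OF assms[of x]]]
      by (simp add: o_def mult_ac)
  qed (intro C_k_mult C_k_const IH *(2))
qed

lemma C_k_linear_compose:
  fixes f :: "'b::real_normed_vector \<Rightarrow> real" and L :: "'a::real_normed_vector \<Rightarrow> 'b"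
  assumes "bounded_linear L"
  shows "C_k k f \<Longrightarrow> C_k k (\<lambda>x. f (L x))"
proof (induction k arbitrary: f)
  case 0
  then show ?case
    using continuous_on_compose2[of UNIV f UNIV L] linear_continuous_on[OF assms] by auto
next
  case (Suc k)
  then obtain f' where *:
    "\<And>x. (f has_derivative f' x) (at x)" "\<And>v. C_k k (\<lambda>x. f' x v)"
    by (elim C_k_SucE) blast
  show ?case
  proof (rule C_k_SucI[where f' = "\<lambda>x v. f' (L x) (L v)"])
    show "((\<lambda>x. f (L x)) has_derivative (\<lambda>v. f' (L x) (L v))) (at x)" for x
      using has_derivative_compose[OF bounded_linear_imp_has_derivative[OF assms] *(1)] .
  qed (use Suc.IH * in auto)
qed

lemma C_k_real_SucI:
  fixes f :: "real \<Rightarrow> real"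
  assumes "\<And>x. (f has_real_derivative f' x) (at x)" and "C_k k f'"
  shows "C_k (Suc k) f"
  by (rule C_k_SucI[where f' = "\<lambda>x v. f' x * v"])
     (use assms in \<open>auto simp: has_field_derivative_def intro: C_k_mult C_k_const\<close>)

lemma C_k_real_SucE:
  fixes f :: "real \<Rightarrow> real"
  assumes "C_k (Suc k) f"
  obtains f' where "\<And>x. (f has_real_derivative f' x) (at x)" and "C_k k f'"
proof -
  from assms obtain f' where *:
    "\<And>x. (f has_derivative f' x) (at x)" "\<And>v. C_k k (\<lambda>x. f' x v)"
    by (elim C_k_SucE) blast
  have "f' x v = f' x 1 * v" for x v
    using linear_cmul[OF has_derivative_linear[OF *(1)[of x]], of v 1] by (simp add: mult.commute)
  then have "f' x = (*) (f' x 1)" for x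
    by blast
  then have "(f has_real_derivative f' x 1) (at x)" for x
    using *(1)[of x] by (metis has_field_derivative_def)
  with *(2) show thesis by (intro that[of "\<lambda>x. f' x 1"]) auto
qed

lemma C_k_real_compose:
  fixes f :: "'a::real_normed_vector \<Rightarrow> real" and g :: "real \<Rightarrow> real"
  shows "C_k k g \<Longrightarrow> C_k k f \<Longrightarrow> C_k k (\<lambda>x. g (f x))"
proof (induction k arbitrary: g)
  case 0
  then show ?case using continuous_on_compose2[of UNIV g UNIV f] by auto
next
  case (Suc k)
  then obtain f' g' where *:
    "\<And>x. (f has_derivative f' x) (at x)" "\<And>v. C_k k (\<lambda>x. f' x v)"
    "\<And>x. (g has_real_derivative g' x) (at x)" "C_k k g'"
    by (elim C_k_SucE[of _ f] C_k_real_SucE[of _ g]) blast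
  have IH: "C_k k (\<lambda>x. g' (f x))" using Suc * C_k_Suc_imp_C_k by blast
  show ?case
  proof (rule C_k_SucI[where f' = "\<lambda>x v. g' (f x) * f' x v"])
    show "((\<lambda>x. g (f x)) has_derivative (\<lambda>v. g' (f x) * f' x v)) (at x)" for x
      using has_derivative_compose[OF *(1), of g "\<lambda>v. g' (f x) * v"] *(3)[of "f x"]
      by (simp add: has_field_derivative_def)
  qed (use IH * in \<open>auto intro: C_k_mult\<close>)
qed

lemma C_k_linear:
  fixes L :: "'a::real_normed_vector \<Rightarrow> real"
  assumes "bounded_linear L"
  shows "C_k k L"
proof (cases k)
  case 0
  then show ?thesis using linear_continuous_on[OF assms] by auto
next
  case (Suc j)
  show ?thesis unfolding Suc
    by (rule C_k_SucI[where f' = "\<lambda>x. L"])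
       (auto intro: C_k_const bounded_linear_imp_has_derivative assms)
qed

lemma C_k_norm_squared: "C_k k (\<lambda>x::'a::euclidean_space. (norm x)\<^sup>2)"
proof -
  have "(\<lambda>x::'a. (norm x)\<^sup>2) = (\<lambda>x. \<Sum>b\<in>Basis. (x \<bullet> b) * (x \<bullet> b))"
    by (simp add: power2_norm_eq_inner euclidean_inner[of x x for x])
  moreover have "C_k k (\<lambda>x::'a. \<Sum>b\<in>Basis. (x \<bullet> b) * (x \<bullet> b))"
    by (intro C_k_sum C_k_mult C_k_linear bounded_linear_inner_left finite_Basis)
  ultimately show ?thesis by simp
qed

section \<open>Smooth cut-off functions\<close>

text \<open>The family \<open>s \<mapsto> s powr (-n) exp (-1/s)\<close>, extended by \<open>0\<close>, spans a space that is closed under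
differentiation; this is why its members are smooth at the origin.\<close>

definition flat :: "nat \<Rightarrow> real \<Rightarrow> real" where
  "flat n s = (if s > 0 then (1 / s) ^ n * exp (- (1 / s)) else 0)"

lemma flat_tendsto_0: "(flat n \<longlongrightarrow> 0) (at_right 0)"
proof -
  have "((\<lambda>x::real. x ^ n / exp x) \<longlongrightarrow> 0) at_top" by (rule tendsto_power_div_exp_0)
  then have "((\<lambda>s::real. inverse s ^ n / exp (inverse s)) \<longlongrightarrow> 0) (at_right 0)"
    by (rule filterlim_compose) (rule filterlim_inverse_at_top_right)
  then show ?thesis
    by (rule Lim_transform_eventually)
       (auto simp: eventually_at_right_field flat_def exp_minus field_simps intro!: exI[of _ 1])
qed

lemma has_real_derivative_flat:
  "(flat n has_real_derivative flat (n + 2) s - n * flat (n + 1) s) (at s)"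
proof (cases s "0::real" rule: linorder_cases)
  case less
  have "((\<lambda>_. 0) has_real_derivative 0) (at s)" by simp
  then have "(flat n has_real_derivative 0) (at s)"
    by (rule has_field_derivative_transform_within_open[where S = "{..<0}"])
       (use less in \<open>auto simp: flat_def\<close>)
  with less show ?thesis by (simp add: flat_def)
next
  case greater
  have "((\<lambda>s. (1 / s) ^ n * exp (- (1 / s))) has_real_derivative
      (flat (n + 2) s - n * flat (n + 1) s)) (at s)"
  proof -
    have 1: "((\<lambda>s. inverse s) has_real_derivative - ((inverse s) ^ 2)) (at s)"
      using greater by (auto intro!: derivative_eq_intros simp: power2_eq_square)
    have 2: "((\<lambda>y. y ^ n * exp (- y)) has_real_derivative
        (real n * y ^ (n - 1) * exp (- y) - y ^ n * exp (- y))) (at y)" for y :: real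
      by (auto intro!: derivative_eq_intros simp: algebra_simps)
    have "((\<lambda>s. inverse s ^ n * exp (- inverse s)) has_real_derivative
       (real n * inverse s ^ (n - 1) * exp (- inverse s) - inverse s ^ n * exp (- inverse s))
         * - ((inverse s) ^ 2)) (at s)"
      by (rule DERIV_chain2[OF 2 1])
    moreover have "(real n * inverse s ^ (n - 1) * exp (- inverse s) - inverse s ^ n * exp (- inverse s))
         * - ((inverse s) ^ 2) = flat (n + 2) s - n * flat (n + 1) s"
      using greater by (cases n) (auto simp: flat_def inverse_eq_divide power2_eq_square algebra_simps add_divide_distrib)
    ultimately show ?thesis by (simp add: inverse_eq_divide)
  qed
  then show ?thesis
    by (rule has_field_derivative_transform_within_open[where S = "{0<..}"])
       (use greater in \<open>auto simp: flat_def\<close>)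
next
  case equal
  have "((\<lambda>h. flat n h / h) \<longlongrightarrow> 0) (at_right 0)"
    by (rule Lim_transform_eventually[OF flat_tendsto_0[of "Suc n"]])
       (auto simp: eventually_at_right_field flat_def intro!: exI[of _ 1])
  moreover have "((\<lambda>h. flat n h / h) \<longlongrightarrow> 0) (at_left 0)"
    by (rule Lim_transform_eventually[OF tendsto_const])
       (auto simp: eventually_at_left_field flat_def intro!: exI[of _ "-1"])
  ultimately have "((\<lambda>h. flat n h / h) \<longlongrightarrow> 0) (at 0)"
    using filterlim_split_at by blast
  with equal show ?thesis by (simp add: DERIV_def flat_def)
qed

lemma C_k_flat: "C_k k (flat n)"
proof (induction k arbitrary: n)
  case 0
  show ?case
    by (auto intro!: continuous_at_imp_continuous_on DERIV_isCont[OF has_real_derivative_flat])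
next
  case (Suc k)
  have "C_k k (\<lambda>s. flat (n + 2) s + (- real n) * flat (n + 1) s)"
    by (intro C_k_add C_k_mult C_k_const Suc)
  then show ?case
    using has_real_derivative_flat by (intro C_k_real_SucI) auto
qed

definition smooth_step :: "real \<Rightarrow> real" where
  "smooth_step s = flat 0 s * inverse (flat 0 s + flat 0 (1 - s))"

lemma flat_nonneg: "0 \<le> flat n s" by (simp add: flat_def)

lemma flat_0_sum_pos: "flat 0 s + flat 0 (1 - s) > 0"
  using flat_nonneg[of 0 s] flat_nonneg[of 0 "1 - s"] by (auto simp: flat_def add_pos_pos)

lemma C_k_affine_real: "C_k k (\<lambda>s::real. a + b * s)"
  by (intro C_k_add C_k_mult C_k_const C_k_linear bounded_linear_ident)

lemma C_k_smooth_step: "C_k k smooth_step"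
proof -
  have 1: "C_k k (\<lambda>s. flat 0 (1 + (-1) * s))"
    by (rule C_k_real_compose[OF C_k_flat C_k_affine_real])
  have "C_k k (\<lambda>s. inverse (flat 0 s + flat 0 (1 + (-1) * s)))"
    by (rule C_k_inverse[OF _ C_k_add[OF C_k_flat 1]]) (use flat_0_sum_pos in \<open>simp add: less_imp_neq[symmetric]\<close>)
  then have "C_k k (\<lambda>s. flat 0 s * inverse (flat 0 s + flat 0 (1 + (-1) * s)))"
    by (intro C_k_mult C_k_flat)
  then show ?thesis
    by (simp add: smooth_step_def[abs_def])
qed

lemma smooth_step_nonneg: "0 \<le> smooth_step s"
  using flat_nonneg[of 0 s] flat_0_sum_pos[of s] by (simp add: smooth_step_def)

lemma smooth_step_eq_0: "s \<le> 0 \<Longrightarrow> smooth_step s = 0"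
  by (simp add: smooth_step_def flat_def)

lemma smooth_step_eq_1: "s \<ge> 1 \<Longrightarrow> smooth_step s = 1"
  by (simp add: smooth_step_def flat_def)

lemma ex_ball_cutoff:
  assumes "0 \<le> r"
  obtains \<eta> :: "'a::euclidean_space \<Rightarrow> real"
  where "\<And>k. C_k k \<eta>" "\<And>x. 0 \<le> \<eta> x" "\<And>x. norm x \<le> r \<Longrightarrow> \<eta> x = 1"
    "\<And>x. norm x \<ge> r + 1 \<Longrightarrow> \<eta> x = 0"
proof
  let ?\<eta> = "\<lambda>x::'a. smooth_step ((r + 1)\<^sup>2 + (-1) * (norm x)\<^sup>2)"
  show "C_k k ?\<eta>" for k
    by (intro C_k_real_compose[OF C_k_smooth_step] C_k_add C_k_const C_k_mult C_k_norm_squared)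
  show "0 \<le> ?\<eta> x" for x by (rule smooth_step_nonneg)
  show "?\<eta> x = 1" if "norm x \<le> r" for x
    using power_mono[OF that, of 2] assms
    by (intro smooth_step_eq_1) (auto simp: power2_eq_square algebra_simps)
  show "?\<eta> x = 0" if "norm x \<ge> r + 1" for x
    using power_mono[OF that, of 2] assms
    by (intro smooth_step_eq_0) auto
qed

text \<open>The cut-off in time must equal \<open>1\<close> on a neighbourhood of \<open>0\<close>, because the weak formulation sees the
two-sided time derivative of the test function at \<open>0\<close>, and must vanish before \<open>-1\<close>, where the weight
\<open>(1 + t) powr \<mu>\<close> is singular.\<close>

lemma ex_interval_cutoff:
  fixes a b :: real
  assumes "a < b"
  obtains \<zeta> :: "real \<Rightarrow> real"
  where "\<And>k. C_k k \<zeta>" "\<And>t. 0 \<le> \<zeta> t" "\<And>t. - (1/4) \<le> t \<Longrightarrow> t \<le> a \<Longrightarrow> \<zeta> t = 1"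
    "\<And>t. t \<le> - (1/2) \<Longrightarrow> \<zeta> t = 0" "\<And>t. t \<ge> b \<Longrightarrow> \<zeta> t = 0"
proof
  let ?\<zeta> = "\<lambda>t. smooth_step (2 + 4 * t) * smooth_step (b / (b - a) + (- 1 / (b - a)) * t)"
  show "C_k k ?\<zeta>" for k
    by (intro C_k_mult C_k_real_compose[OF C_k_smooth_step] C_k_affine_real)
  show "0 \<le> ?\<zeta> t" for t by (simp add: smooth_step_nonneg)
  show "?\<zeta> t = 1" if "- (1/4) \<le> t" "t \<le> a" for t
  proof -
    have "b / (b - a) + (- 1 / (b - a)) * t = (b - t) / (b - a)"
      by (simp add: diff_divide_distrib)
    moreover have "(b - t) / (b - a) \<ge> 1" using that assms by simp
    ultimately show ?thesis using that by (simp add: smooth_step_eq_1)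
  qed
  show "?\<zeta> t = 0" if "t \<le> - (1/2)" for t
    using that by (simp add: smooth_step_eq_0)
  show "?\<zeta> t = 0" if "t \<ge> b" for t
  proof -
    have "b / (b - a) + (- 1 / (b - a)) * t = (b - t) / (b - a)"
      by (simp add: diff_divide_distrib)
    moreover have "(b - t) / (b - a) \<le> 0" using that assms by (simp add: divide_nonpos_pos)
    ultimately show ?thesis by (simp add: smooth_step_eq_0)
  qed
qed

text \<open>Differentiation reproduces the form of the function: it replaces the cut-off by its derivative, or lowers
the exponent by one. Hence the induction runs over all cut-offs and exponents at once.\<close>

lemma C_k_cutoff_mult_powr:
  fixes \<zeta> :: "real \<Rightarrow> real"
  assumes "C_k k \<zeta>" and "\<And>t. t \<le> - (1/2) \<Longrightarrow> \<zeta> t = 0"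
  shows "C_k k (\<lambda>t. \<zeta> t * (1 + t) powr a)"
  using assms
proof (induction k arbitrary: \<zeta> a)
  case 0
  have "continuous_on ({..-1/2} \<union> {-1/2..}) (\<lambda>t. \<zeta> t * (1 + t) powr a)"
  proof (rule continuous_on_closed_Un)
    show "continuous_on {..-1/2} (\<lambda>t. \<zeta> t * (1 + t) powr a)"
      by (rule continuous_on_eq[OF continuous_on_const[of _ 0]]) (use 0 in auto)
    show "continuous_on {-1/2..} (\<lambda>t. \<zeta> t * (1 + t) powr a)"
      using 0 by (intro continuous_intros) (auto intro: continuous_on_subset)
  qed auto
  moreover have "{..-1/2} \<union> {-1/2::real..} = UNIV" by auto
  ultimately show ?case by (simp only: C_k.simps(1))
next
  case (Suc k)
  then obtain \<zeta>' where d: "\<And>t. (\<zeta> has_real_derivative \<zeta>' t) (at t)" "C_k k \<zeta>'"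
    by (elim C_k_real_SucE) blast
  have \<zeta>'_less: "\<zeta>' t = 0" if "t < - (1/2)" for t
  proof -
    have "((\<lambda>_. 0) has_real_derivative 0) (at t)" by simp
    then have "(\<zeta> has_real_derivative 0) (at t)"
      by (rule has_field_derivative_transform_within_open[where S = "{..<- (1/2)}"])
         (use that Suc.prems in auto)
    with d show ?thesis using DERIV_unique by blast
  qed
  have "\<zeta>' (-(1/2)) = 0"
  proof -
    have "continuous_on UNIV \<zeta>'" by (rule C_k_imp_continuous[OF d(2)])
    then have "(\<zeta>' \<longlongrightarrow> \<zeta>' (-(1/2))) (at_left (-(1/2)))"
      by (simp add: continuous_on_eq_continuous_at isCont_def filterlim_at_split)
    moreover have "(\<zeta>' \<longlongrightarrow> 0) (at_left (-(1/2)))"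
      by (rule Lim_transform_eventually[OF tendsto_const])
         (auto simp: eventually_at_left_field \<zeta>'_less intro!: exI[of _ "-1"])
    ultimately show ?thesis by (rule tendsto_unique[OF _ _, rotated]) simp
  qed
  with \<zeta>'_less have \<zeta>'_0: "\<zeta>' t = 0" if "t \<le> - (1/2)" for t using that by (cases "t = -(1/2)") auto
  show ?case
  proof (rule C_k_real_SucI)
    show "((\<lambda>t. \<zeta> t * (1 + t) powr a) has_real_derivative
        (\<zeta>' t * (1 + t) powr a + a * (\<zeta> t * (1 + t) powr (a - 1)))) (at t)" for t
    proof (cases "t > -1")
      case True
      then show ?thesis
        by (auto intro!: derivative_eq_intros d)
    next
      case False
      have "((\<lambda>_. 0) has_real_derivative 0) (at t)" by simp
      then have "((\<lambda>t. \<zeta> t * (1 + t) powr a) has_real_derivative 0) (at t)"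
        by (rule has_field_derivative_transform_within_open[where S = "{..<- (1/2)}"])
           (use False Suc.prems in auto)
      with False show ?thesis using Suc.prems \<zeta>'_0 by simp
    qed
    show "C_k k (\<lambda>t. \<zeta>' t * (1 + t) powr a + a * (\<zeta> t * (1 + t) powr (a - 1)))"
      using C_k_Suc_imp_C_k[OF Suc.prems(1)] d(2) \<zeta>'_0 Suc.prems(2)
      by (intro C_k_add C_k_mult[OF C_k_const] Suc.IH)
  qed
qed

section \<open>Differential inequalities for a damped equation\<close>

lemma nondecreasing_if_derivative_nonneg:
  fixes f f' :: "real \<Rightarrow> real"
  assumes "a \<le> b" and "\<And>t. t \<in> {a..b} \<Longrightarrow> (f has_real_derivative f' t) (at t within {a..b})"
    and "\<And>t. a < t \<Longrightarrow> t < b \<Longrightarrow> 0 \<le> f' t"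
  shows "f a \<le> f b"
proof (cases "a = b")
  case False
  then obtain x where "x \<in> {a<..<b}" "f b - f a = f' x * (b - a)"
    using mvt_simple[of a b f "\<lambda>t. (*) (f' t)"] assms(1,2) by (auto simp: has_field_derivative_def)
  moreover from this assms(1,3) have "0 \<le> f' x * (b - a)" by (intro mult_nonneg_nonneg) auto
  ultimately show ?thesis by simp
qed simp

text \<open>At the first zero of \<open>z\<close> the function would have been nondecreasing so far, hence at least \<open>z 0 > 0\<close>.\<close>

lemma positive_if_increasing_while_positive:
  fixes z z' :: "real \<Rightarrow> real"
  assumes z: "\<And>t. t \<in> {0..b} \<Longrightarrow> (z has_real_derivative z' t) (at t within {0..b})"
    and "0 < z 0"
    and z': "\<And>t. t \<in> {0..b} \<Longrightarrow> (\<And>s. s \<in> {0..t} \<Longrightarrow> 0 \<le> z s) \<Longrightarrow> 0 \<le> z' t"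
    and "t \<in> {0..b}"
  shows "0 < z t"
proof (rule ccontr)
  assume "\<not> 0 < z t"
  let ?S = "{0..b} \<inter> z -` {..0}"
  have "continuous_on {0..b} z"
    using z by (meson DERIV_continuous continuous_on_eq_continuous_within)
  then have "closed ?S" by (auto intro: continuous_closed_preimage)
  then have "compact ?S" by (simp add: closed_Int_compact[OF _ compact_Icc] compact_eq_bounded_closed bounded_Int)
  moreover have "?S \<noteq> {}" using \<open>\<not> 0 < z t\<close> assms(4) by auto
  ultimately obtain \<tau> where \<tau>: "\<tau> \<in> ?S" "\<And>s. s \<in> ?S \<Longrightarrow> \<tau> \<le> s"
    using compact_attains_inf by metis
  have "z 0 \<le> z \<tau>"
  proof (rule nondecreasing_if_derivative_nonneg[where f = z and f' = z' and a = 0 and b = \<tau>])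
    show "(z has_real_derivative z' t) (at t within {0..\<tau>})" if "t \<in> {0..\<tau>}" for t
      by (rule DERIV_subset[OF z]) (use \<tau> that in auto)
    show "0 \<le> z' t" if "0 < t" "t < \<tau>" for t
    proof (rule z')
      show "0 \<le> z s" if "s \<in> {0..t}" for s
        using \<tau>(2)[of s] \<tau>(1) that \<open>t < \<tau>\<close> by fastforce
    qed (use \<tau> that in auto)
  qed (use \<tau> in auto)
  with \<tau>(1) \<open>0 < z 0\<close> show False by auto
qed

text \<open>The substitution \<open>y = (1 + t) powr (-\<mu>/2) e\<^sup>t w\<close> turns \<open>y'' + \<mu>/(1 + t) y' - y\<close> into a positive multiple of
\<open>w'' + 2 w' + m w/(1 + t)\<^sup>2\<close> with \<open>m = \<mu> (2 - \<mu>)/4 \<le> 1/4\<close>. The choice \<open>w = 1 + 2/(2 + t)\<close> makes this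
nonpositive for all \<open>t \<ge> 0\<close> and all \<open>\<mu>\<close>, which avoids Bessel functions. The second claim is the
integrated form of the inequality.\<close>

lemma damped_oscillator_subsolution:
  fixes \<mu> :: real
  defines "w \<equiv> \<lambda>t. 1 + 2 / (2 + t)"
  defines "w' \<equiv> \<lambda>t. - 2 * (1 / (2 + t))\<^sup>2"
  defines "y \<equiv> \<lambda>t. exp t * (1 + t) powr (- \<mu> / 2) * w t"
  defines "y' \<equiv> \<lambda>t. exp t * (1 + t) powr (- \<mu> / 2) * (w t - (\<mu> / 2) * w t / (1 + t) + w' t)"
  assumes "0 \<le> t"
  shows "(y has_real_derivative y' t) (at t)"
    and "(1 + t) powr \<mu> * y' t \<le> y' 0 + integral {0..t} (\<lambda>s. (1 + s) powr \<mu> * y s)"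
proof -
  have w: "(w has_real_derivative w' t) (at t)" if "0 \<le> t" for t
    unfolding w_def w'_def using that
    by (auto intro!: derivative_eq_intros simp: power2_eq_square)
  have w': "(w' has_real_derivative 4 / (2 + t) ^ 3) (at t)" if "0 \<le> t" for t
  proof -
    have "((\<lambda>t. 1 / (2 + t)) has_real_derivative - ((1 / (2 + t))\<^sup>2)) (at t)"
      using that by (auto intro!: derivative_eq_intros simp: power2_eq_square divide_simps)
    from DERIV_cmult[OF DERIV_power[OF this, of 2], of "- 2"] show ?thesis
      by (simp add: w'_def[abs_def] power2_eq_square power3_eq_cube)
  qed
  show y: "(y has_real_derivative y' t) (at t)" 
    unfolding y_def using \<open>0 \<le> t\<close>
    by (auto intro!: derivative_eq_intros w simp: y'_def powr_diff powr_minus algebra_simps)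
  define P where "P t = exp t * (1 + t) powr (\<mu> / 2) * (w t - (\<mu> / 2) * w t / (1 + t) + w' t)" for t
  define P' where "P' t = exp t * (1 + t) powr (\<mu> / 2) * (w t + (\<mu> * (2 - \<mu>) / 4) * w t / (1 + t)\<^sup>2
      + 2 * w' t + 4 / (2 + t) ^ 3)" for t
  have P_eq: "(1 + t) powr \<mu> * y' t = P t" if "0 \<le> t" for t
  proof -
    have "(1 + t) powr \<mu> * (1 + t) powr (- \<mu> / 2) = (1 + t) powr (\<mu> / 2)"
      by (simp add: powr_add[symmetric])
    from this[symmetric] show ?thesis unfolding P_def y'_def by (simp only: mult_ac)
  qed
  have P: "(P has_real_derivative P' t) (at t)" if "0 \<le> t" for t
  proof -
    define X where "X = 1 / (1 + t)"
    have e: "(1 + t) powr (\<mu> / 2 - 1) = (1 + t) powr (\<mu> / 2) * X"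
      using that by (simp add: powr_diff X_def)
    have "((\<lambda>t. w t / (1 + t)) has_real_derivative (w' t * X - w t * X\<^sup>2)) (at t)"
    proof -
      have "((\<lambda>t. 1 / (1 + t)) has_real_derivative - (X\<^sup>2)) (at t)"
        using that by (auto intro!: derivative_eq_intros simp: X_def power2_eq_square)
      from DERIV_mult[OF w[OF that] this] show ?thesis by (simp add: X_def mult.commute)
    qed
    then have 1: "((\<lambda>t. w t - (\<mu> / 2) * (w t / (1 + t)) + w' t) has_real_derivative
       (w' t - (\<mu> / 2) * (w' t * X - w t * X\<^sup>2) + 4 / (2 + t) ^ 3)) (at t)"
      using that by (intro DERIV_add DERIV_diff DERIV_cmult w w')
    have 2: "((\<lambda>t. exp t * (1 + t) powr (\<mu> / 2)) has_real_derivative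
        (exp t * (1 + t) powr (\<mu> / 2) * (1 + (\<mu> / 2) * X))) (at t)"
      using that by (auto intro!: derivative_eq_intros simp: e algebra_simps)
    have "P' t = exp t * (1 + t) powr (\<mu> / 2) * (w t + (\<mu> * (2 - \<mu>) / 4) * w t * X\<^sup>2
      + 2 * w' t + 4 / (2 + t) ^ 3)"
      by (simp add: P'_def X_def power_one_over)
    also have "\<dots> = (exp t * (1 + t) powr (\<mu> / 2) * (1 + (\<mu> / 2) * X)) * (w t - (\<mu> / 2) * (w t * X) + w' t)
       + (w' t - (\<mu> / 2) * (w' t * X - w t * X\<^sup>2) + 4 / (2 + t) ^ 3) * (exp t * (1 + t) powr (\<mu> / 2))"
      by (simp add: field_simps power2_eq_square)
    finally show ?thesis
      using DERIV_mult[OF 2 1] unfolding P_def by (simp add: X_def)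
  qed
  have P'_le: "P' t \<le> exp t * (1 + t) powr (\<mu> / 2) * w t" if "0 \<le> t" for t
  proof -
    define X V where "X = 1 / (1 + t)" and "V = 1 / (2 + t)"
    have V: "0 < V" "V \<le> 1 / 2" using that by (auto simp: V_def field_simps)
    have X: "0 < X" "X \<le> 2 * V" using that by (auto simp: X_def V_def field_simps)
    have m: "\<mu> * (2 - \<mu>) / 4 \<le> 1 / 4" using zero_le_power2[of "\<mu> - 1"] by (simp add: power2_eq_square algebra_simps)
    have "(\<mu> * (2 - \<mu>) / 4) * (w t * X\<^sup>2) \<le> 1/4 * (w t * X\<^sup>2)"
      using m V by (intro mult_right_mono) (auto simp: w_def that)
    also have "\<dots> \<le> 1/4 * (2 * (2 * V)\<^sup>2)"
      using V X by (intro mult_left_mono mult_mono power_mono) (auto simp: w_def V_def)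
    also have "\<dots> \<le> 4 * V\<^sup>2 - 4 * V ^ 3"
      using mult_left_mono[OF V(2), of "V\<^sup>2"] by (simp add: power2_eq_square power3_eq_cube)
    finally have "(\<mu> * (2 - \<mu>) / 4) * w t / (1 + t)\<^sup>2 + 2 * w' t + 4 / (2 + t) ^ 3 \<le> 0"
      by (simp add: X_def V_def w'_def power_one_over)
    then show ?thesis
      unfolding P'_def by (intro mult_left_mono) (auto simp: that)
  qed
  have y_eq: "(1 + s) powr \<mu> * y s = exp s * (1 + s) powr (\<mu> / 2) * w s" if "0 \<le> s" for s
  proof -
    have "(1 + s) powr \<mu> * (1 + s) powr (- \<mu> / 2) = (1 + s) powr (\<mu> / 2)"
      by (simp add: powr_add[symmetric])
    from this[symmetric] show ?thesis unfolding y_def by (simp only: mult_ac)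
  qed
  have cont: "continuous_on {0..t} (\<lambda>s. exp s * (1 + s) powr (\<mu> / 2) * w s)"
    unfolding w_def by (intro continuous_intros) auto
  have "(P' has_integral (P t - P 0)) {0..t}"
    using \<open>0 \<le> t\<close> P
    by (intro fundamental_theorem_of_calculus)
       (auto simp: has_real_derivative_iff_has_vector_derivative intro: has_vector_derivative_at_within)
  then have "P t - P 0 \<le> integral {0..t} (\<lambda>s. exp s * (1 + s) powr (\<mu> / 2) * w s)"
    by (rule has_integral_le[OF _ integrable_integral[OF integrable_continuous_interval[OF cont]]])
       (auto intro: P'_le)
  also have "\<dots> = integral {0..t} (\<lambda>s. (1 + s) powr \<mu> * y s)"
    by (rule integral_cong) (simp add: y_eq)
  finally show "(1 + t) powr \<mu> * y' t \<le> y' 0 + integral {0..t} (\<lambda>s. (1 + s) powr \<mu> * y s)"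
    using P_eq[of t] P_eq[of 0] \<open>0 \<le> t\<close> by simp
qed

text \<open>A quarter of \<open>A\<close> times the subsolution starts below \<open>G\<close> with a smaller slope, hence stays below. The
bound for \<open>G'\<close> follows by inserting the bound for \<open>G\<close> into the integral inequality, keeping only the last
unit of time, where the exponential is concentrated.\<close>

lemma damped_exponential_growth:
  fixes G G' :: "real \<Rightarrow> real" and \<mu> A b :: real
  assumes "0 < \<mu>" and "0 < A"
    and G: "\<And>t. t \<in> {0..b} \<Longrightarrow> (G has_real_derivative G' t) (at t within {0..b})"
    and "A \<le> G 0" and "A \<le> G' 0"
    and ineq: "\<And>t. t \<in> {0..b} \<Longrightarrow>
      G' 0 + integral {0..t} (\<lambda>s. (1 + s) powr \<mu> * G s) \<le> (1 + t) powr \<mu> * G' t"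
  shows "t \<in> {0..b} \<Longrightarrow> A / 4 * exp t * (1 + t) powr (- \<mu> / 2) \<le> G t" (is "_ \<Longrightarrow> ?th1 t")
    and "t \<in> {1..b} \<Longrightarrow> A * (exp (- 1) * 2 powr (- \<mu> / 2) / 4) * exp t * (1 + t) powr (- \<mu> / 2) \<le> G' t"
proof -
  define w where "w t = 1 + 2 / (2 + t)" for t :: real
  define w' where "w' t = - 2 * (1 / (2 + t))\<^sup>2" for t :: real
  define y where "y t = exp t * (1 + t) powr (- \<mu> / 2) * w t" for t
  define y' where "y' t = exp t * (1 + t) powr (- \<mu> / 2) * (w t - (\<mu> / 2) * w t / (1 + t) + w' t)" for t
  have y: "(y has_real_derivative y' t) (at t)"
    "(1 + t) powr \<mu> * y' t \<le> y' 0 + integral {0..t} (\<lambda>s. (1 + s) powr \<mu> * y s)" if "0 \<le> t" for t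
    using damped_oscillator_subsolution[OF that, of \<mu>]
    unfolding w_def[abs_def] w'_def[abs_def] y_def[abs_def] y'_def[abs_def] by auto
  have contG: "continuous_on {0..b} G"
    using G by (meson DERIV_continuous continuous_on_eq_continuous_within)
  have conty: "continuous_on {0..b} y"
    using y(1) by (auto intro!: continuous_at_imp_continuous_on DERIV_isCont)
  have int: "(\<lambda>s. (1 + s) powr \<mu> * G s) integrable_on {0..t}"
     "(\<lambda>s. (1 + s) powr \<mu> * y s) integrable_on {0..t}" if "t \<in> {0..b}" for t
    using that by (auto intro!: integrable_continuous_interval continuous_intros
        intro: continuous_on_subset[OF contG] continuous_on_subset[OF conty])
  have y0: "y 0 = 2" "y' 0 = 3 / 2 - \<mu>" by (simp_all add: y_def y'_def w_def w'_def power2_eq_square)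
  have pos: "0 < G t - A / 4 * y t" if "t \<in> {0..b}" for t
  proof (rule positive_if_increasing_while_positive[where b = b and z = "\<lambda>t. G t - A / 4 * y t"
        and z' = "\<lambda>t. G' t - A / 4 * y' t"])
    show "((\<lambda>t. G t - A / 4 * y t) has_real_derivative G' t - A / 4 * y' t) (at t within {0..b})"
      if "t \<in> {0..b}" for t
      using that by (intro DERIV_diff DERIV_cmult G has_field_derivative_at_within[OF y(1)]) auto
    show "0 < G 0 - A / 4 * y 0" using assms(2,4) by (simp add: y0)
    show "0 \<le> G' t - A / 4 * y' t"
      if t: "t \<in> {0..b}" and z: "\<And>s. s \<in> {0..t} \<Longrightarrow> 0 \<le> G s - A / 4 * y s" for t
    proof -
      have "0 \<le> integral {0..t} (\<lambda>s. (1 + s) powr \<mu> * (G s - A / 4 * y s))"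
      proof (rule integral_nonneg)
        have "(\<lambda>s. (1 + s) powr \<mu> * G s - A / 4 * ((1 + s) powr \<mu> * y s)) integrable_on {0..t}"
          by (intro integrable_diff integrable_on_mult_right int[OF t])
        then show "(\<lambda>s. (1 + s) powr \<mu> * (G s - A / 4 * y s)) integrable_on {0..t}"
          by (simp add: algebra_simps)
      qed (use z in auto)
      also have "\<dots> = integral {0..t} (\<lambda>s. (1 + s) powr \<mu> * G s)
          - A / 4 * integral {0..t} (\<lambda>s. (1 + s) powr \<mu> * y s)"
      proof -
        have "integral {0..t} (\<lambda>s. (1 + s) powr \<mu> * G s - A / 4 * ((1 + s) powr \<mu> * y s))
           = integral {0..t} (\<lambda>s. (1 + s) powr \<mu> * G s)
             - integral {0..t} (\<lambda>s. A / 4 * ((1 + s) powr \<mu> * y s))"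
          by (intro integral_diff integrable_on_mult_right int[OF t])
        then show ?thesis by (simp add: algebra_simps)
      qed
      also have "\<dots> \<le> ((1 + t) powr \<mu> * G' t - G' 0) - A / 4 * ((1 + t) powr \<mu> * y' t - y' 0)"
        using ineq[OF t] y(2)[of t] t assms(2) by (intro diff_mono mult_left_mono) auto
      also have "\<dots> = (1 + t) powr \<mu> * (G' t - A / 4 * y' t) - (G' 0 - A / 4 * y' 0)"
        by (simp add: algebra_simps)
      finally have "(G' 0 - A / 4 * y' 0) \<le> (1 + t) powr \<mu> * (G' t - A / 4 * y' t)" by simp
      moreover have "0 < G' 0 - A / 4 * y' 0"
      proof -
        have "A / 4 * y' 0 \<le> A / 4 * (3 / 2)"
          using assms(1,2) by (intro mult_left_mono) (auto simp: y0)
        also have "\<dots> < A" using assms(2) by simp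
        finally show ?thesis using assms(5) by simp
      qed
      ultimately have "0 < (1 + t) powr \<mu> * (G' t - A / 4 * y' t)" by simp
      then show ?thesis using t by (simp add: zero_less_mult_iff)
    qed
  qed (use that in auto)
  show th1: "?th1 t" if "t \<in> {0..b}" for t
  proof -
    have "1 \<le> w t" using that by (simp add: w_def)
    then have "exp t * (1 + t) powr (- \<mu> / 2) * 1 \<le> y t"
      unfolding y_def by (intro mult_left_mono) auto
    then have "A / 4 * (exp t * (1 + t) powr (- \<mu> / 2)) \<le> A / 4 * y t"
      using \<open>0 < A\<close> by (intro mult_left_mono) auto
    with pos[OF that] show ?thesis by (simp add: mult.assoc)
  qed
  show "A * (exp (- 1) * 2 powr (- \<mu> / 2) / 4) * exp t * (1 + t) powr (- \<mu> / 2) \<le> G' t"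
    if t1: "t \<in> {1..b}" for t
  proof -
    from t1 have t: "t \<in> {0..b}" "0 \<le> t" "1 \<le> t" by auto
    have Gpos: "0 \<le> G s" if "s \<in> {0..b}" for s
      by (rule order_trans[OF _ th1[OF that]]) (use \<open>0 < A\<close> in simp)
    let ?m = "A / 4 * exp (t - 1) * t powr (\<mu> / 2)"
    have "?m = integral {t-1..t} (\<lambda>s. ?m)" by simp
    also have "\<dots> \<le> integral {t-1..t} (\<lambda>s. (1 + s) powr \<mu> * G s)"
    proof (rule integral_le)
      show "(\<lambda>s. (1 + s) powr \<mu> * G s) integrable_on {t - 1..t}"
        by (rule integrable_on_subinterval[OF int(1)[OF t(1)]]) (use t in auto)
      show "?m \<le> (1 + s) powr \<mu> * G s" if s: "s \<in> {t-1..t}" for s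
      proof -
        have "(1 + s) powr \<mu> * (1 + s) powr (- \<mu> / 2) = (1 + s) powr (\<mu> / 2)"
          by (simp add: powr_add[symmetric])
        note e = this[symmetric]
        have "(1 + s) powr \<mu> * (A / 4 * exp s * (1 + s) powr (- \<mu> / 2))
            = A / 4 * exp s * (1 + s) powr (\<mu> / 2)"
          by (simp only: e mult_ac)
        moreover have "?m \<le> A / 4 * exp s * (1 + s) powr (\<mu> / 2)"
          using s t \<open>0 < A\<close> \<open>0 < \<mu>\<close> by (intro mult_mono powr_mono2) auto
        moreover have "(1 + s) powr \<mu> * (A / 4 * exp s * (1 + s) powr (- \<mu> / 2)) \<le> (1 + s) powr \<mu> * G s"
          using s t by (intro mult_left_mono th1) auto
        ultimately show ?thesis by linarith
      qed
    qed auto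
    also have "\<dots> \<le> integral {0..t} (\<lambda>s. (1 + s) powr \<mu> * G s)"
      using int(1)[OF t(1)] t Gpos
      by (intro integral_subset_le) (auto intro: integrable_on_subinterval)
    also have "\<dots> \<le> (1 + t) powr \<mu> * G' t"
      using ineq[OF t(1)] \<open>A \<le> G' 0\<close> \<open>0 < A\<close> by linarith
    finally have *: "?m \<le> (1 + t) powr \<mu> * G' t" .
    have "((1 + t) / 2) powr (\<mu> / 2) \<le> t powr (\<mu> / 2)"
      using t \<open>0 < \<mu>\<close> by (intro powr_mono2) auto
    then have "(1 + t) powr (\<mu> / 2) * 2 powr (- \<mu> / 2) \<le> t powr (\<mu> / 2)"
      using t powr_minus_divide[of 2 "\<mu> / 2"] by (simp add: powr_divide)
    then have "A / 4 * exp (t - 1) * ((1 + t) powr (\<mu> / 2) * 2 powr (- \<mu> / 2)) \<le> ?m"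
      using \<open>0 < A\<close> by (intro mult_left_mono) auto
    with * have "A / 4 * exp (t - 1) * ((1 + t) powr (\<mu> / 2) * 2 powr (- \<mu> / 2)) \<le> (1 + t) powr \<mu> * G' t"
      by linarith
    then have "(1 + t) powr (- \<mu>) * (A / 4 * exp (t - 1) * ((1 + t) powr (\<mu> / 2) * 2 powr (- \<mu> / 2)))
        \<le> (1 + t) powr (- \<mu>) * ((1 + t) powr \<mu> * G' t)"
      by (intro mult_left_mono) auto
    moreover have "(1 + t) powr (- \<mu>) * ((1 + t) powr \<mu> * G' t) = G' t"
      using t by (simp add: powr_minus)
    moreover have "(1 + t) powr (- \<mu>) * (1 + t) powr (\<mu> / 2) = (1 + t) powr (- \<mu> / 2)"
      by (simp add: powr_add[symmetric])
    note e = this[symmetric]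
    have "(1 + t) powr (- \<mu>) * (A / 4 * exp (t - 1) * ((1 + t) powr (\<mu> / 2) * 2 powr (- \<mu> / 2)))
       = A / 4 * exp (t - 1) * ((1 + t) powr (- \<mu> / 2) * 2 powr (- \<mu> / 2))"
      by (simp only: e mult_ac)
    moreover have "exp (t - 1) = exp (- 1) * exp t"
      by (simp flip: exp_add)
    then have "A / 4 * exp (t - 1) * ((1 + t) powr (- \<mu> / 2) * 2 powr (- \<mu> / 2))
       = A * (exp (- 1) * 2 powr (- \<mu> / 2) / 4) * exp t * (1 + t) powr (- \<mu> / 2)"
      by simp
    ultimately show ?thesis by linarith
  qed
qed

text \<open>The hypothesis on \<open>F'\<close> is what \<open>F'' \<ge> b F\<^sup>q\<close> gives for an increasing function. If \<open>F\<close> is at least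
\<open>2\<^sup>k F\<^sub>0\<close> at some time, then it doubles within a further time \<open>d r\<^sup>k\<close>. These times form a convergent
geometric series, so infinitely many doublings fit into \<open>[M, 2M]\<close>.\<close>

lemma kato_blow_up:
  fixes F F' :: "real \<Rightarrow> real" and b q F\<^sub>0 M :: real
  defines "d \<equiv> sqrt (2 / (b * F\<^sub>0 powr (q - 1)))" and "r \<equiv> 2 powr (- (q - 1) / 2)"
  assumes "1 < q" and "0 < b" and "0 < F\<^sub>0" and "F\<^sub>0 \<le> F M"
    and F: "\<And>t. t \<in> {M..2 * M} \<Longrightarrow> (F has_real_derivative F' t) (at t within {M..2 * M})"
    and F': "\<And>a t. M \<le> a \<Longrightarrow> a \<le> t \<Longrightarrow> t \<le> 2 * M \<Longrightarrow> 0 \<le> F a \<Longrightarrow> b * (t - a) * F a powr q \<le> F' t"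
    and small: "d \<le> M * (1 - r)"
  shows False
proof -
  have r: "0 < r" "r < 1" using \<open>1 < q\<close> unfolding r_def
    by (simp, intro powr_less_one) auto
  have d: "0 < d" using \<open>0 < b\<close> \<open>0 < F\<^sub>0\<close> by (simp add: d_def)
  define s where "s k = M + d * (1 - r ^ k) / (1 - r)" for k :: nat
  have s_Suc: "s (Suc k) = s k + d * r ^ k" for k
  proof -
    have "d * (1 - r ^ Suc k) = d * (1 - r ^ k) + d * r ^ k * (1 - r)"
      by (simp add: algebra_simps)
    then have "d * (1 - r ^ Suc k) / (1 - r) = d * (1 - r ^ k) / (1 - r) + d * r ^ k"
      using r by (simp only: add_divide_distrib) simp
    then show ?thesis by (simp only: s_def)
  qed
  have s_le: "M \<le> s k" "s k \<le> 2 * M" for k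
  proof -
    have k: "0 \<le> 1 - r ^ k" "1 - r ^ k \<le> 1" using r by (auto simp: power_le_one)
    have "d * (1 - r ^ k) \<le> d * 1"
      using k d by (intro mult_left_mono) auto
    also have "\<dots> \<le> M * (1 - r)" using small by simp
    finally have "d * (1 - r ^ k) / (1 - r) \<le> M" using r by (simp only: pos_divide_le_eq diff_gt_0_iff_gt)
    then show "s k \<le> 2 * M" by (simp add: s_def)
    show "M \<le> s k" using d r k by (simp add: s_def)
  qed
  have mono: "F x \<le> F y" if "M \<le> x" "x \<le> y" "y \<le> 2 * M" "0 \<le> F x" for x y
  proof (rule nondecreasing_if_derivative_nonneg[where f = F and f' = F' and a = x and b = y])
    show "(F has_real_derivative F' t) (at t within {x..y})" if "t \<in> {x..y}" for t
      by (rule DERIV_subset[OF F]) (use \<open>M \<le> x\<close> \<open>y \<le> 2 * M\<close> that in auto)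
    show "0 \<le> F' t" if "x < t" "t < y" for t
    proof -
      have "0 \<le> b * (t - x) * F x powr q" using that \<open>0 < b\<close> by simp
      also have "\<dots> \<le> F' t" using that \<open>M \<le> x\<close> \<open>y \<le> 2 * M\<close> \<open>0 \<le> F x\<close> by (intro F') auto
      finally show ?thesis .
    qed
  qed (use that in auto)
  have F_s: "2 ^ k * F\<^sub>0 \<le> F (s k)" for k
  proof (induction k)
    case 0
    then show ?case using \<open>F\<^sub>0 \<le> F M\<close> by (simp add: s_def)
  next
    case (Suc k)
    define h where "h = d * r ^ k"
    have h: "0 < h" using d r by (simp add: h_def)
    have pos: "0 < F (s k)" using Suc \<open>0 < F\<^sub>0\<close> by (auto intro: less_le_trans[rotated])
    let ?K = "b * F (s k) powr q"
    have "F (s k) - ?K * (s k - s k)\<^sup>2 / 2 \<le> F (s (Suc k)) - ?K * (s (Suc k) - s k)\<^sup>2 / 2"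
    proof (rule nondecreasing_if_derivative_nonneg[where f = "\<lambda>t. F t - ?K * (t - s k)\<^sup>2 / 2"
        and f' = "\<lambda>t. F' t - ?K * (t - s k)"])
      show "s k \<le> s (Suc k)" using h by (simp add: s_Suc h_def)
      show "((\<lambda>t. F t - ?K * (t - s k)\<^sup>2 / 2) has_real_derivative F' t - ?K * (t - s k))
          (at t within {s k..s (Suc k)})" if "t \<in> {s k..s (Suc k)}" for t
      proof (rule DERIV_diff)
        show "(F has_real_derivative F' t) (at t within {s k..s (Suc k)})"
          by (rule DERIV_subset[OF F]) (use that s_le[of k] s_le[of "Suc k"] in auto)
      qed (auto intro!: derivative_eq_intros)
      show "0 \<le> F' t - ?K * (t - s k)" if "s k < t" "t < s (Suc k)" for t
        using F'[of "s k" t] that s_le(1)[of k] s_le(2)[of "Suc k"] pos by (simp add: mult_ac)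
    qed
    then have 1: "F (s k) + ?K * h\<^sup>2 / 2 \<le> F (s (Suc k))"
      by (simp add: s_Suc h_def)
    have "(r ^ k)\<^sup>2 = 2 powr (- (real k * (q - 1)))"
    proof -
      have "r ^ k = 2 powr (- (q - 1) / 2 * real k)"
        unfolding powr_realpow[OF r(1), symmetric] by (simp only: r_def powr_powr)
      moreover have "- (q - 1) / 2 * real k + - (q - 1) / 2 * real k = - (real k * (q - 1))"
        by (simp add: algebra_simps)
      ultimately show ?thesis by (simp only: power2_eq_square powr_add[symmetric])
    qed
    then have "h\<^sup>2 = 2 / (b * F\<^sub>0 powr (q - 1)) * 2 powr (- (real k * (q - 1)))"
      using \<open>0 < b\<close> \<open>0 < F\<^sub>0\<close> by (simp add: h_def power_mult_distrib d_def)
    moreover have "(2 ^ k * F\<^sub>0) powr (q - 1) = 2 powr (real k * (q - 1)) * F\<^sub>0 powr (q - 1)"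
    proof -
      have "(2 ^ k) powr (q - 1) = (2::real) powr (real k * (q - 1))"
        by (simp only: powr_realpow[of 2 k, simplified, symmetric] powr_powr)
      then show ?thesis using \<open>0 < F\<^sub>0\<close> by (simp add: powr_mult)
    qed
    ultimately have "b * (2 ^ k * F\<^sub>0) powr (q - 1) * h\<^sup>2 / 2 = 1"
      using \<open>0 < b\<close> \<open>0 < F\<^sub>0\<close> by (simp add: powr_minus)
    moreover have "(2 ^ k * F\<^sub>0) powr (q - 1) \<le> F (s k) powr (q - 1)"
      using Suc \<open>1 < q\<close> \<open>0 < F\<^sub>0\<close> by (intro powr_mono2) auto
    then have "b * (2 ^ k * F\<^sub>0) powr (q - 1) * h\<^sup>2 / 2 \<le> b * F (s k) powr (q - 1) * h\<^sup>2 / 2"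
      using \<open>0 < b\<close> by (intro divide_right_mono mult_right_mono mult_left_mono) auto
    ultimately have "F (s k) * 1 \<le> F (s k) * (b * F (s k) powr (q - 1) * h\<^sup>2 / 2)"
      using pos by (intro mult_left_mono) auto
    also have "\<dots> = ?K * h\<^sup>2 / 2"
      using pos by (simp add: powr_diff)
    finally have "2 * F (s k) \<le> F (s (Suc k))" using 1 by simp
    with Suc show ?case by simp
  qed
  obtain n where "F (2 * M) / F\<^sub>0 < 2 ^ n"
    using real_arch_pow[of 2 "F (2 * M) / F\<^sub>0"] by auto
  then have "F (2 * M) < 2 ^ n * F\<^sub>0" using \<open>0 < F\<^sub>0\<close> by (simp add: field_simps)
  also have "\<dots> \<le> F (s n)" by (rule F_s)
  also have "\<dots> \<le> F (2 * M)"
    using F_s[of n] \<open>0 < F\<^sub>0\<close> by (intro mono s_le order.refl) (auto intro: order_trans[rotated])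
  finally show False by simp
qed

section \<open>Lifespan of a spatial average\<close>

text \<open>Powers of comparable quantities are comparable, with a constant that does not depend on the sign of the
exponent; the exponents below can have either sign.\<close>

lemma powr_comparable:
  fixes x y k b :: real
  assumes "0 < x" and "0 < y" and "x \<le> k * y" and "y \<le> k * x"
  shows "k powr (- \<bar>b\<bar>) * x powr b \<le> y powr b"
proof -
  have k: "0 < k" using assms by (smt (verit) mult_nonpos_nonneg)
  show ?thesis
  proof (cases "0 \<le> b")
    case True
    have "(x / k) powr b \<le> y powr b"
      using assms k True by (intro powr_mono2) (auto simp: field_simps)
    then show ?thesis
      using True k assms(1) powr_minus_divide[of k b] by (simp add: powr_divide)
  next
    case False
    have "(k * x) powr b \<le> y powr b"
      using assms k False by (intro powr_mono2') auto
    then show ?thesis using False k assms(1) by (simp add: powr_mult)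
  qed
qed

lemma integrated_lower_bound:
  fixes F F' :: "real \<Rightarrow> real"
  assumes F: "\<And>t. t \<in> {x..y} \<Longrightarrow> (F has_real_derivative F' t) (at t within {x..y})"
    and "x \<le> y" and "\<And>t. x < t \<Longrightarrow> t < y \<Longrightarrow> m \<le> F' t"
  shows "F x + m * (y - x) \<le> F y"
proof -
  have "F x - m * x \<le> F y - m * y"
  proof (rule nondecreasing_if_derivative_nonneg[where f = "\<lambda>t. F t - m * t" and f' = "\<lambda>t. F' t - m" and a = x and b = y])
    show "((\<lambda>t. F t - m * t) has_real_derivative F' t - m) (at t within {x..y})" if "t \<in> {x..y}" for t
      by (rule DERIV_diff[OF F[OF that]]) (auto intro!: derivative_eq_intros)
  qed (use assms in auto)
  then show ?thesis by (simp add: algebra_simps)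
qed

text \<open>\<open>F\<close> stands for the average of a solution on \<open>[0, b]\<close>, and \<open>H\<close> for the integral of its source, which is
controlled only at the \<open>good\<close> times. Condition \<open>P\<close> is a consequence of
\<open>((1 + t) powr \<mu> F')' = (1 + t) powr \<mu> H\<close> that makes sense without any regularity of \<open>H\<close>.\<close>

locale averages =
  fixes \<mu> p q N K\<^sub>1 K\<^sub>2 \<kappa> \<epsilon> b :: real and F F' H :: "real \<Rightarrow> real" and good :: "real \<Rightarrow> bool"
  assumes \<epsilon>: "0 < \<epsilon>" "\<epsilon> \<le> 1"
    and F: "\<And>t. t \<in> {0..b} \<Longrightarrow> (F has_real_derivative F' t) (at t within {0..b})"
    and F0: "0 \<le> F 0" and H0: "\<And>s. 0 \<le> H s"
    and P: "\<And>a t m. 0 \<le> a \<Longrightarrow> a \<le> t \<Longrightarrow> t \<le> b \<Longrightarrow> 0 \<le> m \<Longrightarrow>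
      (\<And>s. a \<le> s \<Longrightarrow> s \<le> t \<Longrightarrow> good s \<Longrightarrow> m \<le> (1 + s) powr \<mu> * H s) \<Longrightarrow>
      m * (t - a) \<le> (1 + t) powr \<mu> * F' t"
    and H1: "\<And>s. 1 \<le> s \<Longrightarrow> s \<le> b \<Longrightarrow> good s \<Longrightarrow> K\<^sub>1 * \<epsilon> powr p * (1 + s) powr (- \<kappa>) \<le> H s"
    and H2: "\<And>s. 0 \<le> s \<Longrightarrow> s \<le> b \<Longrightarrow> good s \<Longrightarrow> 0 \<le> F s \<Longrightarrow>
      K\<^sub>2 * F s powr q * (1 + s) powr (- N * (q - 1)) \<le> H s"

text \<open>The bound on \<open>H\<close> by \<open>\<epsilon>\<close> makes \<open>F\<close> large at time \<open>M\<close>; the bound by \<open>F\<close> then forces blow-up before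
\<open>2 M\<close>, for \<open>M\<close> a suitable multiple of the claimed lifespan. The constant \<open>C\<close> is chosen before \<open>\<epsilon>\<close> and
the functions.\<close>

lemma lifespan_from_averages:
  fixes \<mu> p q N K\<^sub>1 K\<^sub>2 \<kappa> \<theta> :: real
  assumes "0 < \<mu>" and "1 < q" and "0 < K\<^sub>1" and "0 < K\<^sub>2" and "0 < \<theta>"
    and \<theta>: "\<theta> = (2 - \<kappa>) * (q - 1) - N * (q - 1) + 2" and "0 < p"
  obtains C where "0 < C" and "\<And>\<epsilon> b F F' H good.
    averages \<mu> p q N K\<^sub>1 K\<^sub>2 \<kappa> \<epsilon> b F F' H good \<Longrightarrow> b \<le> C * \<epsilon> powr (- (p * (q - 1) / \<theta>))"
proof -
  define r where "r = 2 powr (- (q - 1) / 2)"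
  have r: "0 < r" "r < 1" using \<open>1 < q\<close> unfolding r_def by (simp, intro powr_less_one) auto
  \<comment> \<open>\<open>k\<^sub>1\<close>, \<open>k\<^sub>2\<close>, \<open>k\<^sub>3\<close> are the constants in the lower bounds for \<open>F'\<close>, for \<open>F\<close>, and for \<open>F'\<close> in terms
    of \<open>F\<close>; the factors account for comparing powers on \<open>[t/2, t]\<close> and on \<open>[M, 2M]\<close>.\<close>
  define k\<^sub>1 where "k\<^sub>1 = K\<^sub>1 * 2 powr (- \<bar>\<mu> - \<kappa>\<bar>) / 2"
  define k\<^sub>2 where "k\<^sub>2 = k\<^sub>1 / 4 * 2 powr (- \<bar>- \<kappa>\<bar>) * 2 powr (- \<bar>- \<kappa>\<bar>)"
  define k\<^sub>3 where "k\<^sub>3 = K\<^sub>2 * 3 powr (- \<bar>- N * (q - 1)\<bar>) * 2 powr (- \<mu>)"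
  have k: "0 < k\<^sub>1" "0 < k\<^sub>2" "0 < k\<^sub>3"
    using \<open>0 < K\<^sub>1\<close> \<open>0 < K\<^sub>2\<close> by (auto simp: k\<^sub>1_def k\<^sub>2_def k\<^sub>3_def)
  define k\<^sub>4 where "k\<^sub>4 = k\<^sub>3 * k\<^sub>2 powr (q - 1) * (1 - r)\<^sup>2 / 2"
  have k4: "0 < k\<^sub>4" using k r by (simp add: k\<^sub>4_def)
  \<comment> \<open>With this \<open>L\<close> and \<open>M = L \<epsilon> powr (- (p (q - 1) / \<theta>))\<close> the smallness condition of the blow-up
    lemma holds on \<open>[M, 2M]\<close>; the value \<open>4\<close> guarantees that the bound for \<open>F\<close> applies at time \<open>M\<close>.\<close>
  define L where "L = max 4 (k\<^sub>4 powr (- (1 / \<theta>)))"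
  have L: "4 \<le> L" "1 \<le> k\<^sub>4 * L powr \<theta>"
  proof -
    show "4 \<le> L" by (simp add: L_def)
    have "(k\<^sub>4 powr (- (1 / \<theta>))) powr \<theta> \<le> L powr \<theta>"
      using \<open>0 < \<theta>\<close> by (intro powr_mono2) (auto simp: L_def)
    also have "(k\<^sub>4 powr (- (1 / \<theta>))) powr \<theta> = 1 / k\<^sub>4"
    proof -
      have "(k\<^sub>4 powr (- (1 / \<theta>))) powr \<theta> = k\<^sub>4 powr (- 1)"
        unfolding powr_powr using \<open>0 < \<theta>\<close> by simp
      also have "\<dots> = 1 / k\<^sub>4" using k4 by (simp add: powr_minus_divide)
      finally show ?thesis .
    qed
    finally show "1 \<le> k\<^sub>4 * L powr \<theta>" using k4 by (simp add: field_simps)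
  qed
  show thesis
  proof (rule that[of "2 * L"])
    show "0 < 2 * L" using L by simp
    fix \<epsilon> b :: real and F F' H :: "real \<Rightarrow> real" and good :: "real \<Rightarrow> bool"
    assume "averages \<mu> p q N K\<^sub>1 K\<^sub>2 \<kappa> \<epsilon> b F F' H good"
    then interpret averages \<mu> p q N K\<^sub>1 K\<^sub>2 \<kappa> \<epsilon> b F F' H good .
    have F'_nonneg: "0 \<le> F' t" if "0 \<le> t" "t \<le> b" for t
    proof -
      have "0 * (t - 0) \<le> (1 + t) powr \<mu> * F' t"
        by (rule P) (use that H0 in auto)
      then show ?thesis using that by (simp add: zero_le_mult_iff)
    qed
    have F_sub: "(F has_real_derivative F' t) (at t within {x..y})"
      if "0 \<le> x" "y \<le> b" "t \<in> {x..y}" for t x y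
      by (rule DERIV_subset[OF F]) (use that in auto)
    have F_mono: "F x \<le> F y" if "0 \<le> x" "x \<le> y" "y \<le> b" for x y
      using integrated_lower_bound[of x y F F' 0] F_sub[OF that(1,3)] that F'_nonneg by simp
    have F_nonneg: "0 \<le> F t" if "0 \<le> t" "t \<le> b" for t
      using F_mono[of 0 t] F0 that by simp
    have F'_lower: "k\<^sub>1 * \<epsilon> powr p * t * (1 + t) powr (- \<kappa>) \<le> F' t" if t: "2 \<le> t" "t \<le> b" for t
    proof -
      let ?m = "K\<^sub>1 * \<epsilon> powr p * (2 powr (- \<bar>\<mu> - \<kappa>\<bar>) * (1 + t) powr (\<mu> - \<kappa>))"
      have "?m * (t - t / 2) \<le> (1 + t) powr \<mu> * F' t"
      proof (rule P)
        fix s assume s: "t / 2 \<le> s" "s \<le> t" "good s"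
        have "2 powr (- \<bar>\<mu> - \<kappa>\<bar>) * (1 + t) powr (\<mu> - \<kappa>) \<le> (1 + s) powr (\<mu> - \<kappa>)"
          by (rule powr_comparable) (use s t in auto)
        then have "?m \<le> K\<^sub>1 * \<epsilon> powr p * (1 + s) powr (\<mu> - \<kappa>)"
          using \<open>0 < K\<^sub>1\<close> by (intro mult_left_mono) auto
        also have "\<dots> = (1 + s) powr \<mu> * (K\<^sub>1 * \<epsilon> powr p * (1 + s) powr (- \<kappa>))"
          using powr_add[of "1 + s" \<mu> "- \<kappa>"] by simp
        also have "\<dots> \<le> (1 + s) powr \<mu> * H s"
          using s t by (intro mult_left_mono H1) auto
        finally show "?m \<le> (1 + s) powr \<mu> * H s" .
      qed (use t \<open>0 < K\<^sub>1\<close> in auto)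
      moreover have "?m * (t - t / 2) = (1 + t) powr \<mu> * (k\<^sub>1 * \<epsilon> powr p * t * (1 + t) powr (- \<kappa>))"
        using powr_add[of "1 + t" \<mu> "- \<kappa>"] by (simp add: k\<^sub>1_def)
      ultimately have "(1 + t) powr \<mu> * (k\<^sub>1 * \<epsilon> powr p * t * (1 + t) powr (- \<kappa>)) \<le> (1 + t) powr \<mu> * F' t"
        by linarith
      then show ?thesis using t by (simp add: mult_le_cancel_left)
    qed
    have F_lower: "k\<^sub>2 * \<epsilon> powr p * t powr (2 - \<kappa>) \<le> F t" if t: "4 \<le> t" "t \<le> b" for t
    proof -
      let ?m = "k\<^sub>1 * \<epsilon> powr p * (t / 2) * (2 powr (- \<bar>- \<kappa>\<bar>) * (2 powr (- \<bar>- \<kappa>\<bar>) * t powr (- \<kappa>)))"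
      have "F (t / 2) + ?m * (t - t / 2) \<le> F t"
      proof (rule integrated_lower_bound)
        show "(F has_real_derivative F' s) (at s within {t / 2..t})" if "s \<in> {t / 2..t}" for s
          by (rule F_sub) (use that t in auto)
        show "?m \<le> F' s" if s: "t / 2 < s" "s < t" for s
        proof -
          have "2 powr (- \<bar>- \<kappa>\<bar>) * t powr (- \<kappa>) \<le> (1 + t) powr (- \<kappa>)"
            by (rule powr_comparable) (use t in auto)
          then have "2 powr (- \<bar>- \<kappa>\<bar>) * (2 powr (- \<bar>- \<kappa>\<bar>) * t powr (- \<kappa>)) \<le> 2 powr (- \<bar>- \<kappa>\<bar>) * (1 + t) powr (- \<kappa>)"
            by (intro mult_left_mono) auto
          also have "\<dots> \<le> (1 + s) powr (- \<kappa>)"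
            by (rule powr_comparable) (use s t in auto)
          finally have "?m \<le> k\<^sub>1 * \<epsilon> powr p * s * (1 + s) powr (- \<kappa>)"
            using k s t by (intro mult_mono) auto
          also have "\<dots> \<le> F' s" by (rule F'_lower) (use s t in auto)
          finally show ?thesis .
        qed
      qed (use t in auto)
      moreover have "0 \<le> F (t / 2)" by (rule F_nonneg) (use t in auto)
      moreover have "t powr (2 - \<kappa>) = t * t * t powr (- \<kappa>)"
        using t powr_add[of t 2 "- \<kappa>"] by (simp add: power2_eq_square)
      then have "?m * (t - t / 2) = k\<^sub>2 * \<epsilon> powr p * t powr (2 - \<kappa>)" by (simp add: k\<^sub>2_def)
      ultimately show ?thesis by linarith
    qed
    have F'_growth: "k\<^sub>3 * M powr (- N * (q - 1)) * (t - a) * F a powr q \<le> F' t"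
      if M: "4 \<le> M" "2 * M \<le> b" and t: "M \<le> a" "a \<le> t" "t \<le> 2 * M" for M a t
    proof -
      let ?B = "- N * (q - 1)"
      let ?m = "(1 + M) powr \<mu> * (K\<^sub>2 * F a powr q * (3 powr (- \<bar>?B\<bar>) * M powr ?B))"
      have "?m * (t - a) \<le> (1 + t) powr \<mu> * F' t"
      proof (rule P)
        fix s assume s: "a \<le> s" "s \<le> t" "good s"
        have "3 powr (- \<bar>?B\<bar>) * M powr ?B \<le> (1 + s) powr ?B"
          by (rule powr_comparable) (use s t M in auto)
        moreover have "F a powr q \<le> F s powr q"
          using F_mono[of a s] F_nonneg[of a] s t M \<open>1 < q\<close> by (intro powr_mono2) auto
        ultimately have "K\<^sub>2 * F a powr q * (3 powr (- \<bar>?B\<bar>) * M powr ?B) \<le> K\<^sub>2 * F s powr q * (1 + s) powr ?B"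
          using \<open>0 < K\<^sub>2\<close> by (intro mult_mono) auto
        also have "\<dots> \<le> H s" by (rule H2) (use s t M F_nonneg[of s] in auto)
        finally show "?m \<le> (1 + s) powr \<mu> * H s"
          using s t M \<open>0 < \<mu>\<close> \<open>0 < K\<^sub>2\<close> by (intro mult_mono powr_mono2) auto
      qed (use t M \<open>0 < K\<^sub>2\<close> in auto)
      also have "\<dots> \<le> (2 * (1 + M)) powr \<mu> * F' t"
        using t M \<open>0 < \<mu>\<close> F'_nonneg[of t] by (intro mult_right_mono powr_mono2) auto
      also have "\<dots> = (1 + M) powr \<mu> * (2 powr \<mu> * F' t)"
        using M powr_mult[of 2 "1 + M" \<mu>] by (simp only: mult_ac)
      finally have "(1 + M) powr \<mu> * (K\<^sub>2 * F a powr q * (3 powr (- \<bar>?B\<bar>) * M powr ?B) * (t - a))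
          \<le> (1 + M) powr \<mu> * (2 powr \<mu> * F' t)"
        by (simp only: mult.assoc)
      then have "K\<^sub>2 * F a powr q * (3 powr (- \<bar>?B\<bar>) * M powr ?B) * (t - a) \<le> 2 powr \<mu> * F' t"
        using M by (simp only: mult_le_cancel_left_pos powr_gt_zero)
      then have "2 powr (- \<mu>) * (K\<^sub>2 * F a powr q * (3 powr (- \<bar>?B\<bar>) * M powr ?B) * (t - a))
          \<le> 2 powr (- \<mu>) * (2 powr \<mu> * F' t)"
        by (intro mult_left_mono) auto
      also have "2 powr (- \<mu>) * (2 powr \<mu> * F' t) = F' t"
        by (simp flip: mult.assoc powr_add)
      finally show ?thesis by (simp add: k\<^sub>3_def mult_ac)
    qed
    show "b \<le> 2 * L * \<epsilon> powr (- (p * (q - 1) / \<theta>))"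
    proof (rule ccontr)
      assume *: "\<not> ?thesis"
      define M where "M = L * \<epsilon> powr (- (p * (q - 1) / \<theta>))"
      have M: "4 \<le> M" "2 * M \<le> b"
      proof -
        have "1 powr (- (p * (q - 1) / \<theta>)) \<le> \<epsilon> powr (- (p * (q - 1) / \<theta>))"
          using \<epsilon> \<open>0 < p\<close> \<open>1 < q\<close> \<open>0 < \<theta>\<close> by (intro powr_mono2') auto
        then have "4 * 1 \<le> M" unfolding M_def using L by (intro mult_mono) auto
        then show "4 \<le> M" by simp
        show "2 * M \<le> b" using * by (simp add: M_def)
      qed
      define F\<^sub>0 where "F\<^sub>0 = k\<^sub>2 * \<epsilon> powr p * M powr (2 - \<kappa>)"
      define B where "B = k\<^sub>3 * M powr (- N * (q - 1))"
      have pos: "0 < F\<^sub>0" "0 < B" using k \<epsilon> M by (auto simp: F\<^sub>0_def B_def)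
      show False
      proof (rule kato_blow_up[of q B F\<^sub>0 F M F', folded r_def])
        show "F\<^sub>0 \<le> F M" unfolding F\<^sub>0_def by (rule F_lower) (use M in auto)
        show "(F has_real_derivative F' t) (at t within {M..2 * M})" if "t \<in> {M..2 * M}" for t
          by (rule F_sub) (use M that in auto)
        show "B * (t - a) * F a powr q \<le> F' t" if "M \<le> a" "a \<le> t" "t \<le> 2 * M" for a t
          unfolding B_def by (rule F'_growth[OF M that])
        have M_\<theta>: "M powr \<theta> = L powr \<theta> * \<epsilon> powr (- (p * (q - 1)))"
        proof -
          have "M powr \<theta> = L powr \<theta> * (\<epsilon> powr (- (p * (q - 1) / \<theta>))) powr \<theta>"
            unfolding M_def using L by (simp add: powr_mult)
          also have "(\<epsilon> powr (- (p * (q - 1) / \<theta>))) powr \<theta> = \<epsilon> powr (- (p * (q - 1)))"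
            unfolding powr_powr using \<open>0 < \<theta>\<close> by simp
          finally show ?thesis .
        qed
        have "B * F\<^sub>0 powr (q - 1) * M\<^sup>2 = k\<^sub>3 * k\<^sub>2 powr (q - 1) * L powr \<theta>"
        proof -
          have "F\<^sub>0 powr (q - 1) = k\<^sub>2 powr (q - 1) * \<epsilon> powr (p * (q - 1)) * M powr ((2 - \<kappa>) * (q - 1))"
            unfolding F\<^sub>0_def using k by (simp add: powr_mult powr_powr)
          moreover have "M\<^sup>2 = M powr 2" using M by simp
          moreover have M_prod: "M powr (- N * (q - 1)) * M powr ((2 - \<kappa>) * (q - 1)) * M powr 2 = M powr \<theta>"
            by (simp add: \<theta> algebra_simps flip: powr_add)
          ultimately have "B * F\<^sub>0 powr (q - 1) * M\<^sup>2 = k\<^sub>3 * k\<^sub>2 powr (q - 1) * \<epsilon> powr (p * (q - 1)) * M powr \<theta>"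
            unfolding B_def M_prod[symmetric] by (simp only: mult_ac)
          moreover have "\<epsilon> powr (p * (q - 1)) * \<epsilon> powr (- (p * (q - 1))) = 1"
            using \<epsilon> by (simp flip: powr_add)
          ultimately show ?thesis unfolding M_\<theta> by simp
        qed
        then have "1 \<le> B * F\<^sub>0 powr (q - 1) * M\<^sup>2 * ((1 - r)\<^sup>2 / 2)"
          using L(2) by (simp add: k\<^sub>4_def mult_ac)
        then have "2 / (B * F\<^sub>0 powr (q - 1)) \<le> (M * (1 - r))\<^sup>2"
          using pos by (simp add: divide_le_eq power_mult_distrib mult_ac)
        then show "sqrt (2 / (B * F\<^sub>0 powr (q - 1))) \<le> M * (1 - r)"
          using M r by (intro real_le_lsqrt) auto
      qed (use \<open>1 < q\<close> pos in auto)
    qed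
  qed
qed

section \<open>Two integral inequalities\<close>

text \<open>Hoelder's inequality solved for the norm of \<open>v\<close>, obtained from Young's inequality for \<open>k |v|\<close> and \<open>w/k\<close>
with the optimal \<open>k\<close>. The form with an upper bound \<open>W\<close> and a lower bound \<open>m\<close> is the one needed for
sources.\<close>

lemma Holder_lower_bound:
  fixes v w :: "'a \<Rightarrow> real"
  assumes "1 < p" and "integrable M (\<lambda>x. \<bar>v x\<bar> powr p)"
    and "integrable M (\<lambda>x. w x powr (p / (p - 1)))" and "\<And>x. 0 \<le> w x"
    and "(LINT x|M. w x powr (p / (p - 1))) \<le> W" and "0 < W"
    and "0 \<le> m" and "m \<le> (LINT x|M. v x * w x)"
  shows "m powr p * W powr - (p - 1) \<le> (LINT x|M. \<bar>v x\<bar> powr p)"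
proof (cases "m = 0")
  case True
  then show ?thesis using assms(1) by (simp add: integral_nonneg_AE)
next
  case False
  with assms have m: "0 < m" by simp
  then have int: "integrable M (\<lambda>x. v x * w x)"
    using assms(8) not_integrable_integral_eq[of M "\<lambda>x. v x * w x"] by linarith
  define p' where "p' = p / (p - 1)"
  define I where "I = (LINT x|M. \<bar>v x\<bar> powr p)"
  \<comment> \<open>The optimal \<open>k\<close> makes the second term of Young's inequality equal to \<open>m/p'\<close>.\<close>
  define k where "k = (W / m) powr (1 / p')"
  have p': "1 < p'" "1 / p + 1 / p' = 1" using assms(1) by (auto simp: p'_def field_simps)
  have k: "0 < k" using assms(6) m by (simp add: k_def)
  have kp': "k powr p' = W / m" using p' assms(6) m by (simp add: k_def powr_powr)
  have kp: "k powr p = (W / m) powr (p - 1)"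
    using assms(1) by (simp add: k_def powr_powr p'_def)
  have young: "v x * w x \<le> k powr p / p * \<bar>v x\<bar> powr p + m / W / p' * w x powr p'" for x
  proof -
    have "v x * w x \<le> \<bar>v x\<bar> * w x" using assms(4) by (intro mult_right_mono) auto
    also have "\<dots> = (k * \<bar>v x\<bar>) * (w x / k)" using k by simp
    also have "\<dots> \<le> (k * \<bar>v x\<bar>) powr p / p + (w x / k) powr p' / p'"
      using assms(1,4) p' k by (intro Youngs_inequality) auto
    also have "\<dots> = k powr p / p * \<bar>v x\<bar> powr p + m / W / p' * w x powr p'"
      using k assms(4) by (simp add: powr_mult powr_divide kp')
    finally show ?thesis .
  qed
  have "m \<le> (LINT x|M. k powr p / p * \<bar>v x\<bar> powr p + m / W / p' * w x powr p')"
    by (rule order_trans[OF assms(8)], rule integral_mono[OF int _ young])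
       (use assms(2,3) in \<open>auto simp: p'_def\<close>)
  also have "\<dots> = k powr p / p * I + m / W / p' * (LINT x|M. w x powr p')"
    using assms(2,3) by (simp add: I_def p'_def)
  also have "\<dots> \<le> k powr p / p * I + m / W / p' * W"
  proof (intro add_left_mono mult_left_mono)
    show "(LINT x|M. w x powr p') \<le> W" using assms(5) by (simp add: p'_def)
    show "0 \<le> m / W / p'" using assms(6) m p' by simp
  qed
  finally have "m * (1 - 1 / p') \<le> k powr p / p * I"
    using assms(6) by (simp add: algebra_simps)
  moreover have "1 - 1 / p' = 1 / p" using p'(2) by simp
  ultimately have "m \<le> k powr p * I" using assms(1) by (simp add: field_simps)
  also have "\<dots> = W powr (p - 1) * m powr - (p - 1) * I"
    using m assms(6) powr_minus_divide[of m "p - 1"] by (simp add: kp powr_divide)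
  finally have "m * m powr (p - 1) \<le> W powr (p - 1) * m powr - (p - 1) * I * m powr (p - 1)"
    by (intro mult_right_mono) auto
  also have "\<dots> = W powr (p - 1) * I * (m powr - (p - 1) * m powr (p - 1))"
    by simp
  also have "m powr - (p - 1) * m powr (p - 1) = 1"
    using m by (simp flip: powr_add)
  finally have "m powr p \<le> W powr (p - 1) * I"
    using m by (simp add: powr_mult_base)
  then have "m powr p * W powr - (p - 1) \<le> W powr (p - 1) * I * W powr - (p - 1)"
    by (intro mult_right_mono) auto
  also have "\<dots> = I * (W powr (p - 1) * W powr - (p - 1))" by simp
  also have "W powr (p - 1) * W powr - (p - 1) = 1"
    using assms(6) by (simp flip: powr_add)
  finally show ?thesis by (simp add: I_def)
qed

text \<open>A discrete layer-cake estimate: the integrand is bounded on each layer \<open>k \<le> z < k + 1\<close>. It replaces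
integration in polar coordinates, both over directions and over radii.\<close>

lemma nn_integral_layers_le:
  fixes z :: "'a \<Rightarrow> real" and h :: "'a \<Rightarrow> ennreal" and c m :: "nat \<Rightarrow> real"
  assumes S: "\<And>k::nat. {x \<in> S. real k \<le> z x \<and> z x < real k + 1} \<in> sets M"
    and z: "\<And>x. x \<in> S \<Longrightarrow> 0 \<le> z x"
    and h: "\<And>x k. x \<in> S \<Longrightarrow> real k \<le> z x \<Longrightarrow> z x < real k + 1 \<Longrightarrow> h x \<le> ennreal (c k)"
    and m: "\<And>k. emeasure M {x \<in> S. real k \<le> z x \<and> z x < real k + 1} \<le> ennreal (m k)"
    and nn: "\<And>k. 0 \<le> c k" "\<And>k. 0 \<le> m k"
    and summ: "summable (\<lambda>k. c k * m k)"
  shows "(\<integral>\<^sup>+x. h x * indicator S x \<partial>M) \<le> ennreal (\<Sum>k. c k * m k)"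
proof -
  define L where "L k = {x \<in> S. real k \<le> z x \<and> z x < real k + 1}" for k :: nat
  have "(\<integral>\<^sup>+x. h x * indicator S x \<partial>M) \<le> (\<integral>\<^sup>+x. (\<Sum>k. ennreal (c k) * indicator (L k) x) \<partial>M)"
  proof (rule nn_integral_mono)
    fix x
    show "h x * indicator S x \<le> (\<Sum>k. ennreal (c k) * indicator (L k) x)"
    proof (cases "x \<in> S")
      case True
      define k where "k = nat \<lfloor>z x\<rfloor>"
      have k: "real k \<le> z x" "z x < real k + 1" using z[OF True] by (auto simp: k_def)
      then have "h x * indicator S x \<le> ennreal (c k) * indicator (L k) x"
        using True h[OF True k] by (simp add: L_def)
      also have "\<dots> \<le> (\<Sum>k. ennreal (c k) * indicator (L k) x)"
        using sum_le_suminf[of "\<lambda>k. ennreal (c k) * indicator (L k) x" "{k}"]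
        by (simp del: sum_mult_indicator)
      finally show ?thesis .
    qed simp
  qed
  also have "\<dots> = (\<Sum>k. ennreal (c k) * emeasure M (L k))"
    using S by (subst nn_integral_suminf) (auto simp: L_def nn_integral_cmult_indicator)
  also have "\<dots> \<le> (\<Sum>k. ennreal (c k * m k))"
    using m nn by (intro suminf_le) (auto simp: L_def ennreal_mult intro!: mult_left_mono)
  also have "\<dots> = ennreal (\<Sum>k. c k * m k)"
    using summ nn by (intro suminf_ennreal_eq) (auto simp: summable_sums)
  finally show ?thesis .
qed

lemma summable_exp_mult_powr:
  fixes a b :: real
  assumes "0 < a"
  shows "summable (\<lambda>k. exp (- a * real k) * (real k + 2) powr b)"
proof (rule summable_comparison_test_bigo)
  show "(\<lambda>k. exp (- a * real k) * (real k + 2) powr b) \<in> O(\<lambda>k. 1 / real k ^ 2)"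
    using assms by real_asymp
  show "summable (\<lambda>n. norm (1 / (real n)\<^sup>2))"
    using inverse_power_summable[of 2, where 'a = real] by (simp add: inverse_eq_divide)
qed

section \<open>A positive eigenfunction of the Laplacian\<close>

text \<open>For a density \<open>w\<close> that depends on the direction of \<open>y\<close> only, this is, up to a factor, an integral over
the unit sphere, written without surface measure. Densities occur because the derivative of a plane wave
in the direction \<open>v\<close> is its product with \<open>v \<bullet> sgn y\<close>.\<close>

definition plane_waves :: "('a::euclidean_space \<Rightarrow> real) \<Rightarrow> 'a \<Rightarrow> real" where
  "plane_waves w x = (LINT y|lborel. indicator (ball 0 1) y * (w y * exp (x \<bullet> sgn y)))"

lemma measurable_sgn [measurable]: "(sgn :: 'a::euclidean_space \<Rightarrow> 'a) \<in> borel_measurable borel"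
  unfolding sgn_div_norm[abs_def] by measurable

lemma ball_in_borel [measurable]: "ball x r \<in> sets borel"
  by simp

lemma abs_inner_sgn_le: "\<bar>x \<bullet> sgn y\<bar> \<le> norm (x :: 'a::euclidean_space)"
proof -
  have "\<bar>x \<bullet> sgn y\<bar> \<le> norm x * norm (sgn y)" by (rule Cauchy_Schwarz_ineq2)
  also have "\<dots> \<le> norm x * 1" by (intro mult_left_mono) (auto simp: norm_sgn)
  finally show ?thesis by simp
qed

lemma integrable_ball_bounded:
  fixes g :: "'a::euclidean_space \<Rightarrow> real"
  assumes [measurable]: "g \<in> borel_measurable borel" and "\<And>y. \<bar>g y\<bar> \<le> K"
  shows "integrable lborel (\<lambda>y. indicator (ball 0 1) y * g y)"
    and "\<bar>LINT y|lborel. indicator (ball 0 1) y * g y\<bar> \<le> K * measure lborel (ball (0::'a) 1)"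
proof -
  have fin: "emeasure lborel (ball (0::'a) 1) < \<infinity>"
    using emeasure_bounded_finite[of "ball (0::'a) 1"] by simp
  then have i: "integrable lborel (\<lambda>y. K * indicator (ball (0::'a) 1) y)"
    by (intro integrable_mult_right integrable_real_indicator) auto
  show 1: "integrable lborel (\<lambda>y. indicator (ball 0 1) y * g y)"
    by (rule Bochner_Integration.integrable_bound[OF i])
       (use assms(2) in \<open>auto simp: indicator_def intro: order_trans[OF _ abs_ge_self]\<close>)
  have "\<bar>LINT y|lborel. indicator (ball 0 1) y * g y\<bar> \<le> (LINT y|lborel. \<bar>indicator (ball 0 1) y * g y\<bar>)"
    using integral_abs_bound by blast
  also have "\<dots> \<le> (LINT y|lborel. K * indicator (ball (0::'a) 1) y)"
    by (rule integral_mono[OF _ i]) (use 1 assms(2) in \<open>auto simp: indicator_def intro: order_trans\<close>)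
  also have "\<dots> = K * measure lborel (ball (0::'a) 1)" by simp
  finally show "\<bar>LINT y|lborel. indicator (ball 0 1) y * g y\<bar> \<le> K * measure lborel (ball (0::'a) 1)" .
qed

lemma abs_exp_minus_linear_le:
  fixes d :: real
  assumes "\<bar>d\<bar> \<le> 1"
  shows "\<bar>exp d - 1 - d\<bar> \<le> d\<^sup>2"
proof -
  have "1 + d \<le> exp d" by (rule exp_ge_add_one_self)
  moreover have "exp d \<le> 1 + d + d\<^sup>2"
  proof (cases "0 \<le> d")
    case True
    then show ?thesis using exp_bound[of d] assms by simp
  next
    case False
    have pos: "0 < 1 + d + d\<^sup>2" using assms False by (cases "d = -1") (auto simp: add_pos_nonneg)
    have "1 \<le> (1 + d + d\<^sup>2) * (1 - d)"
    proof -
      have "(1 + d + d\<^sup>2) * (1 - d) = 1 - d ^ 3" by (simp add: algebra_simps power2_eq_square power3_eq_cube)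
      moreover have "d ^ 3 \<le> 0" using False by (simp add: power_le_zero_eq)
      ultimately show ?thesis by simp
    qed
    also have "\<dots> \<le> (1 + d + d\<^sup>2) * exp (- d)"
      using pos exp_ge_add_one_self[of "- d"] by (intro mult_left_mono) auto
    finally show ?thesis by (simp add: exp_minus field_simps)
  qed
  ultimately show ?thesis using zero_le_power2[of d] by linarith
qed

lemma abs_mult_exp_le:
  assumes "\<bar>a\<bar> \<le> K"
  shows "\<bar>a * exp (x \<bullet> sgn y)\<bar> \<le> K * exp (norm (x :: 'a::euclidean_space))"
proof -
  have "x \<bullet> sgn y \<le> norm x" using abs_inner_sgn_le[of x y] by linarith
  with assms show ?thesis unfolding abs_mult by (intro mult_mono) auto
qed

text \<open>Differentiation under the integral sign; since all frequencies are at most \<open>1\<close>, the second order Taylor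
remainder of the exponential is uniform in \<open>y\<close>.\<close>

lemma has_derivative_plane_waves:
  fixes w :: "'a::euclidean_space \<Rightarrow> real"
  assumes [measurable]: "w \<in> borel_measurable borel" and w: "\<And>y. \<bar>w y\<bar> \<le> K"
  shows "(plane_waves w has_derivative (\<lambda>v. plane_waves (\<lambda>y. w y * (v \<bullet> sgn y)) x)) (at x)"
proof -
  have K: "0 \<le> K" using w[of 0] by simp
  have wv: "\<bar>w y * (v \<bullet> sgn y)\<bar> \<le> K * norm v" for v y
    unfolding abs_mult using w[of y] abs_inner_sgn_le[of v y] by (intro mult_mono) auto
  have int: "integrable lborel (\<lambda>y. indicator (ball 0 1) y * (w y * exp (x \<bullet> sgn y)))" for x
    by (rule integrable_ball_bounded[OF _ abs_mult_exp_le[OF w]]) measurable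
  have intv: "integrable lborel (\<lambda>y. indicator (ball 0 1) y * (w y * (v \<bullet> sgn y) * exp (x \<bullet> sgn y)))" for x v
    by (rule integrable_ball_bounded[OF _ abs_mult_exp_le[OF wv]]) measurable
  let ?f = "\<lambda>v. plane_waves (\<lambda>y. w y * (v \<bullet> sgn y)) x"
  let ?V = "measure lborel (ball (0::'a) 1)"
  show ?thesis
  proof (rule has_derivativeI_sandwich[where e = 1 and H = "\<lambda>x'. K * exp (norm x) * ?V * norm (x' - x)"])
    show "bounded_linear ?f"
    proof (rule bounded_linear_intro)
      show "?f (u + v) = ?f u + ?f v" for u v
        unfolding plane_waves_def
        by (subst Bochner_Integration.integral_add[OF intv intv, symmetric])
           (simp add: algebra_simps inner_add_left)
      show "?f (r *\<^sub>R v) = r *\<^sub>R ?f v" for r v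
        unfolding plane_waves_def real_scaleR_def
        by (subst integral_mult_right_zero[symmetric]) (simp add: mult_ac)
      show "norm (?f v) \<le> norm v * (K * exp (norm x) * ?V)" for v
        unfolding plane_waves_def real_norm_def
        by (rule order_trans[OF integrable_ball_bounded(2)[OF _ abs_mult_exp_le[OF wv]]])
           (auto simp: mult_ac)
    qed
    show "norm (plane_waves w x' - plane_waves w x - ?f (x' - x)) / norm (x' - x)
        \<le> K * exp (norm x) * ?V * norm (x' - x)"
      if "x' \<noteq> x" "dist x' x < 1" for x'
    proof -
      let ?h = "x' - x"
      have h: "norm ?h \<le> 1" using that by (simp add: dist_norm)
      let ?r = "\<lambda>y. w y * exp (x \<bullet> sgn y) * (exp (?h \<bullet> sgn y) - 1 - ?h \<bullet> sgn y)"
      have "plane_waves w x' - plane_waves w x - ?f ?h = (LINT y|lborel. indicator (ball 0 1) y * ?r y)"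
        unfolding plane_waves_def
        by (subst Bochner_Integration.integral_diff[OF int int, symmetric],
            subst Bochner_Integration.integral_diff[OF Bochner_Integration.integrable_diff[OF int int] intv, symmetric])
           (auto intro!: Bochner_Integration.integral_cong simp: algebra_simps inner_diff_left exp_diff)
      moreover have "\<bar>LINT y|lborel. indicator (ball 0 1) y * ?r y\<bar> \<le> K * exp (norm x) * (norm ?h)\<^sup>2 * ?V"
      proof (rule integrable_ball_bounded(2))
        show "\<bar>?r y\<bar> \<le> K * exp (norm x) * (norm ?h)\<^sup>2" for y
        proof -
          have "\<bar>?h \<bullet> sgn y\<bar> \<le> norm ?h" by (rule abs_inner_sgn_le)
          moreover from this have "(?h \<bullet> sgn y)\<^sup>2 \<le> (norm ?h)\<^sup>2" by (rule abs_le_square_iff[THEN iffD1, OF order_trans]) simp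
          ultimately have "\<bar>exp (?h \<bullet> sgn y) - 1 - ?h \<bullet> sgn y\<bar> \<le> (norm ?h)\<^sup>2"
            using abs_exp_minus_linear_le[of "?h \<bullet> sgn y"] h by linarith
          then show ?thesis
            unfolding abs_mult[of "w y * exp (x \<bullet> sgn y)"] using abs_mult_exp_le[OF w] K by (intro mult_mono) auto
        qed
      qed measurable
      ultimately show ?thesis using that by (simp add: divide_le_eq power2_eq_square mult_ac)
    qed
    have "((\<lambda>x'. K * exp (norm x) * ?V * norm (x' - x)) \<longlongrightarrow> K * exp (norm x) * ?V * norm (x - x)) (at x)"
      by (intro tendsto_intros)
    then show "((\<lambda>x'. K * exp (norm x) * ?V * norm (x' - x)) \<longlongrightarrow> 0) (at x)" by simp
  qed auto
qed

lemma C_k_plane_waves: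
  fixes w :: "'a::euclidean_space \<Rightarrow> real"
  assumes "w \<in> borel_measurable borel" and "\<And>y. \<bar>w y\<bar> \<le> K"
  shows "C_k k (plane_waves w)"
  using assms
proof (induction k arbitrary: w K)
  case 0
  then show ?case
    using has_derivative_plane_waves[OF 0] 
    by (auto intro!: continuous_at_imp_continuous_on has_derivative_continuous)
next
  case (Suc k)
  note [measurable] = Suc.prems(1)
  show ?case
  proof (rule C_k_SucI[OF has_derivative_plane_waves[OF Suc.prems]])
    show "C_k k (plane_waves (\<lambda>y. w y * (v \<bullet> sgn y)))" for v
    proof (rule Suc.IH)
      show "\<bar>w y * (v \<bullet> sgn y)\<bar> \<le> K * norm v" for y
        unfolding abs_mult using Suc.prems(2)[of y] abs_inner_sgn_le[of v y] by (intro mult_mono) auto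
    qed measurable
  qed
qed

definition sphere_mean :: "'a::euclidean_space \<Rightarrow> real" where
  "sphere_mean = plane_waves (\<lambda>_. 1)"

lemma C_k_sphere_mean: "C_k k sphere_mean"
  unfolding sphere_mean_def by (rule C_k_plane_waves[where K = 1]) auto

text \<open>Every plane wave with a unit frequency \<open>\<omega>\<close> is reproduced by the Laplacian, because the squares of
\<open>b \<bullet> \<omega>\<close> over the basis add up to \<open>1\<close>.\<close>

lemma laplacian_sphere_mean:
  fixes x :: "'a::euclidean_space"
  shows "(\<Sum>b\<in>Basis. frechet_derivative (\<lambda>z. frechet_derivative sphere_mean (at z) b) (at x) b) = sphere_mean x"
proof -
  have 1: "frechet_derivative sphere_mean (at z) = (\<lambda>v. plane_waves (\<lambda>y. v \<bullet> sgn y) z)" for z :: 'a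
    using has_derivative_plane_waves[of "\<lambda>_. 1" 1 z]
    by (simp add: sphere_mean_def frechet_derivative_at[symmetric])
  have 2: "frechet_derivative (plane_waves (\<lambda>y. b \<bullet> sgn y)) (at x)
      = (\<lambda>v. plane_waves (\<lambda>y. (b \<bullet> sgn y) * (v \<bullet> sgn y)) x)" for b :: 'a
    by (rule frechet_derivative_at[symmetric], rule has_derivative_plane_waves[where K = "norm b"])
       (auto simp: abs_inner_sgn_le)
  have int: "integrable lborel (\<lambda>y. indicator (ball 0 1) y * ((b \<bullet> sgn y) * (b \<bullet> sgn y) * exp (x \<bullet> sgn y)))" for b :: 'a
  proof (rule integrable_ball_bounded(1)[OF _ abs_mult_exp_le])
    show "\<bar>(b \<bullet> sgn y) * (b \<bullet> sgn y)\<bar> \<le> norm b * norm b" for y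
      unfolding abs_mult by (intro mult_mono abs_inner_sgn_le) auto
  qed measurable
  \<comment> \<open>The frequency \<open>sgn y\<close> fails to be a unit vector only at \<open>y = 0\<close>, a null set.\<close>
  have "(\<Sum>b\<in>Basis. frechet_derivative (\<lambda>z. frechet_derivative sphere_mean (at z) b) (at x) b)
      = (LINT y|lborel. (\<Sum>b\<in>Basis. indicator (ball 0 1) y * ((b \<bullet> sgn y) * (b \<bullet> sgn y) * exp (x \<bullet> sgn y))))"
    unfolding 1 2 by (subst Bochner_Integration.integral_sum[OF int]) (simp add: plane_waves_def)
  also have "\<dots> = sphere_mean x"
    unfolding sphere_mean_def plane_waves_def
  proof (rule integral_cong_AE)
    show "AE y in lborel. (\<Sum>b\<in>Basis. indicator (ball 0 1) y * ((b \<bullet> sgn y) * (b \<bullet> sgn y) * exp (x \<bullet> sgn y)))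
        = indicator (ball 0 1) y * (1 * exp (x \<bullet> sgn y))"
      using AE_lborel_singleton[of "0::'a"]
    proof eventually_elim
      case (elim y)
      have "(\<Sum>b\<in>Basis. (b \<bullet> sgn y) * (b \<bullet> sgn y)) = sgn y \<bullet> sgn y"
        by (subst euclidean_inner) (simp add: inner_commute)
      also have "\<dots> = 1" using elim by (simp add: norm_sgn flip: power2_norm_eq_inner)
      finally show ?case
        by (simp add: sum_distrib_left[symmetric] sum_distrib_right[symmetric])
    qed
  qed measurable
  finally show ?thesis .
qed

lemma sphere_mean_pos: "0 < sphere_mean (x :: 'a::euclidean_space)"
proof -
  let ?B = "ball (0::'a) 1"
  have "0 < exp (- norm x) * measure lborel ?B"
    using content_ball_pos[of 1 "0::'a"] by simp
  also have "\<dots> = (LINT y|lborel. indicator ?B y * exp (- norm x))" by simp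
  also have "\<dots> \<le> sphere_mean x"
    unfolding sphere_mean_def plane_waves_def
  proof (rule integral_mono)
    show "integrable lborel (\<lambda>y. indicator ?B y * exp (- norm x))"
      by (rule integrable_ball_bounded(1)[where K = 1]) auto
    show "integrable lborel (\<lambda>y. indicator ?B y * (1 * exp (x \<bullet> sgn y)))"
      by (rule integrable_ball_bounded(1)[OF _ abs_mult_exp_le[where K = 1]]) auto
    show "indicator ?B y * exp (- norm x) \<le> indicator ?B y * (1 * exp (x \<bullet> sgn y))" for y
      using abs_inner_sgn_le[of x y] by (intro mult_left_mono) auto
  qed
  finally show ?thesis .
qed

section \<open>Growth of the spherical mean\<close>

lemma norm_orthogonal_part_squared:
  fixes e :: "'a::real_inner"
  assumes "norm e = 1"
  shows "(norm (y - (y \<bullet> e) *\<^sub>R e))\<^sup>2 = (norm y)\<^sup>2 - (y \<bullet> e)\<^sup>2"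
proof -
  have "e \<bullet> e = 1" using assms by (simp flip: power2_norm_eq_inner)
  then show ?thesis
    unfolding power2_norm_eq_inner by (simp add: inner_diff_left inner_diff_right inner_commute[of e y] power2_eq_square)
qed

text \<open>The part of the cylinder in the unit ball is covered by about \<open>2/r\<close> balls of radius \<open>2 r\<close> with centres
on its axis. This gives the right power of \<open>r\<close> without rotating the axis into a coordinate direction.\<close>

lemma emeasure_cylinder_le:
  fixes e :: "'a::euclidean_space"
  assumes "norm e = 1" and "0 < r"
  shows "emeasure lborel {y \<in> ball 0 1. norm (y - (y \<bullet> e) *\<^sub>R e) \<le> r}
    \<le> ennreal (5 * 2 ^ DIM('a) * unit_ball_vol (real DIM('a)) * r ^ (DIM('a) - 1))"
    (is "emeasure lborel ?C \<le> ennreal (?K * r ^ ?d)")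
proof (cases "r \<le> 1")
  case True
  define n where "n = \<lceil>1 / r\<rceil>"
  have n: "1 / r \<le> of_int n" "of_int n \<le> 1 / r + 1" unfolding n_def by linarith+
  have "?C \<subseteq> (\<Union>j\<in>{- n..n}. cball ((of_int j * r) *\<^sub>R e) (2 * r))"
  proof
    fix y assume y: "y \<in> ?C"
    define s where "s = y \<bullet> e"
    define j where "j = \<lfloor>s / r\<rfloor>"
    have "\<bar>s\<bar> \<le> norm y * norm e" unfolding s_def by (rule Cauchy_Schwarz_ineq2)
    then have s: "\<bar>s\<bar> \<le> 1" using y assms(1) by simp
    then have sr: "\<bar>s / r\<bar> \<le> of_int n"
      using n(1) assms(2) by (simp add: abs_divide) (meson divide_right_mono less_imp_le order_trans)
    have j: "of_int j \<le> s / r" "s / r \<le> of_int j + 1" unfolding j_def by linarith+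
    have "- of_int n \<le> s / r" using sr by linarith
    then have "- n \<le> j" by (simp add: j_def le_floor_iff)
    moreover have "of_int j \<le> (of_int n :: real)" using j sr by linarith
    then have "j \<le> n" by simp
    moreover have "norm (y - (of_int j * r) *\<^sub>R e) \<le> 2 * r"
    proof -
      have "norm (y - (of_int j * r) *\<^sub>R e) = norm ((y - s *\<^sub>R e) + (s - of_int j * r) *\<^sub>R e)"
        by (simp add: algebra_simps)
      also have "\<dots> \<le> norm (y - s *\<^sub>R e) + \<bar>s - of_int j * r\<bar>"
        by (rule order_trans[OF norm_triangle_ineq]) (simp add: assms(1))
      also have "\<dots> \<le> r + r"
      proof (rule add_mono)
        show "norm (y - s *\<^sub>R e) \<le> r" using y by (simp add: s_def)
        show "\<bar>s - of_int j * r\<bar> \<le> r" using j assms(2) by (simp add: field_simps abs_le_iff)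
      qed
      finally show ?thesis by simp
    qed
    ultimately show "y \<in> (\<Union>j\<in>{- n..n}. cball ((of_int j * r) *\<^sub>R e) (2 * r))"
      by (auto simp: dist_norm norm_minus_commute)
  qed
  then have "emeasure lborel ?C \<le> emeasure lborel (\<Union>j\<in>{- n..n}. cball ((of_int j * r) *\<^sub>R e) (2 * r))"
    by (intro emeasure_mono) auto
  also have "\<dots> \<le> (\<Sum>j\<in>{- n..n}. emeasure lborel (cball ((of_int j * r) *\<^sub>R e) (2 * r)))"
    by (intro emeasure_subadditive_finite) auto
  also have "\<dots> = (\<Sum>j\<in>{- n..n}. ennreal (unit_ball_vol (real DIM('a)) * (2 * r) ^ DIM('a)))"
    using assms(2) by (intro sum.cong) (auto simp: emeasure_cball)
  also have "\<dots> = ennreal (real (card {- n..n}) * (unit_ball_vol (real DIM('a)) * (2 * r) ^ DIM('a)))"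
    using assms(2) by (subst ennreal_mult) (auto simp: ennreal_of_nat_eq_real_of_nat)
  also have "real (card {- n..n}) \<le> 5 / r"
  proof -
    have "0 \<le> 1 / r" using assms(2) by simp
    then have "(0::real) \<le> of_int n" using n(1) by linarith
    then have "0 \<le> n" by simp
    then have "real (card {- n..n}) = 2 * of_int n + 1"
      by (simp add: of_nat_nat)
    also have "\<dots> \<le> 2 / r + 3" using n(2) by simp
    also have "\<dots> \<le> 5 / r" using True assms(2) by (simp add: field_simps)
    finally show ?thesis .
  qed
  then have "ennreal (real (card {- n..n}) * (unit_ball_vol (real DIM('a)) * (2 * r) ^ DIM('a)))
      \<le> ennreal (5 / r * (unit_ball_vol (real DIM('a)) * (2 * r) ^ DIM('a)))"
    using assms(2) by (intro ennreal_leI mult_right_mono) auto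
  also have "5 / r * (unit_ball_vol (real DIM('a)) * (2 * r) ^ DIM('a)) = ?K * r ^ ?d"
    using assms(2) power_minus_mult[of "DIM('a)" r] by (simp add: power_mult_distrib flip: power_minus_mult)
  finally show ?thesis .
next
  case False
  have "emeasure lborel ?C \<le> emeasure lborel (cball (0::'a) 1)"
    by (intro emeasure_mono) auto
  also have "\<dots> = ennreal (unit_ball_vol (real DIM('a)) * 1 ^ DIM('a))"
    by (rule emeasure_cball) simp
  also have "\<dots> \<le> ennreal (?K * r ^ ?d)"
  proof (rule ennreal_leI)
    have "1 * unit_ball_vol (real DIM('a)) * 1 \<le> 5 * 2 ^ DIM('a) * unit_ball_vol (real DIM('a)) * r ^ ?d"
    proof (intro mult_mono)
      show "(1::real) \<le> 5 * 2 ^ DIM('a)" using one_le_power[of "2::real" "DIM('a)"] by linarith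
      show "1 \<le> r ^ ?d" using False by simp
    qed auto
    then show "unit_ball_vol (real DIM('a)) * 1 ^ DIM('a) \<le> ?K * r ^ ?d" by simp
  qed
  finally show ?thesis .
qed

lemma sphere_mean_le_exp_norm:
  obtains V where "0 < V" "\<And>x::'a::euclidean_space. sphere_mean x \<le> V * exp (norm x)"
proof
  show "0 < measure lborel (ball (0::'a) 1)" using content_ball_pos[of 1 "0::'a"] by simp
  show "sphere_mean x \<le> measure lborel (ball (0::'a) 1) * exp (norm x)" for x :: 'a
  proof -
    have "\<bar>LINT y|lborel. indicator (ball 0 1) y * (1 * exp (x \<bullet> sgn y))\<bar>
        \<le> 1 * exp (norm x) * measure lborel (ball (0::'a) 1)"
      by (rule integrable_ball_bounded(2)[OF _ abs_mult_exp_le]) auto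
    then show ?thesis
      unfolding sphere_mean_def plane_waves_def by (simp add: abs_le_iff mult.commute)
  qed
qed

text \<open>With \<open>c\<close> the cosine of the angle between \<open>x\<close> and \<open>y\<close>, the loss \<open>1 - c\<close> is at least half of
\<open>1 - c\<^sup>2\<close>, and \<open>1 - c\<^sup>2\<close> dominates the square of the component of \<open>y\<close> orthogonal to \<open>x\<close>.\<close>

lemma inner_sgn_le_minus_orthogonal_part:
  fixes x :: "'a::real_inner"
  assumes "x \<noteq> 0" and "norm y < 1"
  shows "x \<bullet> sgn y \<le> norm x - norm x * (norm (y - (y \<bullet> sgn x) *\<^sub>R sgn x))\<^sup>2 / 2"
proof (cases "y = 0")
  case False
  define c where "c = sgn x \<bullet> sgn y"
  have e: "norm (sgn x) = 1" using assms by (simp add: norm_sgn)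
  have c: "\<bar>c\<bar> \<le> 1"
    unfolding c_def using Cauchy_Schwarz_ineq2[of "sgn x" "sgn y"] e False by (simp add: norm_sgn)
  have y: "y \<bullet> sgn x = norm y * c"
    using False by (simp add: c_def sgn_div_norm inner_commute)
  have "(norm (y - (y \<bullet> sgn x) *\<^sub>R sgn x))\<^sup>2 = (norm y)\<^sup>2 * (1 - c\<^sup>2)"
    unfolding norm_orthogonal_part_squared[OF e] by (simp add: y power_mult_distrib algebra_simps)
  also have "\<dots> \<le> 1 * (1 - c\<^sup>2)"
    using assms c by (intro mult_right_mono) (auto simp: power_le_one abs_square_le_1)
  also have "\<dots> = (1 - c) * (1 + c)" by (simp add: power2_eq_square algebra_simps)
  also have "\<dots> \<le> (1 - c) * 2" using c by (intro mult_left_mono) auto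
  finally have "norm x * ((norm (y - (y \<bullet> sgn x) *\<^sub>R sgn x))\<^sup>2) \<le> norm x * ((1 - c) * 2)"
    by (intro mult_left_mono) auto
  moreover have "x \<bullet> sgn y = norm x * c"
    using assms by (simp add: c_def sgn_div_norm)
  ultimately show ?thesis by (simp add: algebra_simps)
qed simp

text \<open>A power of \<open>n\<close> is useful for \<open>n \<ge> 1\<close> only, since it is singular at \<open>0\<close>; the power of \<open>1 + n\<close> combines
it with a bound near the origin.\<close>

lemma near_and_far_bound:
  fixes s E n a V W :: real
  assumes "0 \<le> a" "0 \<le> n" "0 \<le> V" "0 \<le> W" "0 \<le> E"
    and near: "s \<le> V * E" and far: "1 \<le> n \<Longrightarrow> s \<le> W * (E * n powr (- a))"
  shows "s \<le> (V + W) * 2 powr a * (E * (1 + n) powr (- a))"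
proof -
  define r where "r = 2 powr a * (1 + n) powr (- a)"
  have r: "r = ((1 + n) / 2) powr (- a)"
    using powr_divide[of "1 + n" 2 "- a"] powr_minus_divide[of 2 a] by (simp add: r_def)
  have "s \<le> (V + W) * (E * r)"
  proof (cases "1 \<le> n")
    case True
    then have "n powr (- a) \<le> r"
      unfolding r using \<open>0 \<le> a\<close> by (intro powr_mono2') auto
    then have "W * (E * n powr (- a)) \<le> (V + W) * (E * r)"
      using assms by (intro mult_mono mult_nonneg_nonneg) auto
    with far[OF True] show ?thesis by (rule order_trans)
  next
    case False
    then have "1 powr (- a) \<le> r"
      unfolding r using \<open>0 \<le> a\<close> \<open>0 \<le> n\<close> by (intro powr_mono2') auto
    then have "V * (E * 1) \<le> (V + W) * (E * r)"
      using assms by (intro mult_mono mult_nonneg_nonneg) auto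
    with near show ?thesis by simp
  qed
  then show ?thesis by (simp add: r_def mult_ac)
qed

text \<open>The integrand is at most \<open>exp (norm x)\<close> times a Gaussian in the component of \<open>y\<close> orthogonal to \<open>x\<close>,
of width \<open>norm x powr (-1/2)\<close>. There are \<open>DIM('a) - 1\<close> such directions, hence the exponent. The Gaussian
is integrated over the layers of \<open>norm x\<close> times the squared orthogonal component, which are contained
in cylinders.\<close>

lemma sphere_mean_le:
  obtains C where "0 < C" and "\<And>x :: 'a::euclidean_space.
    sphere_mean x \<le> C * (exp (norm x) * (1 + norm x) powr (- (real DIM('a) - 1) / 2))"
proof -
  define a where "a = (real DIM('a) - 1) / 2"
  have a0: "0 \<le> a" using DIM_positive[where 'a = 'a] by (simp add: a_def Suc_leI)
  define K where "K = (\<Sum>k. exp (- (1/2) * real k) * (real k + 2) powr a)"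
  have sK: "summable (\<lambda>k. exp (- (1/2) * real k) * (real k + 2) powr a)"
    by (rule summable_exp_mult_powr) simp
  have K: "0 \<le> K" unfolding K_def using sK by (intro suminf_nonneg) auto
  define D where "D = 5 * 2 ^ DIM('a) * unit_ball_vol (real DIM('a))"
  have far: "sphere_mean x \<le> D * K * (exp (norm x) * norm x powr (- a))"
    if x1: "1 \<le> norm x" for x :: 'a
  proof -
    from x1 have x: "x \<noteq> 0" "0 < norm x" by auto
    define z where "z y = norm x * (norm (y - (y \<bullet> sgn x) *\<^sub>R sgn x))\<^sup>2" for y
    have [measurable]: "z \<in> borel_measurable borel" unfolding z_def by measurable
    have "(\<integral>\<^sup>+y. ennreal (exp (x \<bullet> sgn y)) * indicator (ball 0 1) y \<partial>lborel)
      \<le> ennreal (\<Sum>k. (exp (norm x) * exp (- (1/2) * real k)) * (D * norm x powr (- a) * (real k + 2) powr a))"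
    proof (rule nn_integral_layers_le[where z = z])
      show "{y \<in> ball 0 1. real k \<le> z y \<and> z y < real k + 1} \<in> sets lborel" for k
      proof -
        have "{y \<in> space lborel. y \<in> ball 0 1 \<and> real k \<le> z y \<and> z y < real k + 1} \<in> sets lborel"
          by measurable
        then show ?thesis by simp
      qed
      show "0 \<le> z y" for y by (simp add: z_def)
      show "ennreal (exp (x \<bullet> sgn y)) \<le> ennreal (exp (norm x) * exp (- (1/2) * real k))"
        if "y \<in> ball 0 1" "real k \<le> z y" for y :: 'a and k
      proof -
        have "x \<bullet> sgn y \<le> norm x - z y / 2"
          using inner_sgn_le_minus_orthogonal_part[OF x(1), of y] that by (simp add: z_def)
        also have "\<dots> \<le> norm x + - (1/2) * real k" using that by simp
        finally show ?thesis by (simp flip: exp_add)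
      qed
      show "emeasure lborel {y \<in> ball 0 1. real k \<le> z y \<and> z y < real k + 1}
          \<le> ennreal (D * norm x powr (- a) * (real k + 2) powr a)" for k
      proof -
        define r where "r = sqrt ((real k + 2) / norm x)"
        have r: "0 < r" using x by (simp add: r_def add_pos_nonneg)
        have "emeasure lborel {y \<in> ball 0 1. real k \<le> z y \<and> z y < real k + 1}
           \<le> emeasure lborel {y \<in> ball 0 1. norm (y - (y \<bullet> sgn x) *\<^sub>R sgn x) \<le> r}"
        proof (rule emeasure_mono)
          show "{y \<in> ball 0 1. real k \<le> z y \<and> z y < real k + 1} \<subseteq> {y \<in> ball 0 1. norm (y - (y \<bullet> sgn x) *\<^sub>R sgn x) \<le> r}"
          proof safe
            fix y assume "z y < real k + 1"
            then have "(norm (y - (y \<bullet> sgn x) *\<^sub>R sgn x))\<^sup>2 \<le> (real k + 2) / norm x"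
              using x by (simp add: z_def field_simps)
            then show "norm (y - (y \<bullet> sgn x) *\<^sub>R sgn x) \<le> r"
              unfolding r_def by (rule real_le_rsqrt)
          qed
          have "{y \<in> space lborel. y \<in> ball 0 1 \<and> norm (y - (y \<bullet> sgn x) *\<^sub>R sgn x) \<le> r} \<in> sets lborel"
            by measurable
          then show "{y \<in> ball 0 1. norm (y - (y \<bullet> sgn x) *\<^sub>R sgn x) \<le> r} \<in> sets lborel" by simp
        qed
        also have "\<dots> \<le> ennreal (D * r ^ (DIM('a) - 1))"
          unfolding D_def using x r by (intro emeasure_cylinder_le) (auto simp: norm_sgn)
        also have "D * r ^ (DIM('a) - 1) = D * norm x powr (- a) * (real k + 2) powr a"
        proof -
          have "real (DIM('a) - 1) = 2 * a" by (simp add: a_def of_nat_diff)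
          then have "r ^ (DIM('a) - 1) = r powr (2 * a)"
            using r powr_realpow[of r "DIM('a) - 1"] by simp
          also have "\<dots> = (r powr 2) powr a" by (simp only: powr_powr)
          also have "r powr 2 = (real k + 2) / norm x"
            using r x by (simp add: r_def)
          also have "((real k + 2) / norm x) powr a = norm x powr (- a) * (real k + 2) powr a"
            using x powr_minus_divide[of "norm x" a] by (simp add: powr_divide)
          finally show ?thesis by simp
        qed
        finally show ?thesis .
      qed
      show "summable (\<lambda>k. exp (norm x) * exp (- (1/2) * real k) * (D * norm x powr (- a) * (real k + 2) powr a))"
        using summable_mult[OF sK, of "exp (norm x) * D * norm x powr (- a)"] by (simp add: mult_ac)
    qed (auto simp: D_def)
    also have "(\<Sum>k. (exp (norm x) * exp (- (1/2) * real k)) * (D * norm x powr (- a) * (real k + 2) powr a))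
       = D * K * (exp (norm x) * norm x powr (- a))"
      unfolding K_def using suminf_mult[OF sK, of "exp (norm x) * D * norm x powr (- a)"] by (simp add: mult_ac)
    finally have *: "(\<integral>\<^sup>+y. ennreal (exp (x \<bullet> sgn y)) * indicator (ball 0 1) y \<partial>lborel)
       \<le> ennreal (D * K * (exp (norm x) * norm x powr (- a)))" .
    have "ennreal (sphere_mean x) = (\<integral>\<^sup>+y. ennreal (indicator (ball 0 1) y * (1 * exp (x \<bullet> sgn y))) \<partial>lborel)"
      unfolding sphere_mean_def plane_waves_def
    proof (rule nn_integral_eq_integral[symmetric])
      show "integrable lborel (\<lambda>y. indicator (ball 0 1) y * (1 * exp (x \<bullet> sgn y)))"
        by (rule integrable_ball_bounded(1)[OF _ abs_mult_exp_le[where K = 1]]) auto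
    qed simp
    also have "\<dots> = (\<integral>\<^sup>+y. ennreal (exp (x \<bullet> sgn y)) * indicator (ball 0 1) y \<partial>lborel)"
      by (intro nn_integral_cong) (auto simp: indicator_def)
    finally have "ennreal (sphere_mean x) \<le> ennreal (D * K * (exp (norm x) * norm x powr (- a)))"
      using * by simp
    then show ?thesis using K by (simp add: D_def ennreal_le_iff)
  qed
  obtain V where V: "0 < V" "\<And>x::'a::euclidean_space. sphere_mean x \<le> V * exp (norm x)"
    using sphere_mean_le_exp_norm by blast
  define C where "C = (V + D * K) * 2 powr a"
  have DK: "0 \<le> D * K" using K by (simp add: D_def)
  show thesis
  proof (rule that)
    show "0 < C" using V(1) DK by (simp add: C_def add_pos_nonneg)
    show "sphere_mean x \<le> C * (exp (norm x) * (1 + norm x) powr (- (real DIM('a) - 1) / 2))" for x :: 'a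
    proof -
      have a: "- (real DIM('a) - 1) / 2 = - a" by (simp add: a_def field_simps)
      show ?thesis
        unfolding a C_def by (rule near_and_far_bound[OF a0 norm_ge_zero less_imp_le[OF V(1)] DK exp_ge_zero V(2) far])
    qed
  qed
qed

lemma emeasure_shell_le:
  assumes "0 \<le> r" and "0 \<le> k"
  shows "emeasure lborel {x :: 'a::euclidean_space. norm x \<le> r \<and> k \<le> r - norm x \<and> r - norm x < k + 1}
    \<le> ennreal (unit_ball_vol (real DIM('a)) * (real DIM('a) * (1 + r) ^ (DIM('a) - 1)))"
    (is "emeasure lborel ?S \<le> ennreal (?v * ?B)")
proof (cases "k \<le> r")
  case True
  define \<rho> where "\<rho> = r - k"
  define t where "t = max 0 (\<rho> - 1)"
  have t: "0 \<le> \<rho>" "0 \<le> t" "t \<le> \<rho>" "\<rho> \<le> t + 1" "\<rho> \<le> 1 + r"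
    using True assms by (auto simp: t_def \<rho>_def)
  have "?S \<subseteq> cball 0 \<rho> - ball 0 t"
    using norm_ge_zero[where 'a = 'a] by (auto simp: \<rho>_def t_def max_def not_less split: if_splits)
  then have "emeasure lborel ?S \<le> emeasure lborel (cball (0::'a) \<rho> - ball 0 t)"
    by (intro emeasure_mono) auto
  also have "\<dots> = emeasure lborel (cball (0::'a) \<rho>) - emeasure lborel (ball (0::'a) t)"
    using t emeasure_bounded_finite[of "ball (0::'a) t"] by (intro emeasure_Diff) auto
  also have "\<dots> = ennreal (?v * \<rho> ^ DIM('a) - ?v * t ^ DIM('a))"
    using t by (simp add: emeasure_cball emeasure_ball ennreal_minus)
  also have "\<dots> \<le> ennreal (?v * ?B)"
  proof (rule ennreal_leI)
    have DIM: "DIM('a) = Suc (DIM('a) - 1)" using DIM_positive[where 'a = 'a] by simp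
    have "\<rho> ^ DIM('a) - t ^ DIM('a) = (\<rho> - t) * (\<Sum>i<DIM('a). t ^ (DIM('a) - Suc i) * \<rho> ^ i)"
      by (rule power_diff_sumr2)
    also have "\<dots> \<le> 1 * (\<Sum>i<DIM('a). (1 + r) ^ (DIM('a) - 1))"
    proof (intro mult_mono sum_mono)
      fix i assume "i \<in> {..<DIM('a)}"
      then have "t ^ (DIM('a) - Suc i) * \<rho> ^ i \<le> (1 + r) ^ (DIM('a) - Suc i) * (1 + r) ^ i"
        using t by (intro mult_mono power_mono) auto
      also have "\<dots> = (1 + r) ^ (DIM('a) - 1)"
        using \<open>i \<in> {..<DIM('a)}\<close> by (simp flip: power_add)
      finally show "t ^ (DIM('a) - Suc i) * \<rho> ^ i \<le> (1 + r) ^ (DIM('a) - 1)" .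
    qed (use t in \<open>auto intro!: sum_nonneg\<close>)
    finally have "?v * (\<rho> ^ DIM('a) - t ^ DIM('a)) \<le> ?v * ?B"
      by (intro mult_left_mono) auto
    then show "?v * \<rho> ^ DIM('a) - ?v * t ^ DIM('a) \<le> ?v * ?B"
      by (simp add: right_diff_distrib)
  qed
  finally show ?thesis .
next
  case False
  have "?S = {}"
  proof safe
    fix x :: 'a assume "k \<le> r - norm x"
    with False norm_ge_zero[of x] show "x \<in> {}" by linarith
  qed
  show ?thesis unfolding \<open>?S = {}\<close> by simp
qed

text \<open>The integrand grows exponentially with \<open>norm x\<close>, so that only the points at a bounded distance from the
boundary of the ball matter; the layers are spherical shells of thickness \<open>1\<close>, counted from the
boundary.\<close>

lemma nn_integral_sphere_mean_powr_le:
  fixes \<sigma> :: real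
  assumes "0 < \<sigma>"
  obtains C where "0 < C" and "\<And>r. 0 \<le> r \<Longrightarrow>
    (\<integral>\<^sup>+x. ennreal (sphere_mean (x :: 'a::euclidean_space) powr \<sigma>) * indicator (cball 0 r) x \<partial>lborel)
      \<le> ennreal (C * (exp (\<sigma> * r) * (1 + r) powr ((real DIM('a) - 1) * (1 - \<sigma> / 2))))"
proof -
  define d where "d = real DIM('a) - 1"
  have d: "0 \<le> d" "real (DIM('a) - 1) = d" using DIM_positive[where 'a = 'a] by (auto simp: d_def of_nat_diff Suc_leI)
  obtain C where C: "0 < C" "\<And>x :: 'a. sphere_mean x \<le> C * (exp (norm x) * (1 + norm x) powr (- d / 2))"
    using sphere_mean_le[where 'a = 'a] unfolding d_def by blast
  define a where "a = d * \<sigma> / 2"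
  have a: "0 \<le> a" using d(1) assms by (simp add: a_def)
  define K where "K = (\<Sum>k. exp (- \<sigma> * real k) * (real k + 2) powr a)"
  have sK: "summable (\<lambda>k. exp (- \<sigma> * real k) * (real k + 2) powr a)"
    by (rule summable_exp_mult_powr[OF assms])
  have K: "0 < K" unfolding K_def using sK by (intro suminf_pos) auto
  define v where "v = unit_ball_vol (real DIM('a)) * real DIM('a)"
  have v: "0 < v" by (simp add: v_def)
  show thesis
  proof (rule that)
    show "0 < C powr \<sigma> * K * v" using C K v by simp
    fix r :: real assume r: "0 \<le> r"
    let ?E = "C powr \<sigma> * exp (\<sigma> * r) * (1 + r) powr (- a)"
    have "(\<integral>\<^sup>+x. ennreal (sphere_mean (x :: 'a) powr \<sigma>) * indicator (cball 0 r) x \<partial>lborel)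
      \<le> ennreal (\<Sum>k. (?E * (exp (- \<sigma> * real k) * (real k + 2) powr a)) * (v * (1 + r) powr d))"
    proof (rule nn_integral_layers_le[where z = "\<lambda>x. r - norm x"])
      show "{x \<in> cball (0::'a) r. real k \<le> r - norm x \<and> r - norm x < real k + 1} \<in> sets lborel" for k
      proof -
        have [measurable]: "(\<lambda>x::'a. r - norm x) \<in> borel_measurable borel" "cball (0::'a) r \<in> sets borel"
          by simp_all
        have "{x \<in> space lborel. x \<in> cball (0::'a) r \<and> real k \<le> r - norm x \<and> r - norm x < real k + 1} \<in> sets lborel"
          by measurable
        then show ?thesis by simp
      qed
      show "emeasure lborel {x \<in> cball (0::'a) r. real k \<le> r - norm x \<and> r - norm x < real k + 1}
         \<le> ennreal (v * (1 + r) powr d)" for k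
      proof -
        have "(1 + r) powr d = (1 + r) ^ (DIM('a) - 1)"
          using powr_realpow[of "1 + r" "DIM('a) - 1"] r d(2) by simp
        then show ?thesis
          using emeasure_shell_le[where 'a = 'a, OF r, of "real k"] by (simp add: v_def mult.assoc)
      qed
      show "ennreal (sphere_mean x powr \<sigma>) \<le> ennreal (?E * (exp (- \<sigma> * real k) * (real k + 2) powr a))"
        if x: "x \<in> cball 0 r" "real k \<le> r - norm x" "r - norm x < real k + 1" for x :: 'a and k
      proof (rule ennreal_leI)
        have "sphere_mean x powr \<sigma> \<le> (C * (exp (norm x) * (1 + norm x) powr (- d / 2))) powr \<sigma>"
          using assms C(2)[of x] sphere_mean_pos[of x] by (intro powr_mono2) auto
        also have "\<dots> = C powr \<sigma> * (exp (\<sigma> * norm x) * (1 + norm x) powr (- a))"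
        proof -
          have "(C * (exp (norm x) * (1 + norm x) powr (- d / 2))) powr \<sigma>
             = C powr \<sigma> * (exp (norm x) powr \<sigma> * ((1 + norm x) powr (- d / 2)) powr \<sigma>)"
            using C(1) by (simp add: powr_mult)
          also have "exp (norm x) powr \<sigma> = exp (\<sigma> * norm x)"
            by (simp add: exp_powr_real mult.commute)
          also have "((1 + norm x) powr (- d / 2)) powr \<sigma> = (1 + norm x) powr (- a)"
            unfolding powr_powr by (simp add: a_def)
          finally show ?thesis .
        qed
        also have "\<dots> \<le> C powr \<sigma> * ((exp (\<sigma> * r) * exp (- \<sigma> * real k)) * ((1 + r) powr (- a) * (real k + 2) powr a))"
        proof (intro mult_left_mono mult_mono)
          have "\<sigma> * norm x \<le> \<sigma> * (r - real k)" using x assms by (intro mult_left_mono) auto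
          then show "exp (\<sigma> * norm x) \<le> exp (\<sigma> * r) * exp (- \<sigma> * real k)"
            by (simp add: algebra_simps flip: exp_add)
          have n: "0 < 1 + norm x" by (simp add: add_pos_nonneg)
          have "1 + r \<le> (1 + norm x) * (real k + 2)"
          proof -
            have "1 + r \<le> norm x + (real k + 2)" using x by simp
            also have "\<dots> \<le> (1 + norm x) * (real k + 2)"
              using mult_left_mono[of 1 "real k + 2" "norm x"] by (simp add: algebra_simps)
            finally show ?thesis .
          qed
          then have "((1 + norm x) * (real k + 2)) powr (- a) \<le> (1 + r) powr (- a)"
            using r a by (intro powr_mono2') auto
          then have "(1 + norm x) powr (- a) * (real k + 2) powr (- a) * (real k + 2) powr a
              \<le> (1 + r) powr (- a) * (real k + 2) powr a"
            using n by (intro mult_right_mono) (auto simp: powr_mult)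
          moreover have "(real k + 2) powr (- a) * (real k + 2) powr a = 1"
            by (simp flip: powr_add)
          ultimately show "(1 + norm x) powr (- a) \<le> (1 + r) powr (- a) * (real k + 2) powr a"
            by (simp add: mult.assoc)
        qed auto
        finally show "sphere_mean x powr \<sigma> \<le> ?E * (exp (- \<sigma> * real k) * (real k + 2) powr a)"
          by (simp add: mult_ac)
      qed
      show "summable (\<lambda>k. ?E * (exp (- \<sigma> * real k) * (real k + 2) powr a) * (v * (1 + r) powr d))"
        by (intro summable_mult2 summable_mult sK)
    qed (use v in auto)
    also have "(\<Sum>k. (?E * (exp (- \<sigma> * real k) * (real k + 2) powr a)) * (v * (1 + r) powr d))
       = ?E * K * (v * (1 + r) powr d)"
      unfolding K_def by (simp only: suminf_mult2[OF summable_mult[OF sK], symmetric] suminf_mult[OF sK])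
    also have "\<dots> = C powr \<sigma> * K * v * (exp (\<sigma> * r) * ((1 + r) powr (- a) * (1 + r) powr d))"
      by (simp add: mult_ac)
    also have "(1 + r) powr (- a) * (1 + r) powr d = (1 + r) powr (d * (1 - \<sigma> / 2))"
      by (simp add: a_def algebra_simps flip: powr_add)
    finally show "(\<integral>\<^sup>+x. ennreal (sphere_mean (x :: 'a) powr \<sigma>) * indicator (cball 0 r) x \<partial>lborel)
      \<le> ennreal (C powr \<sigma> * K * v * (exp (\<sigma> * r) * (1 + r) powr ((real DIM('a) - 1) * (1 - \<sigma> / 2))))"
      by (simp add: d_def)
  qed
qed

section \<open>Lebesgue measurable sections and square integrable functions\<close>

lemma AE_lebesgue_iff: "(AE x in lebesgue. P x) \<longleftrightarrow> (AE x in lborel. P x)"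
  by (rule AE_completion_iff)

lemma borel_measurable_lebesgue_cong_AE:
  fixes f g :: "'a::euclidean_space \<Rightarrow> real"
  assumes "f \<in> borel_measurable lebesgue" and "AE x in lebesgue. f x = g x"
  shows "g \<in> borel_measurable lebesgue"
proof (rule measurableI)
  fix A :: "real set" assume A: "A \<in> sets borel"
  have "AE x in lebesgue. x \<in> f -` A \<inter> space lebesgue \<longleftrightarrow> x \<in> g -` A \<inter> space lebesgue"
    using assms(2) by eventually_elim auto
  then show "g -` A \<inter> space lebesgue \<in> sets lebesgue"
    by (rule completion.in_sets_AE[OF _ measurable_sets[OF assms(1) A]]) auto
qed simp

text \<open>The Lebesgue measure on a product is not the product of the Lebesgue measures but its completion; this
lemma and the next one transfer sections and Fubini's theorem through a Borel representative.\<close>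

lemma AE_lebesgue_pair_snd:
  fixes P :: "'a::euclidean_space \<times> 'b::euclidean_space \<Rightarrow> bool"
  assumes "AE z in lebesgue. P z"
  shows "AE t in lebesgue. AE x in lebesgue. P (x, t)"
proof -
  have "AE z in lborel \<Otimes>\<^sub>M lborel. P z"
    using assms unfolding AE_lebesgue_iff lborel_prod .
  then obtain N where N: "{z. \<not> P z} \<subseteq> N" "emeasure (lborel \<Otimes>\<^sub>M lborel) N = 0"
    "N \<in> sets (lborel \<Otimes>\<^sub>M lborel :: ('a \<times> 'b) measure)"
    by (elim AE_E) (auto simp: space_pair_measure)
  have "AE z in lborel \<Otimes>\<^sub>M lborel. z \<notin> N"
    using N by (intro AE_not_in) (auto simp: null_sets_def)
  from lborel_pair.AE_pair[OF this] have "AE x in lborel. AE t in lborel. (x, t) \<notin> N" .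
  moreover have "{z \<in> space (lborel \<Otimes>\<^sub>M lborel). (fst z, snd z) \<notin> N} \<in> sets (lborel \<Otimes>\<^sub>M lborel :: ('a \<times> 'b) measure)"
  proof -
    have "{z \<in> space (lborel \<Otimes>\<^sub>M lborel). (fst z, snd z) \<notin> N} = space (lborel \<Otimes>\<^sub>M lborel) - N" by auto
    then show ?thesis using sets.compl_sets[OF N(3)] by (simp only:)
  qed
  ultimately have "AE t in lborel. AE x in lborel. (x, t) \<notin> N"
    using lborel_pair.AE_commute[of "\<lambda>x t. (x, t) \<notin> N"] by simp
  then have "AE t in lborel. AE x in lborel. P (x, t)"
  proof eventually_elim
    case (elim t)
    then show ?case by eventually_elim (use N in auto)
  qed
  then show ?thesis by (simp add: AE_lebesgue_iff)
qed

lemma lebesgue_Fubini_snd: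
  fixes h :: "'a::euclidean_space \<times> 'b::euclidean_space \<Rightarrow> real"
  assumes "integrable lebesgue h"
  shows "AE t in lebesgue. integrable lebesgue (\<lambda>x. h (x, t))"
    and "integrable lebesgue (\<lambda>t. LINT x|lebesgue. h (x, t))"
proof -
  have hm: "h \<in> borel_measurable lebesgue" using assms by simp
  obtain g where gm: "g \<in> borel_measurable lborel" and ae: "AE z in lborel. h z = g z"
    using completion_ex_borel_measurable_real[OF hm] by blast
  have "integrable lebesgue g"
    by (rule integrable_cong_AE_imp[OF assms measurable_completion[OF gm]])
       (use ae in \<open>auto simp: AE_lebesgue_iff\<close>)
  then have "integrable (lborel \<Otimes>\<^sub>M lborel) g"
    using gm by (simp add: integrable_completion lborel_prod)
  then have g: "integrable (lborel \<Otimes>\<^sub>M lborel) (case_prod (\<lambda>x t. g (x, t)))" by simp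
  have ae2: "AE t in lborel. AE x in lborel. h (x, t) = g (x, t)"
    using AE_lebesgue_pair_snd[of "\<lambda>z. h z = g z"] ae by (simp add: AE_lebesgue_iff)
  have sec: "(\<lambda>x. g (x, t)) \<in> borel_measurable borel" for t
  proof -
    have "(\<lambda>x. (x, t)) \<in> borel_measurable borel"
      by (intro borel_measurable_continuous_onI continuous_intros)
    moreover have "g \<in> borel_measurable borel" using gm by simp
    ultimately show ?thesis by (rule measurable_compose)
  qed
  have gx: "AE t in lborel. integrable lborel (\<lambda>x. g (x, t))"
    by (rule lborel_pair.AE_integrable_snd[where f = "\<lambda>x t. g (x, t)", OF g])
  have step: "integrable lborel (\<lambda>x. g (x, t)) \<and> integrable lebesgue (\<lambda>x. h (x, t))
      \<and> (LINT x|lborel. g (x, t)) = (LINT x|lebesgue. h (x, t))"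
    if "AE x in lborel. h (x, t) = g (x, t)" and gt: "integrable lborel (\<lambda>x. g (x, t))" for t
  proof -
    have gl: "integrable lebesgue (\<lambda>x. g (x, t))"
      using gt sec[of t] by (simp add: integrable_completion)
    have ae: "AE x in lebesgue. g (x, t) = h (x, t)"
      using that(1) unfolding AE_lebesgue_iff by (rule AE_mp) simp
    have hm: "(\<lambda>x. h (x, t)) \<in> borel_measurable lebesgue"
      by (rule borel_measurable_lebesgue_cong_AE[OF borel_measurable_integrable[OF gl] ae])
    have "integrable lebesgue (\<lambda>x. h (x, t))"
      by (rule integrable_cong_AE_imp[OF gl hm ae])
    moreover have "(LINT x|lebesgue. g (x, t)) = (LINT x|lebesgue. h (x, t))"
      by (rule integral_cong_AE[OF borel_measurable_integrable[OF gl] hm ae])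
    moreover have "(LINT x|lebesgue. g (x, t)) = (LINT x|lborel. g (x, t))"
      using sec[of t] by (intro integral_completion) simp
    ultimately show ?thesis using gt by simp
  qed
  have eq: "AE t in lborel. integrable lborel (\<lambda>x. g (x, t)) \<and> integrable lebesgue (\<lambda>x. h (x, t))
      \<and> (LINT x|lborel. g (x, t)) = (LINT x|lebesgue. h (x, t))"
    by (rule AE_mp[OF ae2], rule AE_mp[OF gx], rule AE_I2, intro impI, rule step)
  then show "AE t in lebesgue. integrable lebesgue (\<lambda>x. h (x, t))"
    unfolding AE_lebesgue_iff by (rule AE_mp) (simp add: AE_I2)
  have i: "integrable lborel (\<lambda>t. LINT x|lborel. g (x, t))"
    by (rule lborel_pair.integrable_snd[where f = "\<lambda>x t. g (x, t)", OF g])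
  then have i': "integrable lebesgue (\<lambda>t. LINT x|lborel. g (x, t))"
    using integrable_completion[OF borel_measurable_integrable[OF i]] by blast
  have ae3: "AE t in lebesgue. (LINT x|lborel. g (x, t)) = (LINT x|lebesgue. h (x, t))"
    using eq unfolding AE_lebesgue_iff by (rule AE_mp) (simp add: AE_I2)
  have "(\<lambda>t. LINT x|lebesgue. h (x, t)) \<in> borel_measurable lebesgue"
    by (rule borel_measurable_lebesgue_cong_AE[OF borel_measurable_integrable[OF i'] ae3])
  then show "integrable lebesgue (\<lambda>t. LINT x|lebesgue. h (x, t))"
    by (rule integrable_cong_AE_imp[OF i' _ ae3])
qed

lemma in_L2_add:
  fixes v w :: "'a::euclidean_space \<Rightarrow> 'b::euclidean_space"
  assumes "in_L2 v" and "in_L2 w"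
  shows "in_L2 (\<lambda>x. v x + w x)"
proof -
  have [measurable]: "v \<in> borel_measurable lebesgue" "w \<in> borel_measurable lebesgue"
    using assms by (auto simp: in_L2_def)
  have i: "integrable lebesgue (\<lambda>x. 2 * (norm (v x))\<^sup>2 + 2 * (norm (w x))\<^sup>2)"
    using assms by (auto simp: in_L2_def)
  have "integrable lebesgue (\<lambda>x. (norm (v x + w x))\<^sup>2)"
  proof (rule Bochner_Integration.integrable_bound[OF i])
    show "AE x in lebesgue. norm ((norm (v x + w x))\<^sup>2) \<le> norm (2 * (norm (v x))\<^sup>2 + 2 * (norm (w x))\<^sup>2)"
    proof (rule AE_I2)
      fix x
      have "(norm (v x + w x))\<^sup>2 \<le> (norm (v x) + norm (w x))\<^sup>2"
        by (intro power_mono norm_triangle_ineq) simp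
      also have "\<dots> \<le> 2 * (norm (v x))\<^sup>2 + 2 * (norm (w x))\<^sup>2"
        using zero_le_power2[of "norm (v x) - norm (w x)"] by (simp add: power2_eq_square algebra_simps)
      finally show "norm ((norm (v x + w x))\<^sup>2) \<le> norm (2 * (norm (v x))\<^sup>2 + 2 * (norm (w x))\<^sup>2)" by simp
    qed
  qed measurable
  then show ?thesis by (simp add: in_L2_def)
qed

lemma in_L2_scale:
  fixes v :: "'a::euclidean_space \<Rightarrow> real"
  assumes "in_L2 v"
  shows "in_L2 (\<lambda>x. c * v x)"
  using assms by (auto simp: in_L2_def power_mult_distrib)

lemma in_L2_diff:
  fixes v w :: "'a::euclidean_space \<Rightarrow> real"
  assumes "in_L2 v" and "in_L2 w"
  shows "in_L2 (\<lambda>x. v x - w x)"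
  using in_L2_add[OF assms(1) in_L2_scale[OF assms(2), of "-1"]] by simp

lemma in_L2_inner_const:
  fixes v :: "'a::euclidean_space \<Rightarrow> 'b::euclidean_space"
  assumes "in_L2 v"
  shows "in_L2 (\<lambda>x. v x \<bullet> c)"
proof -
  have [measurable]: "v \<in> borel_measurable lebesgue" using assms by (auto simp: in_L2_def)
  have i: "integrable lebesgue (\<lambda>x. (norm (v x))\<^sup>2 * (norm c)\<^sup>2)"
    using assms by (auto simp: in_L2_def)
  have "integrable lebesgue (\<lambda>x. (norm (v x \<bullet> c))\<^sup>2)"
  proof (rule Bochner_Integration.integrable_bound[OF i])
    show "AE x in lebesgue. norm ((norm (v x \<bullet> c))\<^sup>2) \<le> norm ((norm (v x))\<^sup>2 * (norm c)\<^sup>2)"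
    proof (rule AE_I2)
      fix x
      have "(norm (v x \<bullet> c))\<^sup>2 \<le> (norm (v x) * norm c)\<^sup>2"
        using Cauchy_Schwarz_ineq2 by (intro power_mono) auto
      then show "norm ((norm (v x \<bullet> c))\<^sup>2) \<le> norm ((norm (v x))\<^sup>2 * (norm c)\<^sup>2)"
        by (simp add: power_mult_distrib)
    qed
  qed measurable
  then show ?thesis by (simp add: in_L2_def)
qed

lemma in_L2_continuous_compact_support:
  fixes w :: "'a::euclidean_space \<Rightarrow> real"
  assumes "continuous_on UNIV w" and "compact K" and "\<And>x. x \<notin> K \<Longrightarrow> w x = 0"
  shows "in_L2 w"
proof -
  have m: "w \<in> borel_measurable borel"
    using assms(1) by (rule borel_measurable_continuous_onI)
  have "integrable lborel (\<lambda>x. indicator K x *\<^sub>R (norm (w x))\<^sup>2)"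
    by (rule borel_integrable_compact[OF assms(2)])
       (auto intro!: continuous_intros continuous_on_subset[OF assms(1)])
  also have "(\<lambda>x. indicator K x *\<^sub>R (norm (w x))\<^sup>2) = (\<lambda>x. (norm (w x))\<^sup>2)"
    using assms(3) by (auto simp: indicator_def fun_eq_iff)
  finally show ?thesis
    using m by (simp add: in_L2_def integrable_completion measurable_completion)
qed

lemma integrable_L2_product:
  fixes v w :: "'a::euclidean_space \<Rightarrow> real"
  assumes "in_L2 v" and "in_L2 w"
  shows "integrable lebesgue (\<lambda>x. v x * w x)"
proof -
  have [measurable]: "v \<in> borel_measurable lebesgue" "w \<in> borel_measurable lebesgue"
    using assms by (auto simp: in_L2_def)
  have i: "integrable lebesgue (\<lambda>x. (norm (v x))\<^sup>2 + (norm (w x))\<^sup>2)"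
    using assms by (auto simp: in_L2_def)
  show ?thesis
  proof (rule Bochner_Integration.integrable_bound[OF i])
    show "AE x in lebesgue. norm (v x * w x) \<le> norm ((norm (v x))\<^sup>2 + (norm (w x))\<^sup>2)"
    proof (rule AE_I2)
      fix x
      have "2 * (\<bar>v x\<bar> * \<bar>w x\<bar>) \<le> \<bar>v x\<bar>\<^sup>2 + \<bar>w x\<bar>\<^sup>2"
        using sum_squares_bound[of "\<bar>v x\<bar>" "\<bar>w x\<bar>"] by simp
      moreover have "0 \<le> \<bar>v x\<bar> * \<bar>w x\<bar>" by simp
      ultimately have "\<bar>v x\<bar> * \<bar>w x\<bar> \<le> \<bar>v x\<bar>\<^sup>2 + \<bar>w x\<bar>\<^sup>2" by linarith
      then show "norm (v x * w x) \<le> norm ((norm (v x))\<^sup>2 + (norm (w x))\<^sup>2)"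
        by (simp add: abs_mult)
    qed
  qed measurable
qed

lemma L2_Cauchy_Schwarz:
  fixes v w :: "'a::euclidean_space \<Rightarrow> real"
  assumes "in_L2 v" and "in_L2 w"
  shows "\<bar>LINT x|lebesgue. v x * w x\<bar> \<le> norm_L2 v * norm_L2 w"
proof -
  have [measurable]: "v \<in> borel_measurable lebesgue" "w \<in> borel_measurable lebesgue"
    using assms by (auto simp: in_L2_def)
  have i: "integrable lebesgue (\<lambda>x. \<bar>v x\<bar> * \<bar>w x\<bar>)"
    using integrable_abs[OF integrable_L2_product[OF assms]] by (simp add: abs_mult)
  have sq: "(\<integral>\<^sup>+x. (ennreal \<bar>f x\<bar>)\<^sup>2 \<partial>lebesgue) = ennreal ((norm_L2 f)\<^sup>2)" if "in_L2 f" for f :: "'a \<Rightarrow> real"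
  proof -
    have "(\<integral>\<^sup>+x. (ennreal \<bar>f x\<bar>)\<^sup>2 \<partial>lebesgue) = (\<integral>\<^sup>+x. ennreal ((norm (f x))\<^sup>2) \<partial>lebesgue)"
      by (simp add: ennreal_power)
    also have "\<dots> = ennreal (LINT x|lebesgue. (norm (f x))\<^sup>2)"
      using that by (intro nn_integral_eq_integral) (auto simp: in_L2_def)
    finally show ?thesis by (simp add: norm_L2_def integral_nonneg_AE)
  qed
  have "ennreal ((LINT x|lebesgue. \<bar>v x\<bar> * \<bar>w x\<bar>)\<^sup>2) = (\<integral>\<^sup>+x. ennreal \<bar>v x\<bar> * ennreal \<bar>w x\<bar> \<partial>lebesgue)\<^sup>2"
    using nn_integral_eq_integral[OF i]
    by (simp add: ennreal_mult[symmetric] ennreal_power integral_nonneg_AE)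
  also have "\<dots> \<le> (\<integral>\<^sup>+x. (ennreal \<bar>v x\<bar>)\<^sup>2 \<partial>lebesgue) * (\<integral>\<^sup>+x. (ennreal \<bar>w x\<bar>)\<^sup>2 \<partial>lebesgue)"
    by (rule Cauchy_Schwarz_nn_integral) measurable
  also have "\<dots> = ennreal ((norm_L2 v * norm_L2 w)\<^sup>2)"
    using assms by (simp add: sq ennreal_mult[symmetric] power_mult_distrib)
  finally have "(LINT x|lebesgue. \<bar>v x\<bar> * \<bar>w x\<bar>)\<^sup>2 \<le> (norm_L2 v * norm_L2 w)\<^sup>2"
    by (simp add: ennreal_le_iff)
  then have "(LINT x|lebesgue. \<bar>v x\<bar> * \<bar>w x\<bar>) \<le> norm_L2 v * norm_L2 w"
    by (rule power2_le_imp_le) (simp add: norm_L2_def integral_nonneg_AE)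
  moreover have "\<bar>LINT x|lebesgue. v x * w x\<bar> \<le> (LINT x|lebesgue. \<bar>v x\<bar> * \<bar>w x\<bar>)"
    using integral_abs_bound[of lebesgue "\<lambda>x. v x * w x"] by (simp add: abs_mult)
  ultimately show ?thesis by linarith
qed

lemma norm_L2_nonneg: "0 \<le> norm_L2 v"
  by (simp add: norm_L2_def integral_nonneg_AE)

text \<open>Vanishing on a set passes to limits in \<open>L\<^sup>2\<close>. Since \<open>P\<close> need not be measurable, the argument runs on the
common zero set \<open>A\<close> of the approximants.\<close>

lemma AE_zero_if_L2_approximable:
  fixes v :: "'a::euclidean_space \<Rightarrow> real"
  assumes "in_L2 v"
    and "\<And>e. 0 < e \<Longrightarrow> \<exists>w. in_L2 w \<and> norm_L2 (\<lambda>x. w x - v x) < e \<and> (AE x in lebesgue. P x \<longrightarrow> w x = 0)"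
  shows "AE x in lebesgue. P x \<longrightarrow> v x = 0"
proof -
  have "\<exists>w. in_L2 w \<and> norm_L2 (\<lambda>x. w x - v x) < 1 / real (Suc n) \<and> (AE x in lebesgue. P x \<longrightarrow> w x = 0)" for n
    by (rule assms(2)) simp
  then obtain w where w: "\<And>n. in_L2 (w n)" "\<And>n. norm_L2 (\<lambda>x. w n x - v x) < 1 / real (Suc n)"
    "\<And>n. AE x in lebesgue. P x \<longrightarrow> w n x = 0" by metis
  have [measurable]: "v \<in> borel_measurable lebesgue" "w n \<in> borel_measurable lebesgue" for n
    using assms(1) w(1) by (auto simp: in_L2_def)
  define A where "A = (\<Inter>n. {x. w n x = 0})"
  have [measurable]: "A \<in> sets lebesgue"
  proof -
    have "{x \<in> space lebesgue. w n x = 0} \<in> sets lebesgue" for n by measurable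
    then show ?thesis unfolding A_def by (intro sets.countable_INT) auto
  qed
  have A: "AE x in lebesgue. P x \<longrightarrow> x \<in> A"
  proof -
    have "AE x in lebesgue. \<forall>n. P x \<longrightarrow> w n x = 0" unfolding AE_all_countable using w(3) by blast
    then show ?thesis by eventually_elim (auto simp: A_def)
  qed
  have iA: "integrable lebesgue (\<lambda>x. indicator A x * (norm (v x))\<^sup>2)"
    using assms(1) integrable_real_mult_indicator[of A lebesgue "\<lambda>x. (norm (v x))\<^sup>2"]
    by (simp add: in_L2_def mult.commute)
  have le: "(LINT x|lebesgue. indicator A x * (norm (v x))\<^sup>2) \<le> (1 / real (Suc n))\<^sup>2" for n
  proof -
    have "(LINT x|lebesgue. indicator A x * (norm (v x))\<^sup>2) \<le> (LINT x|lebesgue. (norm (w n x - v x))\<^sup>2)"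
      by (rule integral_mono[OF iA])
         (use in_L2_diff[OF w(1) assms(1)] in \<open>auto simp: in_L2_def indicator_def A_def\<close>)
    also have "\<dots> = (norm_L2 (\<lambda>x. w n x - v x))\<^sup>2"
      by (simp add: norm_L2_def integral_nonneg_AE)
    also have "\<dots> \<le> (1 / real (Suc n))\<^sup>2"
      using w(2)[of n] norm_L2_nonneg by (intro power_mono) auto
    finally show ?thesis .
  qed
  have "(\<lambda>n. (1 / real (Suc n))\<^sup>2) \<longlonglongrightarrow> 0"
    using tendsto_power[OF LIMSEQ_inverse_real_of_nat, of 2] by (simp add: inverse_eq_divide)
  then have "(LINT x|lebesgue. indicator A x * (norm (v x))\<^sup>2) \<le> 0"
    by (rule tendsto_lowerbound) (use le in auto)
  then have "(LINT x|lebesgue. indicator A x * (norm (v x))\<^sup>2) = 0"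
    by (intro antisym integral_nonneg_AE) auto
  then have "AE x in lebesgue. indicator A x * (norm (v x))\<^sup>2 = 0"
    using integral_nonneg_eq_0_iff_AE[OF iA] by auto
  with A show ?thesis by eventually_elim (auto simp: indicator_def)
qed

section \<open>Energy solutions tested against product functions\<close>

lemma AE_vanishes_off_ess_supp:
  fixes v :: "'a::euclidean_space \<Rightarrow> real"
  shows "AE w in lebesgue. w \<in> S - ess_supp S v \<longrightarrow> v w = 0"
proof -
  define \<F> where "\<F> = {U. open U \<and> (AE w in lebesgue. w \<in> U \<inter> S \<longrightarrow> v w = 0)}"
  obtain \<G> where \<G>: "\<G> \<subseteq> \<F>" "countable \<G>" "\<Union>\<G> = \<Union>\<F>"
    using Lindelof[of \<F>] by (auto simp: \<F>_def)
  have "AE w in lebesgue. \<forall>U\<in>\<G>. w \<in> U \<inter> S \<longrightarrow> v w = 0"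
    using \<G>(1,2) by (subst AE_ball_countable) (auto simp: \<F>_def)
  then show ?thesis
  proof eventually_elim
    case (elim w)
    show ?case
    proof
      assume w: "w \<in> S - ess_supp S v"
      then obtain U where "open U" "w \<in> U" "AE z in lebesgue. z \<in> U \<inter> S \<longrightarrow> v z = 0"
        by (auto simp: ess_supp_def)
      then have "w \<in> \<Union>\<F>" by (auto simp: \<F>_def)
      then obtain V where "V \<in> \<G>" "w \<in> V" using \<G>(3) by auto
      with elim w show "v w = 0" by auto
    qed
  qed
qed

lemma AE_imp_ex_in_interval:
  fixes a b :: real
  assumes "AE s in lebesgue. Q s" and "a < b"
  shows "\<exists>s\<in>{a<..<b}. Q s"
proof (rule ccontr)
  assume "\<not> ?thesis"
  with assms(1) have "AE s in lebesgue. s \<notin> {a<..<b}" by (auto elim: eventually_mono)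
  then have "AE s in lborel. s \<notin> {a<..<b}" by (simp only: AE_lebesgue_iff)
  then have "emeasure lborel {a<..<b} = 0"
    using AE_iff_null_sets[of "{a<..<b}" lborel] by auto
  then show False using assms(2) by simp
qed

lemma time_ivl_extend:
  assumes "t \<in> time_ivl T"
  obtains t' where "t < t'" and "t' \<in> time_ivl T"
proof -
  from assms obtain z where "ereal t < z" "z < T" using dense[of "ereal t" T] by (auto simp: time_ivl_def)
  then obtain t' where "z = ereal t'" by (cases z) auto
  with \<open>ereal t < z\<close> \<open>z < T\<close> assms that[of t'] show thesis by (simp add: time_ivl_def)
qed

lemma time_ivl_downward: "t \<in> time_ivl T \<Longrightarrow> 0 \<le> s \<Longrightarrow> s \<le> t \<Longrightarrow> s \<in> time_ivl T"
  by (auto simp: time_ivl_def intro: le_less_trans[of "ereal s" "ereal t" T])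

lemma frechet_derivative_cong_open:
  assumes "open S" and "x \<in> S" and "\<And>y. y \<in> S \<Longrightarrow> f y = g y"
  shows "frechet_derivative f (at x) = frechet_derivative g (at x)"
proof -
  have "(f has_derivative d) (at x) \<longleftrightarrow> (g has_derivative d) (at x)" for d
    using has_derivative_transform_within_open[OF _ assms(1,2), of f d UNIV g]
      has_derivative_transform_within_open[OF _ assms(1,2), of g d UNIV f] assms(3) by auto
  then show ?thesis by (simp add: frechet_derivative_def)
qed

lemma compact_closure_support:
  fixes \<phi> :: "'a::t2_space \<Rightarrow> real"
  assumes "compact K" and "\<And>z. z \<notin> K \<Longrightarrow> \<phi> z = 0"
  shows "closure {z. \<phi> z \<noteq> 0} \<subseteq> K" and "compact (closure {z. \<phi> z \<noteq> 0})"
proof -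
  show sub: "closure {z. \<phi> z \<noteq> 0} \<subseteq> K"
    using assms compact_imp_closed by (intro closure_minimal) auto
  show "compact (closure {z. \<phi> z \<noteq> 0})"
    using compact_Int_closed[OF assms(1) closed_closure, of "{z. \<phi> z \<noteq> 0}"] sub
    by (simp add: Int_absorb1)
qed

lemma spacetime_test_function_product:
  fixes X :: "'a::euclidean_space \<Rightarrow> real" and Z :: "real \<Rightarrow> real"
  assumes "\<And>k. C_k k X" and "compact K" and "\<And>x. x \<notin> K \<Longrightarrow> X x = 0"
    and "\<And>k. C_k k Z" and "\<And>t. t \<notin> {a..b} \<Longrightarrow> Z t = 0" and "ereal b < T"
  shows "spacetime_test_function T (\<lambda>(x, t). X x * Z t)"
proof -
  have "C_k k (\<lambda>z. X (fst z) * Z (snd z))" for k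
    by (intro C_k_mult C_k_linear_compose[OF bounded_linear_fst] C_k_linear_compose[OF bounded_linear_snd] assms)
  then have C: "C_k k (\<lambda>(x, t). X x * Z t)" for k by (simp add: case_prod_unfold)
  have K: "compact (K \<times> {a..b})" using assms(2) by (intro compact_Times) auto
  have 0: "(case z of (x, t) \<Rightarrow> X x * Z t) = 0" if "z \<notin> K \<times> {a..b}" for z
    using that assms(3,5) by (cases z) auto
  have sub: "K \<times> {a..b} \<subseteq> {(x, t). ereal t < T}"
  proof safe
    fix t assume "t \<in> {a..b}"
    then have "ereal t \<le> ereal b" by simp
    also note assms(6)
    finally show "ereal t < T" .
  qed
  show ?thesis
    unfolding spacetime_test_function_def test_function_def
    using C compact_closure_support(2)[OF K 0] order_trans[OF compact_closure_support(1)[OF K 0] sub]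
    by (intro conjI allI)
qed

lemma test_function_directional_derivative:
  fixes X :: "'a::euclidean_space \<Rightarrow> real"
  assumes "\<And>k. C_k k X" and "\<And>x. \<rho> < norm x \<Longrightarrow> X x = 0"
  shows "test_function (\<lambda>x. frechet_derivative X (at x) v)"
    and "\<rho> < norm x \<Longrightarrow> frechet_derivative X (at x) v = 0"
proof -
  show 0: "frechet_derivative X (at x) v = 0" if "\<rho> < norm x" for x v
  proof -
    have "frechet_derivative X (at x) = frechet_derivative (\<lambda>_. 0) (at x)"
      by (rule frechet_derivative_cong_open[of "{x. \<rho> < norm x}"])
         (use assms that in \<open>auto intro: open_Collect_less continuous_intros\<close>)
    then show ?thesis by (simp add: frechet_derivative_const)
  qed
  have "C_k k (\<lambda>x. frechet_derivative X (at x) v)" for k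
    using assms(1)[of "Suc k"] by simp
  moreover have "compact (closure {x. frechet_derivative X (at x) v \<noteq> 0})"
    by (rule compact_closure_support[of "cball 0 \<rho>"]) (auto simp: 0)
  ultimately show "test_function (\<lambda>x. frechet_derivative X (at x) v)"
    by (simp add: test_function_def)
qed

abbreviation laplacian :: "('a::euclidean_space \<Rightarrow> real) \<Rightarrow> 'a \<Rightarrow> real" where
  "laplacian X x \<equiv> \<Sum>b\<in>Basis. frechet_derivative (\<lambda>z. frechet_derivative X (at z) b) (at x) b"

text \<open>The definition of the weak gradient is applied to the directional derivatives of \<open>X\<close>, and the
components are added up.\<close>

lemma weak_gradient_laplacian:
  fixes X :: "'a::euclidean_space \<Rightarrow> real"
  assumes "in_H1 v" and X: "\<And>k. C_k k X" and X0: "\<And>x. \<rho> < norm x \<Longrightarrow> X x = 0"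
  shows "(LINT x|lebesgue. weak_grad v x \<bullet> grad X x) = - (LINT x|lebesgue. v x * laplacian X x)"
proof -
  define W where "W = weak_grad v"
  have "in_L2 W \<and> is_weak_grad v W"
    unfolding W_def weak_grad_def 
    using assms(1) someI_ex[of "\<lambda>G. in_L2 G \<and> is_weak_grad v G"] by (simp add: in_H1_def)
  then have W: "in_L2 W" "is_weak_grad v W" by auto
  have v: "in_L2 v" using assms(1) by (simp add: in_H1_def)
  define D where "D b x = frechet_derivative X (at x) b" for b x
  define D2 where "D2 b c x = frechet_derivative (D b) (at x) c" for b c x
  have D: "\<And>k. C_k k (D b)" "\<And>x. \<rho> < norm x \<Longrightarrow> D b x = 0" "test_function (D b)" for b
    using test_function_directional_derivative[where X = X and \<rho> = \<rho>, OF X X0] by (auto simp: D_def[abs_def] test_function_def)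
  have D2: "\<And>k. C_k k (D2 b c)" "\<And>x. \<rho> < norm x \<Longrightarrow> D2 b c x = 0" for b c
    using test_function_directional_derivative[where X = "D b" and \<rho> = \<rho>, OF D(1,2)] by (auto simp: D2_def[abs_def] test_function_def)
  have L2: "in_L2 w" if "\<And>k. C_k k w" "\<And>x. \<rho> < norm x \<Longrightarrow> w x = 0" for w :: "'a \<Rightarrow> real"
    by (rule in_L2_continuous_compact_support[OF C_k_imp_continuous[OF that(1)], of "cball 0 \<rho>"])
       (use that(2) in auto)
  note L2D = L2[OF D(1,2)] and L2D2 = L2[OF D2]
  have iW: "integrable lebesgue (\<lambda>x. (W x \<bullet> b) * D b x)" for b
    by (rule integrable_L2_product[OF in_L2_inner_const[OF W(1)] L2D])
  have iv: "integrable lebesgue (\<lambda>x. v x * D2 b c x)" for b c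
    by (rule integrable_L2_product[OF v L2D2])
  have parts: "(LINT x|lebesgue. v x * D2 b b x) = - (LINT x|lebesgue. (W x \<bullet> b) * D b x)" if b: "b \<in> Basis" for b
  proof -
    have g: "v x *\<^sub>R grad (D b) x = (\<Sum>c\<in>Basis. (v x * D2 b c x) *\<^sub>R c)" for x
      by (simp add: grad_def D2_def scaleR_sum_right)
    have "integrable lebesgue (\<lambda>x. v x *\<^sub>R grad (D b) x)"
      unfolding g by (intro Bochner_Integration.integrable_sum integrable_scaleR_left iv)
    then have "(LINT x|lebesgue. (v x *\<^sub>R grad (D b) x) \<bullet> b) = (LINT x|lebesgue. v x *\<^sub>R grad (D b) x) \<bullet> b"
      by (intro integral_inner_left)
    also have "(\<lambda>x. (v x *\<^sub>R grad (D b) x) \<bullet> b) = (\<lambda>x. v x * D2 b b x)"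
      using b by (simp add: g inner_sum_left inner_Basis if_distrib sum.delta cong: if_cong)
    finally have 1: "(LINT x|lebesgue. v x * D2 b b x) = (LINT x|lebesgue. v x *\<^sub>R grad (D b) x) \<bullet> b" .
    have Wexp: "D b x *\<^sub>R W x = (\<Sum>c\<in>Basis. ((W x \<bullet> c) * D b x) *\<^sub>R c)" for x
      by (subst euclidean_representation[of "W x", symmetric]) (simp add: scaleR_sum_right mult.commute)
    have "integrable lebesgue (\<lambda>x. (W x \<bullet> c) * D b x)" for c
      by (rule integrable_L2_product[OF in_L2_inner_const[OF W(1)] L2D])
    then have "integrable lebesgue (\<lambda>x. D b x *\<^sub>R W x)"
      unfolding Wexp by (intro Bochner_Integration.integrable_sum integrable_scaleR_left)
    then have "(LINT x|lebesgue. (D b x *\<^sub>R W x) \<bullet> b) = (LINT x|lebesgue. D b x *\<^sub>R W x) \<bullet> b"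
      by (intro integral_inner_left)
    then have 2: "(LINT x|lebesgue. (W x \<bullet> b) * D b x) = (LINT x|lebesgue. D b x *\<^sub>R W x) \<bullet> b"
      by (simp add: mult.commute)
    have "(LINT x|lebesgue. v x *\<^sub>R grad (D b) x) = - (LINT x|lebesgue. D b x *\<^sub>R W x)"
      using W(2) D(3) by (auto simp: is_weak_grad_def)
    then show ?thesis unfolding 1 2 by simp
  qed
  have "(LINT x|lebesgue. W x \<bullet> grad X x) = (LINT x|lebesgue. (\<Sum>b\<in>Basis. (W x \<bullet> b) * D b x))"
    by (simp add: grad_def D_def inner_sum_right mult.commute)
  also have "\<dots> = (\<Sum>b\<in>Basis. LINT x|lebesgue. (W x \<bullet> b) * D b x)"
    by (rule Bochner_Integration.integral_sum) (rule iW)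
  also have "\<dots> = (\<Sum>b\<in>Basis. - (LINT x|lebesgue. v x * D2 b b x))"
    by (intro sum.cong refl) (simp add: parts)
  also have "\<dots> = - (LINT x|lebesgue. (\<Sum>b\<in>Basis. v x * D2 b b x))"
    by (subst Bochner_Integration.integral_sum[OF iv]) (simp add: sum_negf)
  finally show ?thesis by (simp add: W_def D_def[abs_def] D2_def sum_distrib_left)
qed

text \<open>An energy solution with its time derivative made explicit, together with the support condition.\<close>

locale supported_solution =
  fixes \<mu> p q R :: real and T :: ereal and u ut :: "real \<Rightarrow> 'a::euclidean_space \<Rightarrow> real"
  assumes R: "0 \<le> R"
    and H1: "t \<in> time_ivl T \<Longrightarrow> in_H1 (u t)"
    and C1: "C1_L2 (time_ivl T) u ut"
    and supp: "ess_supp (UNIV \<times> time_ivl T) (\<lambda>(x, t). u t x) \<subseteq> {(x, t). 0 \<le> t \<and> norm x \<le> t + R}"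
    and source_integrable: "\<And>\<Phi> t. spacetime_test_function T \<Phi> \<Longrightarrow> t \<in> time_ivl T \<Longrightarrow>
        set_integrable lebesgue (UNIV \<times> {0..t})
          (\<lambda>(x, s). (\<bar>ut s x\<bar> powr p + \<bar>u s x\<bar> powr q) * \<Phi> (x, s))"
    and weak: "\<And>\<Phi> t. spacetime_test_function T \<Phi> \<Longrightarrow> t \<in> time_ivl T \<Longrightarrow>
        (LINT x|lebesgue. ut t x * \<Phi> (x, t))
        - (LINT x|lebesgue. ut 0 x * \<Phi> (x, 0))
        - (LINT s:{0..t}|lebesgue. LINT x|lebesgue. ut s x * deriv (\<lambda>\<tau>. \<Phi> (x, \<tau>)) s)
        + (LINT s:{0..t}|lebesgue. LINT x|lebesgue.
             weak_grad (u s) x \<bullet> grad (\<lambda>y. \<Phi> (y, s)) x)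
        + (LINT s:{0..t}|lebesgue. LINT x|lebesgue. \<mu> / (1 + s) * ut s x * \<Phi> (x, s))
        = (LINT s:{0..t}|lebesgue. LINT x|lebesgue.
             (\<bar>ut s x\<bar> powr p + \<bar>u s x\<bar> powr q) * \<Phi> (x, s))"
begin

abbreviation J :: "real set" where "J \<equiv> time_ivl T"

abbreviation source :: "real \<Rightarrow> 'a \<Rightarrow> real" where
  "source s x \<equiv> \<bar>ut s x\<bar> powr p + \<bar>u s x\<bar> powr q"

lemma L2_u: "t \<in> J \<Longrightarrow> in_L2 (u t)" and L2_ut: "t \<in> J \<Longrightarrow> in_L2 (ut t)"
  using C1 by (auto simp: C1_L2_def C0_L2_def)

lemma u_continuous: "t \<in> J \<Longrightarrow> ((\<lambda>s. norm_L2 (\<lambda>x. u s x - u t x)) \<longlongrightarrow> 0) (at t within J)"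
  and u_differentiable: "t \<in> J \<Longrightarrow>
    ((\<lambda>s. norm_L2 (\<lambda>x. (u s x - u t x) / (s - t) - ut t x)) \<longlongrightarrow> 0) (at t within J)"
  using C1 by (auto simp: C1_L2_def C0_L2_def)

lemma L2_u_quotient: "t \<in> J \<Longrightarrow> s \<in> J \<Longrightarrow> in_L2 (\<lambda>x. (u s x - u t x) / (s - t))"
  using in_L2_scale[OF in_L2_diff[OF L2_u L2_u], of s t "1 / (s - t)"] by simp

lemma norm_L2_small_within:
  assumes "((\<lambda>s. norm_L2 (w s)) \<longlongrightarrow> 0) (at t within J)" and "0 < e"
  obtains d where "0 < d" "\<And>s. s \<in> J \<Longrightarrow> s \<noteq> t \<Longrightarrow> \<bar>s - t\<bar> < d \<Longrightarrow> norm_L2 (w s) < e"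
proof -
  have "\<forall>\<^sub>F s in at t within J. norm_L2 (w s) < e"
    using tendstoD[OF assms] by (rule eventually_mono) (simp add: dist_real_def)
  then obtain d where "0 < d" "\<forall>s\<in>J. s \<noteq> t \<and> dist s t < d \<longrightarrow> norm_L2 (w s) < e"
    by (auto simp: eventually_at)
  then show thesis by (intro that[of d]) (auto simp: dist_real_def)
qed

text \<open>The support condition concerns almost all points of space-time, so it speaks about almost all times
only. Continuity in time extends it to every \<open>t\<close>, at the price of a slightly larger cone.\<close>

lemma u_vanishes:
  assumes t: "t \<in> J"
  shows "AE x in lebesgue. t + R + 1 < norm x \<longrightarrow> u t x = 0"
proof (rule AE_zero_if_L2_approximable[OF L2_u[OF t]])
  fix e :: real assume e: "0 < e"
  obtain d where d: "0 < d" "\<And>s. s \<in> J \<Longrightarrow> s \<noteq> t \<Longrightarrow> \<bar>s - t\<bar> < d \<Longrightarrow> norm_L2 (\<lambda>x. u s x - u t x) < e"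
    by (rule norm_L2_small_within[OF u_continuous[OF t] e]) blast
  obtain t' where t': "t < t'" "t' \<in> J" using time_ivl_extend[OF t] .
  have "AE z in lebesgue. z \<in> UNIV \<times> J - ess_supp (UNIV \<times> J) (\<lambda>(x, t). u t x) \<longrightarrow> (\<lambda>(x, t). u t x) z = 0"
    by (rule AE_vanishes_off_ess_supp)
  then have "AE z in lebesgue. snd z \<in> J \<longrightarrow> snd z + R < norm (fst z) \<longrightarrow> u (snd z) (fst z) = 0"
    by eventually_elim (use supp in force)
  from AE_lebesgue_pair_snd[OF this]
  have "AE s in lebesgue. AE x in lebesgue. s \<in> J \<longrightarrow> s + R < norm x \<longrightarrow> u s x = 0" by simp
  from AE_imp_ex_in_interval[OF this, of t "min t' (t + min d 1)"] t' d
  obtain s where s: "t < s" "s < t'" "s < t + d" "s < t + 1"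
    "AE x in lebesgue. s \<in> J \<longrightarrow> s + R < norm x \<longrightarrow> u s x = 0" by auto
  have "s \<in> J" using s t' t by (intro time_ivl_downward[OF t'(2)]) (auto simp: time_ivl_def)
  show "\<exists>w. in_L2 w \<and> norm_L2 (\<lambda>x. w x - u t x) < e \<and> (AE x in lebesgue. t + R + 1 < norm x \<longrightarrow> w x = 0)"
  proof (intro exI[of _ "u s"] conjI L2_u[OF \<open>s \<in> J\<close>])
    show "norm_L2 (\<lambda>x. u s x - u t x) < e" using d(2)[OF \<open>s \<in> J\<close>] s by auto
    show "AE x in lebesgue. t + R + 1 < norm x \<longrightarrow> u s x = 0"
      using s(5) by eventually_elim (use \<open>s \<in> J\<close> s in auto)
  qed
qed

lemma ut_vanishes:
  assumes t: "t \<in> J"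
  shows "AE x in lebesgue. t + R + 2 < norm x \<longrightarrow> ut t x = 0"
proof (rule AE_zero_if_L2_approximable[OF L2_ut[OF t]])
  fix e :: real assume e: "0 < e"
  obtain d where d: "0 < d" "\<And>s. s \<in> J \<Longrightarrow> s \<noteq> t \<Longrightarrow> \<bar>s - t\<bar> < d \<Longrightarrow>
      norm_L2 (\<lambda>x. (u s x - u t x) / (s - t) - ut t x) < e"
    by (rule norm_L2_small_within[OF u_differentiable[OF t] e]) blast
  obtain t' where t': "t < t'" "t' \<in> J" using time_ivl_extend[OF t] .
  obtain s where s: "t < s" "s < min t' (t + min d 1)"
    using dense[of t "min t' (t + min d 1)"] t' d by auto
  have sJ: "s \<in> J" using s t' t by (intro time_ivl_downward[OF t'(2)]) (auto simp: time_ivl_def)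
  show "\<exists>w. in_L2 w \<and> norm_L2 (\<lambda>x. w x - ut t x) < e \<and> (AE x in lebesgue. t + R + 2 < norm x \<longrightarrow> w x = 0)"
  proof (intro exI[of _ "\<lambda>x. (u s x - u t x) / (s - t)"] conjI L2_u_quotient t sJ)
    show "norm_L2 (\<lambda>x. (u s x - u t x) / (s - t) - ut t x) < e" using d(2)[OF sJ] s by auto
    show "AE x in lebesgue. t + R + 2 < norm x \<longrightarrow> (u s x - u t x) / (s - t) = 0"
      using u_vanishes[OF t] u_vanishes[OF sJ] by eventually_elim (use s in auto)
  qed
qed

lemma has_derivative_pairing:
  assumes w: "in_L2 w" and t: "t \<in> J"
  shows "((\<lambda>s. LINT x|lebesgue. u s x * w x) has_real_derivative (LINT x|lebesgue. ut t x * w x)) (at t within J)"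
  unfolding has_field_derivative_iff
proof (rule Lim_null[THEN iffD2], rule Lim_null_comparison)
  show "((\<lambda>s. norm_L2 (\<lambda>x. (u s x - u t x) / (s - t) - ut t x) * norm_L2 w) \<longlongrightarrow> 0) (at t within J)"
    using tendsto_mult_right[OF u_differentiable[OF t], of "norm_L2 w"] by simp
  have "norm (((LINT x|lebesgue. u s x * w x) - (LINT x|lebesgue. u t x * w x)) / (s - t)
        - (LINT x|lebesgue. ut t x * w x))
      \<le> norm_L2 (\<lambda>x. (u s x - u t x) / (s - t) - ut t x) * norm_L2 w" if s: "s \<in> J" for s
  proof -
    note i = integrable_L2_product[OF L2_u[OF s] w] integrable_L2_product[OF L2_u[OF t] w]
      integrable_L2_product[OF L2_ut[OF t] w]
    have "((LINT x|lebesgue. u s x * w x) - (LINT x|lebesgue. u t x * w x)) / (s - t)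
        - (LINT x|lebesgue. ut t x * w x)
        = (LINT x|lebesgue. (u s x * w x - u t x * w x) / (s - t) - ut t x * w x)"
      using i by simp
    also have "\<dots> = (LINT x|lebesgue. ((u s x - u t x) / (s - t) - ut t x) * w x)"
      by (simp add: left_diff_distrib diff_divide_distrib)
    finally show ?thesis
      using L2_Cauchy_Schwarz[OF in_L2_diff[OF L2_u_quotient[OF t s] L2_ut[OF t]] w] by simp
  qed
  then show "\<forall>\<^sub>F s in at t within J.
      norm (((LINT x|lebesgue. u s x * w x) - (LINT x|lebesgue. u t x * w x)) / (s - t)
        - (LINT x|lebesgue. ut t x * w x))
      \<le> norm_L2 (\<lambda>x. (u s x - u t x) / (s - t) - ut t x) * norm_L2 w"
    by (auto simp: eventually_at_filter)
qed

lemma pairing_cong: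
  assumes t: "t \<in> J" and eq: "\<And>x. norm x \<le> t + R + 2 \<Longrightarrow> w x = w' x"
    and "w \<in> borel_measurable borel" and "w' \<in> borel_measurable borel"
  shows "(LINT x|lebesgue. u t x * w x) = (LINT x|lebesgue. u t x * w' x)"
    and "(LINT x|lebesgue. ut t x * w x) = (LINT x|lebesgue. ut t x * w' x)"
    and "(LINT x|lebesgue. source t x * w x) = (LINT x|lebesgue. source t x * w' x)"
    and "integrable lebesgue (\<lambda>x. source t x * w x) \<longleftrightarrow> integrable lebesgue (\<lambda>x. source t x * w' x)"
proof -
  have [measurable]: "u t \<in> borel_measurable lebesgue" "ut t \<in> borel_measurable lebesgue"
    "w \<in> borel_measurable lebesgue" "w' \<in> borel_measurable lebesgue"
    using L2_u[OF t] L2_ut[OF t] assms(3,4) by (auto simp: in_L2_def intro: measurable_completion)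
  have ae: "AE x in lebesgue. w x = w' x \<or> u t x = 0 \<and> ut t x = 0"
    using u_vanishes[OF t] ut_vanishes[OF t]
  proof eventually_elim
    case (elim x)
    then show ?case using eq[of x] by (cases "norm x \<le> t + R + 2") auto
  qed
  show "(LINT x|lebesgue. u t x * w x) = (LINT x|lebesgue. u t x * w' x)"
    by (rule integral_cong_AE) (use ae in \<open>auto elim!: eventually_mono\<close>)
  show "(LINT x|lebesgue. ut t x * w x) = (LINT x|lebesgue. ut t x * w' x)"
    by (rule integral_cong_AE) (use ae in \<open>auto elim!: eventually_mono\<close>)
  show "(LINT x|lebesgue. source t x * w x) = (LINT x|lebesgue. source t x * w' x)"
    by (rule integral_cong_AE) (use ae in \<open>auto elim!: eventually_mono\<close>)
  show "integrable lebesgue (\<lambda>x. source t x * w x) \<longleftrightarrow> integrable lebesgue (\<lambda>x. source t x * w' x)"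
    by (rule integrable_cong_AE) (use ae in \<open>auto elim!: eventually_mono\<close>)
qed

text \<open>A weight without decay is admissible because up to time \<open>b\<close> it may be replaced by a cut-off of itself.\<close>

lemma pairing_has_derivative:
  fixes \<Psi> :: "'a \<Rightarrow> real"
  assumes \<Psi>: "\<And>k. C_k k \<Psi>" and b: "b \<in> J" and t: "t \<in> {0..b}"
  shows "((\<lambda>s. LINT x|lebesgue. u s x * \<Psi> x) has_real_derivative (LINT x|lebesgue. ut t x * \<Psi> x))
    (at t within {0..b})"
proof -
  define r where "r = b + R + 2"
  have "0 \<le> r" using b R by (simp add: r_def time_ivl_def)
  then obtain \<eta> :: "'a \<Rightarrow> real" where \<eta>: "\<And>k. C_k k \<eta>" "\<And>x. 0 \<le> \<eta> x"
    "\<And>x. norm x \<le> r \<Longrightarrow> \<eta> x = 1" "\<And>x. r + 1 \<le> norm x \<Longrightarrow> \<eta> x = 0"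
    using ex_ball_cutoff[where 'a = 'a] by metis
  define X where "X x = \<eta> x * \<Psi> x" for x
  have X: "C_k k X" for k unfolding X_def by (intro C_k_mult \<eta> \<Psi>)
  have L2X: "in_L2 X"
    by (rule in_L2_continuous_compact_support[OF C_k_imp_continuous[OF X], of "cball 0 (r + 1)"])
       (use \<eta>(4) in \<open>auto simp: X_def\<close>)
  have m: "X \<in> borel_measurable borel" "\<Psi> \<in> borel_measurable borel"
    using C_k_imp_continuous[OF X] C_k_imp_continuous[OF \<Psi>] by (auto intro: borel_measurable_continuous_onI)
  have J: "s \<in> J" if "s \<in> {0..b}" for s using time_ivl_downward[OF b] that by auto
  have eq: "(LINT x|lebesgue. u s x * X x) = (LINT x|lebesgue. u s x * \<Psi> x)"
    "(LINT x|lebesgue. ut s x * X x) = (LINT x|lebesgue. ut s x * \<Psi> x)" if s: "s \<in> {0..b}" for s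
    by (rule pairing_cong[OF J[OF s] _ m]; use s \<eta>(3) in \<open>simp add: X_def r_def\<close>)+
  have "((\<lambda>s. LINT x|lebesgue. u s x * X x) has_real_derivative (LINT x|lebesgue. ut t x * X x)) (at t within {0..b})"
    by (rule DERIV_subset[OF has_derivative_pairing[OF L2X J[OF t]]]) (use J in auto)
  then show ?thesis
    unfolding eq(2)[OF t] by (rule has_field_derivative_transform_within[OF _ zero_less_one t]) (simp add: eq(1))
qed

text \<open>The test function is \<open>X(x) Z(s)\<close>, where \<open>X\<close> is a cut-off of \<open>\<Psi>\<close> and \<open>Z\<close> is a cut-off of
\<open>(1 + s) powr \<mu>\<close>. Since \<open>Z' = \<mu>/(1 + s) Z\<close> on \<open>[0, t]\<close>, the term with the time derivative of the test function cancels the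
damping term.\<close>

lemma weighted_identity:
  fixes \<Psi> :: "'a \<Rightarrow> real" and \<sigma> :: real
  defines "G \<equiv> \<lambda>s. LINT x|lebesgue. u s x * \<Psi> x" and "G' \<equiv> \<lambda>s. LINT x|lebesgue. ut s x * \<Psi> x"
    and "H \<equiv> \<lambda>s. LINT x|lebesgue. source s x * \<Psi> x"
  assumes \<Psi>: "\<And>k. C_k k \<Psi>" and lap: "\<And>x. laplacian \<Psi> x = \<sigma> * \<Psi> x" and t: "t \<in> J"
  shows "set_integrable lebesgue {0..t} (\<lambda>s. (1 + s) powr \<mu> * H s)"
    and "AE s in lebesgue. s \<in> {0..t} \<longrightarrow> integrable lebesgue (\<lambda>x. source s x * \<Psi> x)"
    and "(1 + t) powr \<mu> * G' t = G' 0 + \<sigma> * integral {0..t} (\<lambda>s. (1 + s) powr \<mu> * G s)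
      + (LINT s:{0..t}|lebesgue. (1 + s) powr \<mu> * H s)"
proof -
  \<comment> \<open>One unit larger than the radius of the support of \<open>ut\<close>, so that \<open>X = \<Psi>\<close> on a neighbourhood of it
    and the Laplacians agree there.\<close>
  define r where "r = t + R + 3"
  have t0: "0 \<le> t" using t by (simp add: time_ivl_def)
  have r0: "0 \<le> r" using t0 R by (simp add: r_def)
  then obtain \<eta> :: "'a \<Rightarrow> real" where \<eta>: "\<And>k. C_k k \<eta>" "\<And>x. 0 \<le> \<eta> x"
    "\<And>x. norm x \<le> r \<Longrightarrow> \<eta> x = 1" "\<And>x. r + 1 \<le> norm x \<Longrightarrow> \<eta> x = 0"
    using ex_ball_cutoff[where 'a = 'a] by metis
  define X where "X x = \<eta> x * \<Psi> x" for x
  have X: "C_k k X" for k unfolding X_def by (intro C_k_mult \<eta> \<Psi>)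
  have X0: "X x = 0" if "r + 1 < norm x" for x using \<eta>(4)[of x] that by (simp add: X_def)
  have X_eq: "X x = \<Psi> x" if "norm x \<le> r" for x using \<eta>(3)[OF that] by (simp add: X_def)
  have lapX: "laplacian X x = \<sigma> * \<Psi> x" if "norm x < r" for x
  proof -
    have 1: "frechet_derivative X (at z) = frechet_derivative \<Psi> (at z)" if "z \<in> ball 0 r" for z
      by (rule frechet_derivative_cong_open[OF open_ball that]) (simp add: X_eq)
    have "frechet_derivative (\<lambda>z. frechet_derivative X (at z) b) (at x)
        = frechet_derivative (\<lambda>z. frechet_derivative \<Psi> (at z) b) (at x)" for b
      by (rule frechet_derivative_cong_open[OF open_ball[of 0 r]]) (use that 1 in auto)
    then show ?thesis by (simp add: lap)
  qed
  obtain t' where t': "t < t'" "t' \<in> J" using time_ivl_extend[OF t] .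
  define a where "a = (t + t') / 2"
  have a: "t < a" "a < t'" using t' by (auto simp: a_def)
  obtain \<zeta> :: "real \<Rightarrow> real" where \<zeta>: "\<And>k. C_k k \<zeta>" "\<And>s. 0 \<le> \<zeta> s"
    "\<And>s. - (1/4) \<le> s \<Longrightarrow> s \<le> a \<Longrightarrow> \<zeta> s = 1"
    "\<And>s. s \<le> - (1/2) \<Longrightarrow> \<zeta> s = 0" "\<And>s. s \<ge> t' \<Longrightarrow> \<zeta> s = 0"
    using ex_interval_cutoff[OF a(2)] by metis
  define Z where "Z s = \<zeta> s * (1 + s) powr \<mu>" for s
  have Z: "C_k k Z" for k unfolding Z_def by (rule C_k_cutoff_mult_powr[OF \<zeta>(1,4)])
  have Z_eq: "Z s = (1 + s) powr \<mu>" if "- (1/4) \<le> s" "s \<le> a" for s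
    using \<zeta>(3)[OF that] by (simp add: Z_def)
  have Z': "(Z has_real_derivative \<mu> * (1 + s) powr (\<mu> - 1)) (at s)" if "s \<in> {0..t}" for s
  proof (rule has_field_derivative_transform_within_open[where S = "{- (1/4)<..<a}"])
    show "((\<lambda>s. (1 + s) powr \<mu>) has_real_derivative \<mu> * (1 + s) powr (\<mu> - 1)) (at s)"
      using that by (auto intro!: derivative_eq_intros)
  qed (use that a Z_eq in auto)
  define \<Phi> where "\<Phi> = (\<lambda>(x::'a, s). X x * Z s)"
  have \<Phi>: "spacetime_test_function T \<Phi>"
    unfolding \<Phi>_def
  proof (rule spacetime_test_function_product[where K = "cball 0 (r + 1)" and a = "- (1/2)" and b = t'])
    show "Z s = 0" if "s \<notin> {- (1/2)..t'}" for s
      using that \<zeta>(4)[of s] \<zeta>(5)[of s] by (auto simp: Z_def)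
    show "ereal t' < T" using t' by (simp add: time_ivl_def)
  qed (use X Z X0 in auto)
  have J: "s \<in> J" if "s \<in> {0..t}" for s using time_ivl_downward[OF t] that by auto
  have m: "X \<in> borel_measurable borel" "\<Psi> \<in> borel_measurable borel"
    using C_k_imp_continuous[OF X] C_k_imp_continuous[OF \<Psi>] by (auto intro: borel_measurable_continuous_onI)
  have ut_eq: "(LINT x|lebesgue. ut s x * X x) = G' s"
    and source_eq: "(LINT x|lebesgue. source s x * X x) = H s"
    and int_eq: "integrable lebesgue (\<lambda>x. source s x * X x) \<longleftrightarrow> integrable lebesgue (\<lambda>x. source s x * \<Psi> x)"
    if s: "s \<in> {0..t}" for s
    unfolding G'_def H_def by (rule pairing_cong[OF J[OF s] _ m]; use s X_eq in \<open>simp add: r_def\<close>)+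
  have lap_eq: "(LINT x|lebesgue. weak_grad (u s) x \<bullet> grad X x) = - (\<sigma> * G s)" if s: "s \<in> {0..t}" for s
  proof -
    have "(LINT x|lebesgue. u s x * laplacian X x) = (LINT x|lebesgue. u s x * (\<sigma> * \<Psi> x))"
    proof (rule pairing_cong(1)[OF J[OF s]])
      show "laplacian X x = \<sigma> * \<Psi> x" if "norm x \<le> s + R + 2" for x
        by (rule lapX) (use s that in \<open>simp add: r_def\<close>)
      have "C_k 0 (laplacian X)"
      proof (rule C_k_sum)
        show "C_k 0 (\<lambda>x. frechet_derivative (\<lambda>z. frechet_derivative X (at z) b) (at x) b)" for b
          using X[of 2] by (simp add: numeral_2_eq_2)
      qed simp
      then show "laplacian X \<in> borel_measurable borel" by (auto intro: borel_measurable_continuous_onI)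
    qed (use m in measurable)
    also have "\<dots> = (LINT x|lebesgue. \<sigma> * (u s x * \<Psi> x))" by (simp add: mult_ac)
    also have "\<dots> = \<sigma> * G s" by (simp add: G_def)
    finally show ?thesis
      using weak_gradient_laplacian[OF H1[OF J[OF s]] X X0] by simp
  qed
  have grad\<Phi>: "grad (\<lambda>y. \<Phi> (y, s)) x = Z s *\<^sub>R grad X x" for s x
  proof -
    obtain X' where X': "\<And>x. (X has_derivative X' x) (at x)" using C_k_SucE[OF X[of 1, unfolded One_nat_def]] by metis
    have "((\<lambda>y. \<Phi> (y, s)) has_derivative (\<lambda>v. X' x v * Z s)) (at x)"
      unfolding \<Phi>_def using has_derivative_mult_left[OF X'[of x], of "Z s"] by simp
    then have 1: "frechet_derivative (\<lambda>y. \<Phi> (y, s)) (at x) = (\<lambda>v. X' x v * Z s)"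
      by (rule frechet_derivative_at[symmetric])
    have 2: "frechet_derivative X (at x) = X' x" by (rule frechet_derivative_at[OF X', symmetric])
    show ?thesis by (simp add: grad_def 1 2 scaleR_sum_right mult.commute)
  qed
  have deriv\<Phi>: "deriv (\<lambda>\<tau>. \<Phi> (x, \<tau>)) s = X x * (\<mu> * (1 + s) powr (\<mu> - 1))" if "s \<in> {0..t}" for s x
    unfolding \<Phi>_def using DERIV_cmult[OF Z'[OF that], of "X x"] by (auto intro: DERIV_imp_deriv)
  have Z_t: "Z s = (1 + s) powr \<mu>" if "s \<in> {0..t}" for s using Z_eq[of s] that a by auto

  have I1: "(LINT s:{0..t}|lebesgue. LINT x|lebesgue. ut s x * deriv (\<lambda>\<tau>. \<Phi> (x, \<tau>)) s)
      = (LINT s:{0..t}|lebesgue. (\<mu> * (1 + s) powr (\<mu> - 1)) * G' s)"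
  proof (rule set_lebesgue_integral_cong, simp, intro allI impI)
    fix s assume s: "s \<in> {0..t}"
    have "(LINT x|lebesgue. ut s x * deriv (\<lambda>\<tau>. \<Phi> (x, \<tau>)) s)
        = (LINT x|lebesgue. (\<mu> * (1 + s) powr (\<mu> - 1)) * (ut s x * X x))"
      by (simp only: deriv\<Phi>[OF s] mult_ac)
    then show "(LINT x|lebesgue. ut s x * deriv (\<lambda>\<tau>. \<Phi> (x, \<tau>)) s) = (\<mu> * (1 + s) powr (\<mu> - 1)) * G' s"
      by (simp add: ut_eq[OF s])
  qed
  have I2: "(LINT s:{0..t}|lebesgue. LINT x|lebesgue. \<mu> / (1 + s) * ut s x * \<Phi> (x, s))
      = (LINT s:{0..t}|lebesgue. (\<mu> * (1 + s) powr (\<mu> - 1)) * G' s)"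
  proof (rule set_lebesgue_integral_cong, simp, intro allI impI)
    fix s assume s: "s \<in> {0..t}"
    have "(1 + s) powr (\<mu> - 1) = (1 + s) powr \<mu> / (1 + s)" using s by (simp add: powr_diff)
    then have "(LINT x|lebesgue. \<mu> / (1 + s) * ut s x * \<Phi> (x, s))
        = (LINT x|lebesgue. (\<mu> * (1 + s) powr (\<mu> - 1)) * (ut s x * X x))"
      by (simp add: \<Phi>_def Z_t[OF s] mult_ac)
    then show "(LINT x|lebesgue. \<mu> / (1 + s) * ut s x * \<Phi> (x, s)) = (\<mu> * (1 + s) powr (\<mu> - 1)) * G' s"
      by (simp add: ut_eq[OF s])
  qed
  have I3: "(LINT s:{0..t}|lebesgue. LINT x|lebesgue. weak_grad (u s) x \<bullet> grad (\<lambda>y. \<Phi> (y, s)) x)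
      = (LINT s:{0..t}|lebesgue. (- \<sigma>) * ((1 + s) powr \<mu> * G s))"
  proof (rule set_lebesgue_integral_cong)
    show "\<forall>s. s \<in> {0..t} \<longrightarrow> (LINT x|lebesgue. weak_grad (u s) x \<bullet> grad (\<lambda>y. \<Phi> (y, s)) x) = (- \<sigma>) * ((1 + s) powr \<mu> * G s)"
      by (auto simp: grad\<Phi> lap_eq Z_t)
  qed simp
  have H_eq: "(LINT x|lebesgue. source s x * \<Phi> (x, s)) = (1 + s) powr \<mu> * H s" if "s \<in> {0..t}" for s
  proof -
    have "(LINT x|lebesgue. source s x * \<Phi> (x, s)) = (LINT x|lebesgue. (1 + s) powr \<mu> * (source s x * X x))"
      by (simp add: \<Phi>_def Z_t[OF that] mult_ac)
    then show ?thesis by (simp add: source_eq[OF that])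
  qed
  have I4: "(LINT s:{0..t}|lebesgue. LINT x|lebesgue. source s x * \<Phi> (x, s))
      = (LINT s:{0..t}|lebesgue. (1 + s) powr \<mu> * H s)"
    by (rule set_lebesgue_integral_cong) (use H_eq in auto)
  have contG: "continuous_on {0..t} G"
    using pairing_has_derivative[OF \<Psi> t] unfolding G_def
    by (meson DERIV_continuous continuous_on_eq_continuous_within)
  have "(\<lambda>s. (1 + s) powr \<mu> * G s) absolutely_integrable_on {0..t}"
    by (rule absolutely_integrable_continuous_real) (auto intro!: continuous_intros contG)
  then have I5: "(LINT s:{0..t}|lebesgue. (- \<sigma>) * ((1 + s) powr \<mu> * G s))
      = - \<sigma> * integral {0..t} (\<lambda>s. (1 + s) powr \<mu> * G s)"
    unfolding set_integral_mult_right by (simp only: set_lebesgue_integral_eq_integral(2))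
  have I6: "(LINT x|lebesgue. ut s x * \<Phi> (x, s)) = (1 + s) powr \<mu> * G' s" if "s \<in> {0..t}" for s
  proof -
    have "(LINT x|lebesgue. ut s x * \<Phi> (x, s)) = (LINT x|lebesgue. (1 + s) powr \<mu> * (ut s x * X x))"
      by (simp add: \<Phi>_def Z_t[OF that] mult_ac)
    then show ?thesis by (simp add: ut_eq[OF that])
  qed
  have I7: "(LINT x|lebesgue. ut t x * \<Phi> (x, t)) = (1 + t) powr \<mu> * G' t"
    by (rule I6) (use t0 in simp)
  have I8: "(LINT x|lebesgue. ut 0 x * \<Phi> (x, 0)) = G' 0"
    using I6[of 0] t0 by simp
  show "(1 + t) powr \<mu> * G' t = G' 0 + \<sigma> * integral {0..t} (\<lambda>s. (1 + s) powr \<mu> * G s)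
      + (LINT s:{0..t}|lebesgue. (1 + s) powr \<mu> * H s)"
    using weak[OF \<Phi> t] unfolding I1 I2 I3 I4 I5 I7 I8 by linarith

  have "integrable lebesgue (\<lambda>z. indicator (UNIV \<times> {0..t}) z * (\<lambda>(x, s). source s x * \<Phi> (x, s)) z)"
    using source_integrable[OF \<Phi> t] by (simp add: set_integrable_def)
  note F = lebesgue_Fubini_snd[OF this]
  have sec: "(\<lambda>x. indicator (UNIV \<times> {0..t}) (x, s) * (\<lambda>(x, s). source s x * \<Phi> (x, s)) (x, s))
      = (\<lambda>x. indicator {0..t} s * ((1 + s) powr \<mu> * (source s x * X x)))" for s
    using Z_t[of s] by (auto simp: indicator_def \<Phi>_def fun_eq_iff)
  show "set_integrable lebesgue {0..t} (\<lambda>s. (1 + s) powr \<mu> * H s)"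
  proof -
    have "(LINT x|lebesgue. indicator (UNIV \<times> {0..t}) (x, s) * (\<lambda>(x, s). source s x * \<Phi> (x, s)) (x, s))
        = indicator {0..t} s *\<^sub>R ((1 + s) powr \<mu> * H s)" for s
      unfolding sec by (cases "s \<in> {0..t}") (simp_all add: source_eq)
    with F(2) show ?thesis by (simp add: set_integrable_def)
  qed
  show "AE s in lebesgue. s \<in> {0..t} \<longrightarrow> integrable lebesgue (\<lambda>x. source s x * \<Psi> x)"
    using F(1) unfolding sec
  proof (rule AE_mp, intro AE_I2 impI)
    fix s assume i: "integrable lebesgue (\<lambda>x. indicator {0..t} s * ((1 + s) powr \<mu> * (source s x * X x)))" and s: "s \<in> {0..t}"
    have "integrable lebesgue (\<lambda>x. (1 + s) powr \<mu> * (source s x * X x))" using i s by simp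
    then have "integrable lebesgue (\<lambda>x. 1 / (1 + s) powr \<mu> * ((1 + s) powr \<mu> * (source s x * X x)))"
      by (rule integrable_mult_right)
    then have "integrable lebesgue (\<lambda>x. source s x * X x)" using s by simp
    then show "integrable lebesgue (\<lambda>x. source s x * \<Psi> x)" using int_eq[OF s] by blast
  qed
qed

end

section \<open>Lower bounds for the source term\<close>

text \<open>Hoelder's inequality for a function supported in a ball, with the nonlinear term enlarged to the whole
source.\<close>

lemma Holder_on_ball:
  fixes v w S :: "'a::euclidean_space \<Rightarrow> real"
  assumes "1 < e" and [measurable]: "v \<in> borel_measurable lebesgue" and S: "integrable lebesgue S"
    and vS: "\<And>x. \<bar>v x\<bar> powr e \<le> S x" and v0: "AE x in lebesgue. \<rho> < norm x \<longrightarrow> v x = 0"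
    and w: "continuous_on UNIV w" "\<And>x. 0 \<le> w x"
    and W: "(\<integral>\<^sup>+x. ennreal (w x powr (e / (e - 1))) * indicator (cball 0 \<rho>) x \<partial>lborel) \<le> ennreal W" "0 < W"
    and "0 \<le> m" and m: "m \<le> (LINT x|lebesgue. v x * w x)"
  shows "m powr e * W powr - (e - 1) \<le> (LINT x|lebesgue. S x)"
proof -
  define \<sigma> where "\<sigma> = e / (e - 1)"
  define w' where "w' x = indicator (cball 0 \<rho>) x * w x" for x
  have [measurable]: "w \<in> borel_measurable borel" using w(1) by (rule borel_measurable_continuous_onI)
  have cb [measurable]: "cball (0::'a) \<rho> \<in> sets borel" by simp
  have w'm: "w' \<in> borel_measurable borel" unfolding w'_def by measurable
  then have [measurable]: "w' \<in> borel_measurable lebesgue" "w \<in> borel_measurable lebesgue"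
    by (auto intro: measurable_completion)
  have nn: "(\<integral>\<^sup>+x. ennreal (w' x powr \<sigma>) \<partial>lborel) \<le> ennreal W"
  proof -
    have "(\<integral>\<^sup>+x. ennreal (w' x powr \<sigma>) \<partial>lborel) = (\<integral>\<^sup>+x. ennreal (w x powr \<sigma>) * indicator (cball 0 \<rho>) x \<partial>lborel)"
      by (intro nn_integral_cong) (auto simp: w'_def indicator_def)
    with W(1) show ?thesis by (simp add: \<sigma>_def)
  qed
  have w'\<sigma>m: "(\<lambda>x. w' x powr \<sigma>) \<in> borel_measurable borel" using w'm by measurable
  have i: "integrable lborel (\<lambda>x. w' x powr \<sigma>)"
  proof (rule integrableI_nonneg)
    show "(\<integral>\<^sup>+x. ennreal (w' x powr \<sigma>) \<partial>lborel) < \<infinity>"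
      using nn by (rule le_less_trans) simp
  qed (use w'\<sigma>m in auto)
  then have i': "integrable lebesgue (\<lambda>x. w' x powr \<sigma>)"
    using w'\<sigma>m by (simp add: integrable_completion)
  have "(LINT x|lborel. w' x powr \<sigma>) \<le> W"
    using nn nn_integral_eq_integral[OF i] W(2) by (simp add: ennreal_le_iff)
  then have le: "(LINT x|lebesgue. w' x powr \<sigma>) \<le> W"
    using w'\<sigma>m by (simp add: integral_completion)
  have vi: "integrable lebesgue (\<lambda>x. \<bar>v x\<bar> powr e)"
  proof (rule Bochner_Integration.integrable_bound[OF S])
    show "AE x in lebesgue. norm (\<bar>v x\<bar> powr e) \<le> norm (S x)"
      using vS by (intro AE_I2) (auto intro: order_trans[OF _ abs_ge_self])
  qed measurable
  have "(LINT x|lebesgue. v x * w x) = (LINT x|lebesgue. v x * w' x)"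
  proof (rule integral_cong_AE)
    show "AE x in lebesgue. v x * w x = v x * w' x"
      using v0 by eventually_elim (auto simp: w'_def indicator_def)
  qed measurable
  then have "m powr e * W powr - (e - 1) \<le> (LINT x|lebesgue. \<bar>v x\<bar> powr e)"
    using assms(1) vi i' le W(2) \<open>0 \<le> m\<close> m
    by (intro Holder_lower_bound[where w = w']) (auto simp: \<sigma>_def w'_def w(2))
  also have "\<dots> \<le> (LINT x|lebesgue. S x)"
    using vi S vS by (rule integral_mono)
  finally show ?thesis .
qed

lemma positive_pairing:
  fixes v w :: "'a::euclidean_space \<Rightarrow> real"
  assumes v: "in_L2 v" and "AE x in lebesgue. 0 \<le> v x" and v0: "AE x in lebesgue. R < norm x \<longrightarrow> v x = 0"
    and "\<not> (AE x in lebesgue. v x = 0)" and "0 \<le> R"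
    and w: "\<And>k. C_k k w" "\<And>x. 0 < w x"
  shows "0 < (LINT x|lebesgue. v x * w x)"
proof -
  obtain \<eta> :: "'a \<Rightarrow> real" where \<eta>: "\<And>k. C_k k \<eta>" "\<And>x. 0 \<le> \<eta> x"
    "\<And>x. norm x \<le> R \<Longrightarrow> \<eta> x = 1" "\<And>x. R + 1 \<le> norm x \<Longrightarrow> \<eta> x = 0"
    using ex_ball_cutoff[where 'a = 'a, OF \<open>0 \<le> R\<close>] by metis
  have c: "continuous_on UNIV (\<lambda>x. \<eta> x * w x)"
    by (rule C_k_imp_continuous[of 0]) (intro C_k_mult \<eta> w)
  have "in_L2 (\<lambda>x. \<eta> x * w x)"
    by (rule in_L2_continuous_compact_support[OF c, of "cball 0 (R + 1)"]) (use \<eta>(4) in auto)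
  then have 1: "integrable lebesgue (\<lambda>x. v x * (\<eta> x * w x))" by (rule integrable_L2_product[OF v])
  have [measurable]: "v \<in> borel_measurable lebesgue" using v by (simp add: in_L2_def)
  have "w \<in> borel_measurable borel" using C_k_imp_continuous[OF w(1)] by (rule borel_measurable_continuous_onI)
  then have [measurable]: "w \<in> borel_measurable lebesgue" by (auto intro: measurable_completion)
  have i: "integrable lebesgue (\<lambda>x. v x * w x)"
  proof (rule integrable_cong_AE_imp[OF 1])
    show "AE x in lebesgue. v x * (\<eta> x * w x) = v x * w x"
      using v0
    proof eventually_elim
      case (elim x)
      then show ?case using \<eta>(3)[of x] by (cases "norm x \<le> R") auto
    qed
  qed measurable
  have nn: "AE x in lebesgue. 0 \<le> v x * w x"
    using assms(2) by eventually_elim (simp add: w(2) less_imp_le)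
  have "(LINT x|lebesgue. v x * w x) \<noteq> 0"
  proof
    assume "(LINT x|lebesgue. v x * w x) = 0"
    then have "AE x in lebesgue. v x * w x = 0"
      using integral_nonneg_eq_0_iff_AE[OF i nn] by simp
    then have "AE x in lebesgue. v x = 0"
      by eventually_elim (use w(2) in \<open>auto simp: less_le\<close>)
    with assms(4) show False by simp
  qed
  moreover have "0 \<le> (LINT x|lebesgue. v x * w x)" using nn by (rule integral_nonneg_AE)
  ultimately show ?thesis by simp
qed

text \<open>The exponentials cancel because \<open>\<sigma> (p - 1) = p\<close> for the conjugate exponent \<open>\<sigma>\<close>; what remains is the power
\<open>-\<kappa>\<close> of \<open>1 + s\<close>.\<close>

lemma sphere_mean_source_bound:
  fixes p \<mu> \<rho> C A d s :: real
  assumes "1 < p" and "0 < C" and "0 < A" and "0 \<le> \<rho>" and "0 \<le> s" and "0 < \<epsilon>"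
  defines "\<sigma> \<equiv> p / (p - 1)" and "\<beta> \<equiv> - (d * (p / 2 - 1))"
  shows "A powr p * C powr - (p - 1) * exp (- (p * \<rho>)) * (1 + \<rho>) powr (- \<bar>\<beta>\<bar>) * \<epsilon> powr p
      * (1 + s) powr (- (\<mu> * p / 2 - \<beta>))
    \<le> (\<epsilon> * A * exp s * (1 + s) powr (- \<mu> / 2)) powr p
      * (C * (exp (\<sigma> * (s + \<rho>)) * (1 + (s + \<rho>)) powr (d * (1 - \<sigma> / 2)))) powr - (p - 1)"
proof -
  have \<sigma>: "\<sigma> * (p - 1) = p" using assms(1) by (simp add: \<sigma>_def)
  have e1: "(\<epsilon> * A * exp s * (1 + s) powr (- \<mu> / 2)) powr p
      = \<epsilon> powr p * A powr p * exp (p * s) * (1 + s) powr (- (\<mu> * p / 2))"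
  proof -
    have "(\<epsilon> * A * exp s * (1 + s) powr (- \<mu> / 2)) powr p
        = \<epsilon> powr p * A powr p * exp s powr p * ((1 + s) powr (- \<mu> / 2)) powr p"
      using assms by (simp add: powr_mult)
    also have "exp s powr p = exp (p * s)" by (simp add: exp_powr_real mult.commute)
    also have "((1 + s) powr (- \<mu> / 2)) powr p = (1 + s) powr (- (\<mu> * p / 2))" unfolding powr_powr by simp
    finally show ?thesis .
  qed
  have e2: "(C * (exp (\<sigma> * (s + \<rho>)) * (1 + (s + \<rho>)) powr (d * (1 - \<sigma> / 2)))) powr - (p - 1)
      = C powr - (p - 1) * (exp (- (p * s)) * exp (- (p * \<rho>)) * (1 + (s + \<rho>)) powr \<beta>)"
  proof -
    have "(C * (exp (\<sigma> * (s + \<rho>)) * (1 + (s + \<rho>)) powr (d * (1 - \<sigma> / 2)))) powr - (p - 1)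
        = C powr - (p - 1) * (exp (\<sigma> * (s + \<rho>)) powr - (p - 1) * ((1 + (s + \<rho>)) powr (d * (1 - \<sigma> / 2))) powr - (p - 1))"
      using assms by (simp add: powr_mult)
    also have "exp (\<sigma> * (s + \<rho>)) powr - (p - 1) = exp (- (\<sigma> * (p - 1) * (s + \<rho>)))"
      unfolding exp_powr_real by (simp add: algebra_simps)
    also have "- (\<sigma> * (p - 1) * (s + \<rho>)) = - (p * s) + - (p * \<rho>)" unfolding \<sigma> by (simp add: algebra_simps)
    also have "((1 + (s + \<rho>)) powr (d * (1 - \<sigma> / 2))) powr - (p - 1) = (1 + (s + \<rho>)) powr \<beta>"
    proof -
      have "d * (1 - \<sigma> / 2) * - (p - 1) = - (d * ((p - 1) - \<sigma> * (p - 1) / 2))" by (simp add: field_simps)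
      also have "\<dots> = \<beta>" unfolding \<sigma> \<beta>_def by simp
      finally show ?thesis unfolding powr_powr by simp
    qed
    finally show ?thesis unfolding exp_add .
  qed
  have e3: "exp (p * s) * exp (- (p * s)) = 1" by (simp flip: exp_add)
  have "(1 + \<rho>) powr (- \<bar>\<beta>\<bar>) * (1 + s) powr \<beta> \<le> (1 + (s + \<rho>)) powr \<beta>"
  proof (rule powr_comparable)
    have "0 \<le> \<rho> * s" "0 \<le> \<rho> * (s + \<rho>)" using assms by simp_all
    then show "1 + (s + \<rho>) \<le> (1 + \<rho>) * (1 + s)" "1 + s \<le> (1 + \<rho>) * (1 + (s + \<rho>))"
      using assms by (simp_all only: distrib_left distrib_right)
  qed (use assms in auto)
  then have le: "\<epsilon> powr p * A powr p * (1 + s) powr (- (\<mu> * p / 2)) * C powr - (p - 1) * exp (- (p * \<rho>))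
        * ((1 + \<rho>) powr (- \<bar>\<beta>\<bar>) * (1 + s) powr \<beta>)
     \<le> \<epsilon> powr p * A powr p * (1 + s) powr (- (\<mu> * p / 2)) * C powr - (p - 1) * exp (- (p * \<rho>))
        * (1 + (s + \<rho>)) powr \<beta>"
    by (intro mult_left_mono) auto
  have e4: "(1 + s) powr (- (\<mu> * p / 2 - \<beta>)) = (1 + s) powr (- (\<mu> * p / 2)) * (1 + s) powr \<beta>"
    by (simp flip: powr_add)
  have "(\<epsilon> * A * exp s * (1 + s) powr (- \<mu> / 2)) powr p
      * (C * (exp (\<sigma> * (s + \<rho>)) * (1 + (s + \<rho>)) powr (d * (1 - \<sigma> / 2)))) powr - (p - 1)
    = (exp (p * s) * exp (- (p * s))) * (\<epsilon> powr p * A powr p * (1 + s) powr (- (\<mu> * p / 2)) * C powr - (p - 1) * exp (- (p * \<rho>))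
        * (1 + (s + \<rho>)) powr \<beta>)"
    unfolding e1 e2 by (simp only: mult_ac)
  with le show ?thesis unfolding e3 e4 by (simp only: mult_ac mult_1_right mult_1_left)
qed

lemma ball_source_bound:
  fixes q \<rho> V N s x :: real
  assumes "1 < q" and "0 < V" and "1 \<le> \<rho>" and "0 \<le> s"
  defines "\<beta> \<equiv> - N * (q - 1)"
  shows "V powr - (q - 1) * (1 + \<rho>) powr (- \<bar>\<beta>\<bar>) * x powr q * (1 + s) powr \<beta>
    \<le> x powr q * (V * (s + \<rho>) powr N) powr - (q - 1)"
proof -
  have "(V * (s + \<rho>) powr N) powr - (q - 1) = V powr - (q - 1) * (s + \<rho>) powr \<beta>"
  proof -
    have "((s + \<rho>) powr N) powr - (q - 1) = (s + \<rho>) powr \<beta>"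
      unfolding powr_powr by (simp add: \<beta>_def algebra_simps)
    then show ?thesis using assms by (simp add: powr_mult)
  qed
  moreover have "(1 + \<rho>) powr (- \<bar>\<beta>\<bar>) * (1 + s) powr \<beta> \<le> (s + \<rho>) powr \<beta>"
  proof (rule powr_comparable)
    have "0 \<le> \<rho> * s" "0 \<le> \<rho> * (s + \<rho>)" using assms by simp_all
    then show "s + \<rho> \<le> (1 + \<rho>) * (1 + s)" "1 + s \<le> (1 + \<rho>) * (s + \<rho>)"
      using assms by (simp_all only: distrib_left distrib_right)
  qed (use assms in auto)
  then have "x powr q * V powr - (q - 1) * ((1 + \<rho>) powr (- \<bar>\<beta>\<bar>) * (1 + s) powr \<beta>)
      \<le> x powr q * V powr - (q - 1) * (s + \<rho>) powr \<beta>"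
    by (intro mult_left_mono) auto
  ultimately show ?thesis by (simp only: mult_ac)
qed

context supported_solution
begin

text \<open>The identity for the weight \<open>1\<close>, for which the Laplacian drops out.\<close>

lemma average_identity:
  defines "H \<equiv> \<lambda>s. LINT x|lebesgue. source s x" and "F' \<equiv> \<lambda>s. LINT x|lebesgue. ut s x"
  assumes t: "t \<in> J"
  shows "set_integrable lebesgue {0..t} (\<lambda>s. (1 + s) powr \<mu> * H s)"
    and "AE s in lebesgue. s \<in> {0..t} \<longrightarrow> integrable lebesgue (source s)"
    and "(1 + t) powr \<mu> * F' t = F' 0 + (LINT s:{0..t}|lebesgue. (1 + s) powr \<mu> * H s)"
proof -
  have c: "C_k k (\<lambda>x::'a. 1)" for k by (rule C_k_const)
  have l: "laplacian (\<lambda>x::'a. 1) x = 0 * 1" for x by (simp add: frechet_derivative_const)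
  note W = weighted_identity[OF c l t]
  show "set_integrable lebesgue {0..t} (\<lambda>s. (1 + s) powr \<mu> * H s)" using W(1) by (simp add: H_def)
  show "AE s in lebesgue. s \<in> {0..t} \<longrightarrow> integrable lebesgue (source s)" using W(2) by simp
  show "(1 + t) powr \<mu> * F' t = F' 0 + (LINT s:{0..t}|lebesgue. (1 + s) powr \<mu> * H s)"
    using W(3) by (simp add: H_def F'_def)
qed

text \<open>The interface to \<open>lifespan_from_averages\<close>: a lower bound on the source at the times at which it is
integrable suffices, since these are almost all times.\<close>

lemma average_velocity_lower_bound:
  defines "H \<equiv> \<lambda>s. LINT x|lebesgue. source s x" and "F' \<equiv> \<lambda>s. LINT x|lebesgue. ut s x"
  assumes t: "t \<in> J" and a: "0 \<le> a" "a \<le> t" and F'0: "0 \<le> F' 0" and m: "0 \<le> m"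
    and le: "\<And>s. a \<le> s \<Longrightarrow> s \<le> t \<Longrightarrow> integrable lebesgue (source s) \<Longrightarrow> m \<le> (1 + s) powr \<mu> * H s"
  shows "m * (t - a) \<le> (1 + t) powr \<mu> * F' t"
proof -
  have H: "0 \<le> H s" for s unfolding H_def by (rule integral_nonneg_AE) simp
  have "m * (t - a) = (LINT s:{a..t}|lebesgue. m)"
    using a by (simp add: set_lebesgue_integral_def)
  also have "\<dots> \<le> (LINT s:{0..t}|lebesgue. (1 + s) powr \<mu> * H s)"
    unfolding set_lebesgue_integral_def
  proof (rule integral_mono_AE)
    have "integrable lebesgue (indicator {a..t} :: real \<Rightarrow> real)"
      by (rule integrable_real_indicator) (use a in auto)
    then show "integrable lebesgue (\<lambda>s. indicator {a..t} s *\<^sub>R m)" by simp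
    show "integrable lebesgue (\<lambda>s. indicator {0..t} s *\<^sub>R ((1 + s) powr \<mu> * H s))"
      using average_identity(1)[OF t] by (simp add: set_integrable_def H_def)
    show "AE s in lebesgue. indicator {a..t} s *\<^sub>R m \<le> indicator {0..t} s *\<^sub>R ((1 + s) powr \<mu> * H s)"
      using average_identity(2)[OF t]
    proof eventually_elim
      case (elim s)
      then show ?case using le[of s] H[of s] a by (auto simp: indicator_def)
    qed
  qed
  also have "\<dots> \<le> (1 + t) powr \<mu> * F' t"
    using average_identity(3)[OF t] F'0 by (simp add: H_def F'_def)
  finally show ?thesis .
qed

lemma exponential_average_growth:
  defines "G' \<equiv> \<lambda>s. LINT x|lebesgue. ut s x * sphere_mean x"
  assumes "0 < \<mu>" and "0 < A" and "A \<le> (LINT x|lebesgue. u 0 x * sphere_mean x)" and "A \<le> G' 0"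
    and t: "t \<in> J" "1 \<le> t"
  shows "A * (exp (- 1) * 2 powr (- \<mu> / 2) / 4) * exp t * (1 + t) powr (- \<mu> / 2) \<le> G' t"
proof -
  have l: "laplacian sphere_mean x = 1 * sphere_mean x" for x :: 'a
    using laplacian_sphere_mean[of x] by simp
  show ?thesis
  proof (rule damped_exponential_growth(2)[where G = "\<lambda>s. LINT x|lebesgue. u s x * sphere_mean x" and b = t])
    show "((\<lambda>s. LINT x|lebesgue. u s x * sphere_mean x) has_real_derivative G' s) (at s within {0..t})"
      if "s \<in> {0..t}" for s
      unfolding G'_def by (rule pairing_has_derivative[OF C_k_sphere_mean t(1) that])
    show "G' 0 + integral {0..s} (\<lambda>s. (1 + s) powr \<mu> * (LINT x|lebesgue. u s x * sphere_mean x))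
        \<le> (1 + s) powr \<mu> * G' s" if s: "s \<in> {0..t}" for s
    proof -
      have sJ: "s \<in> J" using time_ivl_downward[OF t(1)] s by auto
      have "0 \<le> (LINT x|lebesgue. source r x * sphere_mean x)" for r
        by (rule integral_nonneg_AE) (simp add: sphere_mean_pos less_imp_le)
      then have "0 \<le> (LINT r:{0..s}|lebesgue. (1 + r) powr \<mu> * (LINT x|lebesgue. source r x * sphere_mean x))"
        unfolding set_lebesgue_integral_def by (intro integral_nonneg_AE AE_I2) simp
      with weighted_identity(3)[OF C_k_sphere_mean l sJ] show ?thesis by (simp add: G'_def)
    qed
  qed (use assms in auto)
qed

end

section \<open>The lifespan estimate\<close>

theorem theorem2p2:
  fixes \<mu> R p q :: real and f g :: "real ^ 'n \<Rightarrow> real"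
  assumes "\<mu> > 0" and "R > 0" and "p > 1" and "q > 1"
    and "CARD('n) \<ge> 3 \<Longrightarrow> q \<le> 2 * real CARD('n) / (real CARD('n) - 2)"
    and "lam p q (real CARD('n) + \<mu>) < 4"
    and "p > p_Glassey (real CARD('n) + \<mu>)"
    and "q > q_Strauss (real CARD('n) + \<mu>)"
    and "in_H1 f" and "in_L2 g"
    and "AE x in lebesgue. f x \<ge> 0" and "AE x in lebesgue. g x \<ge> 0"
    and "compact (ess_supp UNIV f)" and "ess_supp UNIV f \<subseteq> ball 0 R"
    and "compact (ess_supp UNIV g)" and "ess_supp UNIV g \<subseteq> ball 0 R"
    and "\<not> (AE x in lebesgue. f x = 0)" and "\<not> (AE x in lebesgue. g x = 0)"
  shows "\<exists>\<epsilon>\<^sub>0>0. \<exists>C>0. \<forall>\<epsilon>. 0 < \<epsilon> \<and> \<epsilon> \<le> \<epsilon>\<^sub>0 \<longrightarrow>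
    (\<forall>(T :: ereal) (u :: real \<Rightarrow> real ^ 'n \<Rightarrow> real).
      energy_solution \<mu> p q (\<lambda>x. \<epsilon> * f x) (\<lambda>x. \<epsilon> * g x) T u \<and>
      ess_supp (UNIV \<times> time_ivl T) (\<lambda>(x, t). u t x)
        \<subseteq> {(x, t). 0 \<le> t \<and> norm x \<le> t + R}
      \<longrightarrow> T \<le> ereal (C * \<epsilon> powr - (2 * p * (q - 1) / (4 - lam p q (real CARD('n) + \<mu>)))))"
proof -
  note \<mu> = assms(1) and R = assms(2) and p = assms(3) and q = assms(4) and lam = assms(6)
  define N where "N = real CARD('n)"
  define d where "d = N - 1"
  define \<sigma> where "\<sigma> = p / (p - 1)"
  define \<beta> where "\<beta> = - (d * (p / 2 - 1))"
  define \<kappa> where "\<kappa> = \<mu> * p / 2 - \<beta>"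
  define \<theta> where "\<theta> = (2 - \<kappa>) * (q - 1) - N * (q - 1) + 2"
  \<comment> \<open>Solution and velocity vanish at time \<open>s\<close> outside the ball of radius \<open>s + \<rho>\<close>.\<close>
  define \<rho> where "\<rho> = R + 2"
  have \<theta>_eq: "\<theta> = (4 - lam p q (N + \<mu>)) / 2"
    by (simp add: \<theta>_def \<kappa>_def \<beta>_def d_def lam_def field_simps)
  then have \<theta>: "0 < \<theta>" using lam by (simp add: N_def)
  have DIM: "real DIM(real ^ 'n) = N" by (simp add: N_def)
  have f: "in_L2 f" using assms(9) by (simp add: in_H1_def)
  have f0: "AE x in lebesgue. R < norm x \<longrightarrow> f x = 0"
    using AE_vanishes_off_ess_supp[of UNIV f] by eventually_elim (use assms(14) in force)
  have g0: "AE x in lebesgue. R < norm x \<longrightarrow> g x = 0"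
    using AE_vanishes_off_ess_supp[of UNIV g] by eventually_elim (use assms(16) in force)
  define f1 where "f1 = (LINT x|lebesgue. f x * sphere_mean x)"
  define g1 where "g1 = (LINT x|lebesgue. g x * sphere_mean x)"
  have "0 < f1"
    unfolding f1_def using R
    by (intro positive_pairing[OF f assms(11) f0 assms(17) _ C_k_sphere_mean sphere_mean_pos]) simp
  moreover have "0 < g1"
    unfolding g1_def using R
    by (intro positive_pairing[OF assms(10,12) g0 assms(18) _ C_k_sphere_mean sphere_mean_pos]) simp
  moreover define c where "c = min f1 g1"
  ultimately have c: "0 < c" "c \<le> f1" "c \<le> g1" by auto
  \<comment> \<open>The weighted average of the velocity will be at least \<open>\<epsilon> A exp t (1 + t) powr (- \<mu>/2)\<close>.\<close>
  define A where "A = c * (exp (- 1) * 2 powr (- \<mu> / 2) / 4)"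
  have A: "0 < A" using c by (simp add: A_def)
  obtain C where C: "0 < C" "\<And>r. 0 \<le> r \<Longrightarrow>
    (\<integral>\<^sup>+x. ennreal (sphere_mean (x :: real ^ 'n) powr \<sigma>) * indicator (cball 0 r) x \<partial>lborel)
      \<le> ennreal (C * (exp (\<sigma> * r) * (1 + r) powr (d * (1 - \<sigma> / 2))))"
    using nn_integral_sphere_mean_powr_le[where 'a = "real ^ 'n", of \<sigma>] p unfolding DIM d_def \<sigma>_def by auto
  define V where "V = unit_ball_vol N"
  have V: "0 < V" by (simp add: V_def N_def)
  define K\<^sub>1 where "K\<^sub>1 = A powr p * C powr - (p - 1) * exp (- (p * \<rho>)) * (1 + \<rho>) powr (- \<bar>\<beta>\<bar>)"
  define K\<^sub>2 where "K\<^sub>2 = V powr - (q - 1) * (1 + \<rho>) powr (- \<bar>- N * (q - 1)\<bar>)"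
  have \<rho>: "2 \<le> \<rho>" using R by (simp add: \<rho>_def)
  have K: "0 < K\<^sub>1" "0 < K\<^sub>2" using A C V \<rho> by (auto simp: K\<^sub>1_def K\<^sub>2_def)
  obtain D where D: "0 < D" "\<And>\<epsilon> b F F' H good. averages \<mu> p q N K\<^sub>1 K\<^sub>2 \<kappa> \<epsilon> b F F' H good
      \<Longrightarrow> b \<le> D * \<epsilon> powr (- (p * (q - 1) / \<theta>))"
    by (rule lifespan_from_averages[OF \<mu> q K \<theta> \<theta>_def, of p]) (use p in auto)
  have exponent: "p * (q - 1) / \<theta> = 2 * p * (q - 1) / (4 - lam p q (N + \<mu>))"
    by (simp add: \<theta>_eq)
  show ?thesis
  proof (rule exI[of _ 1], rule conjI[OF zero_less_one], rule exI[of _ D], intro conjI allI impI)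
    show "0 < D" by (rule D(1))
    fix \<epsilon> :: real and T :: ereal and u :: "real \<Rightarrow> real ^ 'n \<Rightarrow> real"
    assume \<epsilon>: "0 < \<epsilon> \<and> \<epsilon> \<le> 1"
      and sol: "energy_solution \<mu> p q (\<lambda>x. \<epsilon> * f x) (\<lambda>x. \<epsilon> * g x) T u \<and>
      ess_supp (UNIV \<times> time_ivl T) (\<lambda>(x, t). u t x) \<subseteq> {(x, t). 0 \<le> t \<and> norm x \<le> t + R}"
    have "0 \<le> R" using R by simp
    with sol obtain ut where "supported_solution \<mu> p q R T u ut" and ut0: "AE x in lebesgue. ut 0 x = \<epsilon> * g x"
      unfolding energy_solution_def C0_H1_def supported_solution_def by blast
    then interpret supported_solution \<mu> p q R T u ut by simp
    have u0: "AE x in lebesgue. u 0 x = \<epsilon> * f x" and T: "0 < T"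
      using sol by (auto simp: energy_solution_def)
    have J0: "0 \<in> J" using T by (simp add: time_ivl_def zero_ereal_def)
    define F where "F s = (LINT x|lebesgue. u s x)" for s
    define F' where "F' s = (LINT x|lebesgue. ut s x)" for s
    define H where "H s = (LINT x|lebesgue. source s x)" for s
    have m: "u 0 \<in> borel_measurable lebesgue" "ut 0 \<in> borel_measurable lebesgue"
      "f \<in> borel_measurable lebesgue" "g \<in> borel_measurable lebesgue"
      using L2_u[OF J0] L2_ut[OF J0] f assms(10) by (simp_all add: in_L2_def)
    have sphere_mean_measurable: "sphere_mean \<in> borel_measurable (lebesgue :: (real ^ 'n) measure)"
    proof (rule measurable_completion)
      have "sphere_mean \<in> borel_measurable (borel :: (real ^ 'n) measure)"
        by (rule borel_measurable_continuous_onI) (rule C_k_imp_continuous[OF C_k_sphere_mean])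
      then show "sphere_mean \<in> borel_measurable (lborel :: (real ^ 'n) measure)" by simp
    qed
    note [measurable] = m
    have init: "(LINT x|lebesgue. u 0 x * w x) = \<epsilon> * (LINT x|lebesgue. f x * w x)"
      "(LINT x|lebesgue. ut 0 x * w x) = \<epsilon> * (LINT x|lebesgue. g x * w x)"
      if [measurable]: "w \<in> borel_measurable lebesgue" for w
    proof -
      have "(LINT x|lebesgue. u 0 x * w x) = (LINT x|lebesgue. \<epsilon> * (f x * w x))"
        by (rule integral_cong_AE) (use u0 in \<open>auto elim!: eventually_mono\<close>)
      then show "(LINT x|lebesgue. u 0 x * w x) = \<epsilon> * (LINT x|lebesgue. f x * w x)" by simp
      have "(LINT x|lebesgue. ut 0 x * w x) = (LINT x|lebesgue. \<epsilon> * (g x * w x))"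
        by (rule integral_cong_AE) (use ut0 in \<open>auto elim!: eventually_mono\<close>)
      then show "(LINT x|lebesgue. ut 0 x * w x) = \<epsilon> * (LINT x|lebesgue. g x * w x)" by simp
    qed
    have F0: "0 \<le> F 0"
      using init(1)[of "\<lambda>_. 1"] \<epsilon> integral_nonneg_AE[OF assms(11)] by (simp add: F_def)
    have F'0: "0 \<le> F' 0"
      using init(2)[of "\<lambda>_. 1"] \<epsilon> integral_nonneg_AE[OF assms(12)] by (simp add: F'_def)
    have bound: "b \<le> D * \<epsilon> powr (- (p * (q - 1) / \<theta>))" if b: "b \<in> J" for b
    proof (rule D(2)[where F = F and F' = F' and H = H and good = "\<lambda>s. integrable lebesgue (source s)"], unfold_locales)
      show "0 < \<epsilon>" "\<epsilon> \<le> 1" "0 \<le> F 0" using \<epsilon> F0 by auto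
      show "0 \<le> H s" for s unfolding H_def by (rule integral_nonneg_AE) simp
      have J: "s \<in> J" if "0 \<le> s" "s \<le> b" for s using time_ivl_downward[OF b that] .
      show "(F has_real_derivative F' t) (at t within {0..b})" if "t \<in> {0..b}" for t
        using pairing_has_derivative[of "\<lambda>_. 1", OF C_k_const b that] by (simp add: F_def[abs_def] F'_def)
      show "m * (t - a) \<le> (1 + t) powr \<mu> * F' t"
        if "0 \<le> a" "a \<le> t" "t \<le> b" "0 \<le> m"
          "\<And>s. a \<le> s \<Longrightarrow> s \<le> t \<Longrightarrow> integrable lebesgue (source s) \<Longrightarrow> m \<le> (1 + s) powr \<mu> * H s" for a t m
        unfolding F'_def
        by (rule average_velocity_lower_bound[OF J])
           (use that F'0 in \<open>auto simp: F'_def H_def\<close>)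
      show "K\<^sub>1 * \<epsilon> powr p * (1 + s) powr (- \<kappa>) \<le> H s"
        if s: "1 \<le> s" "s \<le> b" "integrable lebesgue (source s)" for s
      proof -
        have sJ: "s \<in> J" using J s by simp
        have growth: "\<epsilon> * A * exp s * (1 + s) powr (- \<mu> / 2) \<le> (LINT x|lebesgue. ut s x * sphere_mean x)"
        proof -
          have "\<epsilon> * c * (exp (- 1) * 2 powr (- \<mu> / 2) / 4) * exp s * (1 + s) powr (- \<mu> / 2)
              \<le> (LINT x|lebesgue. ut s x * sphere_mean x)"
            by (rule exponential_average_growth[OF \<mu> _ _ _ sJ s(1)])
               (use \<epsilon> c in \<open>auto simp: init sphere_mean_measurable simp flip: f1_def g1_def\<close>)
          then show ?thesis by (simp add: A_def mult_ac)
        qed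
        have "K\<^sub>1 * \<epsilon> powr p * (1 + s) powr (- \<kappa>) \<le> (\<epsilon> * A * exp s * (1 + s) powr (- \<mu> / 2)) powr p
            * (C * (exp (\<sigma> * (s + \<rho>)) * (1 + (s + \<rho>)) powr (d * (1 - \<sigma> / 2)))) powr - (p - 1)"
          unfolding K\<^sub>1_def \<kappa>_def \<beta>_def \<sigma>_def using p C(1) A \<rho> s \<epsilon>
          by (intro sphere_mean_source_bound) auto
        also have "\<dots> \<le> (LINT x|lebesgue. source s x)"
        proof (rule Holder_on_ball[OF p _ s(3) _ _ C_k_imp_continuous[OF C_k_sphere_mean] _ _ _ _ growth])
          show "ut s \<in> borel_measurable lebesgue" using L2_ut[OF sJ] by (simp add: in_L2_def)
          show "AE x in lebesgue. s + \<rho> < norm x \<longrightarrow> ut s x = 0"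
            using ut_vanishes[OF sJ] by (simp add: \<rho>_def add.assoc)
          show "(\<integral>\<^sup>+x. ennreal (sphere_mean (x :: real ^ 'n) powr (p / (p - 1))) * indicator (cball 0 (s + \<rho>)) x \<partial>lborel)
            \<le> ennreal (C * (exp (\<sigma> * (s + \<rho>)) * (1 + (s + \<rho>)) powr (d * (1 - \<sigma> / 2))))"
            using C(2)[of "s + \<rho>"] s \<rho> by (simp add: \<sigma>_def)
          show "0 < C * (exp (\<sigma> * (s + \<rho>)) * (1 + (s + \<rho>)) powr (d * (1 - \<sigma> / 2)))"
            using C(1) s \<rho> by simp
          show "0 \<le> \<epsilon> * A * exp s * (1 + s) powr (- \<mu> / 2)" using \<epsilon> A by simp
        qed (simp_all add: sphere_mean_pos less_imp_le)
        finally show ?thesis by (simp add: H_def)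
      qed
      show "K\<^sub>2 * F s powr q * (1 + s) powr (- N * (q - 1)) \<le> H s"
        if s: "0 \<le> s" "s \<le> b" "integrable lebesgue (source s)" "0 \<le> F s" for s
      proof -
        have sJ: "s \<in> J" using J s by simp
        have "K\<^sub>2 * F s powr q * (1 + s) powr (- N * (q - 1))
            \<le> F s powr q * (V * (s + \<rho>) powr N) powr - (q - 1)"
          unfolding K\<^sub>2_def using q V \<rho> s by (intro ball_source_bound) auto
        also have "\<dots> \<le> (LINT x|lebesgue. source s x)"
        proof (rule Holder_on_ball[OF q _ s(3), where w = "\<lambda>_. 1" and v = "u s" and \<rho> = "s + \<rho>"])
          show "u s \<in> borel_measurable lebesgue" using L2_u[OF sJ] by (simp add: in_L2_def)
          show "AE x in lebesgue. s + \<rho> < norm x \<longrightarrow> u s x = 0"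
            using u_vanishes[OF sJ] by eventually_elim (simp add: \<rho>_def)
          have "(s + \<rho>) powr N = (s + \<rho>) ^ CARD('n)"
            using s \<rho> by (simp add: N_def powr_realpow)
          then show "(\<integral>\<^sup>+x. ennreal (1 powr (q / (q - 1))) * indicator (cball (0 :: real ^ 'n) (s + \<rho>)) x \<partial>lborel)
              \<le> ennreal (V * (s + \<rho>) powr N)"
            using s \<rho> by (simp add: emeasure_cball V_def N_def)
          show "0 < V * (s + \<rho>) powr N" using V s \<rho> by simp
        qed (use s in \<open>auto simp: F_def\<close>)
        finally show ?thesis by (simp add: H_def)
      qed
    qed
    show "T \<le> ereal (D * \<epsilon> powr - (2 * p * (q - 1) / (4 - lam p q (real CARD('n) + \<mu>))))"
    proof (rule ccontr)
      assume "\<not> ?thesis"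
      then have "ereal (D * \<epsilon> powr (- (p * (q - 1) / \<theta>))) < T"
        by (simp only: exponent N_def not_le)
      then obtain b where b: "ereal (D * \<epsilon> powr (- (p * (q - 1) / \<theta>))) < ereal b" "ereal b < T"
        using ereal_dense2 by blast
      have "0 \<le> D * \<epsilon> powr (- (p * (q - 1) / \<theta>))" using D(1) by simp
      then have "b \<in> J" using b by (simp add: time_ivl_def)
      from bound[OF this] b show False by simp
    qed
  qed
qed

end
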